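(* Let $k\ge2$ be an integer, $N\geq 1$, and let $\mathcal{G}$ be a congruence subgroup of $\mathrm{SL}_2(\mathbb{Z})$ containing $\Gamma(N)$. Let $\mathbb{k}$ be a subfield of $\mathbb{C}$ containing $\mathbb{Q}(\zeta_N)$, where $\zeta_N=\exp(2\pi i/N)$. Then each element of $\mathcal{E}_k(\mathcal{G},\mathbb{k})$ admits a Fourier expansion of the form \[\sum_{j\ge0}A_j\exp\Big(\frac{2\pi i j\tau}{N}\Big)\quad\text{with } A_j\in\mathbb{k}.\] In particular, each element of the spectral basis $\mathcal{B}_{\mathcal{G},k}$ has its Fourier coefficients in $\mathbb{Q}(\zeta_N)$.
   Context: Notation: $\Gamma=\mathrm{SL}_2(\mathbb{Z})$ acts on the upper half plane $\mathbb{H}$; $(f|_{k,\gamma})(\tau)=(c\tau+d)^{-k}f(\frac{a\tau+b}{c\tau+d})$ for $\gamma=\begin{pmatrix}a&b\\c&d\end{pmatrix}\in\Gamma$; $\mathrm{Hol}(\mathbb{H})$ is the space of holomorphic functions on $\mathbb{H}$; $\Gamma(N)$ is the principal congruence subgroup of level $N$. Eisenstein series on $\Gamma(N)$: let $\Lambda_N$ be the set of elements of additive order $N$ in $\mathbb{Z}^2/N\mathbb{Z}^2$ (row vectors). Put $\epsilon_N=1$ if $N\ge3$ and $\epsilon_N=\frac12$ if $N\in\{1,2\}$. For $\bar\lambda\in\Lambda_N$ with lift $\lambda\in\mathbb{Z}^2$, \[E_k(\tau,\bar\lambda,N;s)=\epsilon_N\sum_{(c,d)\equiv\lambda\,(N),\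 \gcd(c,d)=1}\frac{\mathrm{Im}(\tau)^s}{(c\tau+d)^k|c\tau+d|^{2s}}\qquad(\mathrm{Re}(k+2s)>2),\] which continues analytically in $s$ to $\mathrm{Re}(k+2s)>1$; $E_k(\tau,\bar\lambda,N)$ is its value at $s=0$. Spaces: $\mathcal{E}^*_k(\Gamma(N),\mathbb{k})$ is the $\mathbb{k}$-span of $\{E_k(\cdot,\bar\lambda,N):\bar\lambda\in\Lambda_N\}$ in the space of real analytic functions on $\mathbb{H}$; $\mathcal{E}^*_k(\mathcal{G},\mathbb{k})$ is its subspace of $|_k$-invariants under $\mathcal{G}$; and $\mathcal{E}_k(\mathcal{G},\mathbb{k})=\mathcal{E}^*_k(\mathcal{G},\mathbb{k})\cap\mathrm{Hol}(\mathbb{H})$. Cusps: a cusp of $\mathcal{G}$ is a $\mathcal{G}$-orbit in $\mathbb{P}^1(\mathbb{Q})$, denoted by a fixed representative $x$; $\mathcal{C}(\mathcal{G})$ is the set of cusps. With $T=\begin{pmatrix}1&1\\0&1\end{pmatrix}$ and $\gamma\in\Gamma$ with $\gamma\infty=x$, the cusp $x$ is irregular if $\gamma^{-1}\mathcal{G}_x\gamma=\langle -T^h\rangle$ for some $h\ge1$ and regular otherwise; $\mathcal{C}_\infty(\mathcal{G})$ is the set of regular cusps. $\mathrm{or}_{\mathcal{G},N}(x)$ denotes the set of cusps of $\Gamma(N)$ contained in $\mathcal{G}x$. For $x\in\mathbb{P}^1(\mathbb{Q})$, $\mathrm{amp}(x,\mathcal{G})=[\Gamma_x:\mathcal{G}_x^{\pm}]$,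 where $\mathcal{G}_x^\pm$ is generated by $\mathcal{G}_x$ and $-\mathrm{Id}$; $x_0$ is a fixed cusp such that $\mathrm{amp}(x_0,\mathcal{G})$ divides $\mathrm{amp}(x,\mathcal{G})$ for every $x\in\mathcal{C}(\mathcal{G})$ (such $x_0$ exists by a theorem of Larcher). Spectral Eisenstein series: choose a scaling matrix $\sigma_x\in\Gamma$ with $\sigma_x\infty=x$ and set \[E_{k,x}(\tau;s)=\sum_{\gamma\in\mathcal{G}_x\backslash\mathcal{G}}\mathbf{j}(\sigma_x^{-1}\gamma,\tau)^{-k}\,(\mathrm{Im}\,\sigma_x^{-1}\gamma\tau)^s\quad(\mathrm{Re}(k+2s)>2),\] where $\mathbf{j}\big(\begin{pmatrix}a&b\\c&d\end{pmatrix},\tau\big)=c\tau+d$. This is well defined if $k$ is even, or if $k$ is odd, $-\mathrm{Id}\notin\mathcal{G}$ and $x$ is regular. It continues analytically in $s$ to $\mathrm{Re}(k+2s)>1$, and $E_{k,x}(\tau)$ denotes its value at $s=0$. Spectral basis: $\mathcal{B}_{\mathcal{G},k}$ is $\{E_{k,x}:x\in\mathcal{C}(\mathcal{G})\}$ if $k\ge4$ is even; $\{E_{k,x}:x\in\mathcal{C}_\infty(\mathcal{G})\}$ (for a fixed choice of scaling matrix for each regular cusp) if $k$ is odd and $-\mathrm{Id}\notin\mathcal{G}$; $\{E_{2,x}-\frac{|\mathrm{or}_{\mathcal{G},N}(x)|}{|\mathrm{or}_{\mathcal{G},N}(x_0)|}E_{2,x_0}: x\in\mathcal{C}(\mathcal{G})-\{x_0\}\}$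 if $k=2$; and $\emptyset$ otherwise. *)

theory Defs
  imports
    "HOL-Analysis.Analysis"
    "HOL-Algebra.Group_Action"
    "HOL-Algebra.Elementary_Groups"
    "HOL-Algebra.Multiplicative_Group"
    "HOL-Algebra.Generated_Fields"
    "HOL-Algebra.Algebraic_Closure_Type"
    "HOL-Number_Theory.Cong"
begin

no_notation fps_nth (infixl \<open>$\<close> 75)

section \<open>The modular group and its congruence subgroups\<close>

definition SL2Z :: "(int^2^2) monoid" where
  "SL2Z = \<lparr>carrier = {A. det A = 1}, monoid.mult = (**), one = mat 1\<rparr>"

abbreviation restrict_SL2Z :: "(int^2^2) set \<Rightarrow> (int^2^2) monoid" where
  "restrict_SL2Z G \<equiv> SL2Z\<lparr>carrier := G\<rparr>"

definition T_mat :: "int^2^2" where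
  "T_mat = vector [vector [1, 1], vector [0, 1]]"

definition principal_congruence :: "nat \<Rightarrow> (int^2^2) set" where
  "principal_congruence N =
     {A \<in> carrier SL2Z. \<forall>i j. [A $ i $ j = mat 1 $ i $ j] (mod int N)}"

definition congruence_subgroup :: "(int^2^2) set \<Rightarrow> bool" where
  "congruence_subgroup G \<longleftrightarrow>
     subgroup G SL2Z \<and> (\<exists>M\<ge>1. principal_congruence M \<subseteq> G)"


section \<open>Actions on the upper half plane, on functions, and on the rational projective line\<close>

definition upper_half_plane :: "complex set" where
  "upper_half_plane = {\<tau>. Im \<tau> > 0}"

definition autom_factor :: "int^2^2 \<Rightarrow> complex \<Rightarrow> complex" where
  "autom_factor A \<tau> = of_int (A $ 2 $ 1) * \<tau> + of_int (A $ 2 $ 2)"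

definition moebius :: "int^2^2 \<Rightarrow> complex \<Rightarrow> complex" where
  "moebius A \<tau> = (of_int (A $ 1 $ 1) * \<tau> + of_int (A $ 1 $ 2)) / autom_factor A \<tau>"

definition slash :: "nat \<Rightarrow> (complex \<Rightarrow> complex) \<Rightarrow> int^2^2 \<Rightarrow> complex \<Rightarrow> complex" where
  "slash k f A \<tau> = f (moebius A \<tau>) / autom_factor A \<tau> ^ k"

datatype proj_rat = Infty | Fin rat

fun proj_act :: "int^2^2 \<Rightarrow> proj_rat \<Rightarrow> proj_rat" where
  "proj_act A Infty =
     (if A $ 2 $ 1 = 0 then Infty else Fin (of_int (A $ 1 $ 1) / of_int (A $ 2 $ 1)))"
| "proj_act A (Fin r) =
     (if of_int (A $ 2 $ 1) * r + of_int (A $ 2 $ 2) = 0 then Infty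
      else Fin ((of_int (A $ 1 $ 1) * r + of_int (A $ 1 $ 2)) /
                (of_int (A $ 2 $ 1) * r + of_int (A $ 2 $ 2))))"


section \<open>Analytic continuation in the parameter s\<close>

text \<open>
  The value at \<open>s = 0\<close> of the holomorphic continuation to \<open>Re (k + 2 s) > 1\<close> of a function
  given on \<open>Re (k + 2 s) > 2\<close>. The continuation is unique, since the larger half plane is
  connected; that it exists for the series below is not built into the definition.
\<close>

definition continued_value :: "nat \<Rightarrow> (complex \<Rightarrow> complex) \<Rightarrow> complex" where
  "continued_value k F =
     (THE v. \<exists>g. g holomorphic_on {s. Re (of_nat k + 2 * s) > 1} \<and>
                 (\<forall>s. Re (of_nat k + 2 * s) > 2 \<longrightarrow> g s = F s) \<and> v = g 0)"


section \<open>Eisenstein series on principal congruence subgroups\<close>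

text \<open>
  Elements of \<open>(\<int>/N\<int>)\<^sup>2\<close> are represented by their lifts with coordinates in \<open>{0..<N}\<close>.
\<close>

definition Lambda :: "nat \<Rightarrow> (int \<times> int) set" where
  "Lambda N =
     (let Q = integer_mod_group N \<times>\<times> integer_mod_group N
      in {l \<in> carrier Q. group.ord Q l = N})"

definition eps_level :: "nat \<Rightarrow> complex" where
  "eps_level N = (if N \<ge> 3 then 1 else 1 / 2)"

definition Eis_series :: "nat \<Rightarrow> nat \<Rightarrow> int \<times> int \<Rightarrow> complex \<Rightarrow> complex \<Rightarrow> complex" where
  "Eis_series k N l \<tau> s =
     eps_level N *
     (\<Sum>\<^sub>\<infinity>(c, d) \<in> {(c, d). [c = fst l] (mod int N) \<and> [d = snd l] (mod int N) \<and> gcd c d = 1}.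
        of_real (Im \<tau>) powr s /
        ((of_int c * \<tau> + of_int d) ^ k *
         of_real (cmod (of_int c * \<tau> + of_int d)) powr (2 * s)))"

definition Eis :: "nat \<Rightarrow> nat \<Rightarrow> int \<times> int \<Rightarrow> complex \<Rightarrow> complex" where
  "Eis k N l \<tau> = continued_value k (Eis_series k N l \<tau>)"

text \<open>
  Functions on the upper half plane are represented by functions on \<open>\<complex>\<close> whose values outside
  the half plane are irrelevant.
\<close>

definition Eis_star_level :: "nat \<Rightarrow> nat \<Rightarrow> complex set \<Rightarrow> (complex \<Rightarrow> complex) set" where
  "Eis_star_level k N K =
     {f. \<exists>a. (\<forall>l\<in>Lambda N. a l \<in> K) \<and>
             (\<forall>\<tau>\<in>upper_half_plane. f \<tau> = (\<Sum>l\<in>Lambda N. a l * Eis k N l \<tau>))}"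

definition Eis_star ::
    "nat \<Rightarrow> nat \<Rightarrow> (int^2^2) set \<Rightarrow> complex set \<Rightarrow> (complex \<Rightarrow> complex) set" where
  "Eis_star k N G K =
     {f \<in> Eis_star_level k N K. \<forall>A\<in>G. \<forall>\<tau>\<in>upper_half_plane. slash k f A \<tau> = f \<tau>}"

definition Eis_space ::
    "nat \<Rightarrow> nat \<Rightarrow> (int^2^2) set \<Rightarrow> complex set \<Rightarrow> (complex \<Rightarrow> complex) set" where
  "Eis_space k N G K = {f \<in> Eis_star k N G K. f holomorphic_on upper_half_plane}"


section \<open>Cusps\<close>

abbreviation cusp_orbit :: "(int^2^2) set \<Rightarrow> proj_rat \<Rightarrow> proj_rat set" where
  "cusp_orbit G x \<equiv> orbit (restrict_SL2Z G) proj_act x"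

abbreviation cusp_stab :: "(int^2^2) set \<Rightarrow> proj_rat \<Rightarrow> (int^2^2) set" where
  "cusp_stab G x \<equiv> stabilizer (restrict_SL2Z G) proj_act x"

definition cusps :: "(int^2^2) set \<Rightarrow> proj_rat set set" where
  "cusps G = orbits (restrict_SL2Z G) UNIV proj_act"

definition cusp_representatives :: "(int^2^2) set \<Rightarrow> proj_rat set \<Rightarrow> bool" where
  "cusp_representatives G C \<longleftrightarrow> (\<forall>Y\<in>cusps G. \<exists>!x. x \<in> C \<and> x \<in> Y)"

definition irregular_cusp :: "(int^2^2) set \<Rightarrow> proj_rat \<Rightarrow> bool" where
  "irregular_cusp G x \<longleftrightarrow>
     (\<exists>A\<in>carrier SL2Z. proj_act A Infty = x \<and>
        (\<exists>h::nat. h \<ge> 1 \<and>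
           (\<lambda>B. inv\<^bsub>SL2Z\<^esub> A \<otimes>\<^bsub>SL2Z\<^esub> B \<otimes>\<^bsub>SL2Z\<^esub> A) ` cusp_stab G x =
           generate SL2Z {- (T_mat [^]\<^bsub>SL2Z\<^esub> h)}))"

definition cusps_inside :: "(int^2^2) set \<Rightarrow> nat \<Rightarrow> proj_rat \<Rightarrow> proj_rat set set" where
  "cusps_inside G N x = {Y \<in> cusps (principal_congruence N). Y \<subseteq> cusp_orbit G x}"

definition cusp_amp :: "proj_rat \<Rightarrow> (int^2^2) set \<Rightarrow> nat" where
  "cusp_amp x G =
     card (rcosets\<^bsub>restrict_SL2Z (cusp_stab (carrier SL2Z) x)\<^esub>
             (generate SL2Z (cusp_stab G x \<union> {- mat 1})))"


section \<open>Spectral Eisenstein series and the spectral basis\<close>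

text \<open>
  \<open>S\<close> is the scaling matrix of the cusp \<open>x\<close>. The summand does not depend on the element
  picked from a coset if \<open>k\<close> is even, or if \<open>k\<close> is odd, \<open>- mat 1 \<notin> G\<close> and \<open>x\<close> is regular;
  the series is used in these cases only.
\<close>

definition spectral_series ::
    "nat \<Rightarrow> (int^2^2) set \<Rightarrow> int^2^2 \<Rightarrow> proj_rat \<Rightarrow> complex \<Rightarrow> complex \<Rightarrow> complex" where
  "spectral_series k G S x \<tau> s =
     (\<Sum>\<^sub>\<infinity>R \<in> rcosets\<^bsub>restrict_SL2Z G\<^esub> (cusp_stab G x).
        let A = inv\<^bsub>SL2Z\<^esub> S \<otimes>\<^bsub>SL2Z\<^esub> (SOME B. B \<in> R)
        in of_real (Im (moebius A \<tau>)) powr s / autom_factor A \<tau> ^ k)"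

definition spectral_Eis ::
    "nat \<Rightarrow> (int^2^2) set \<Rightarrow> int^2^2 \<Rightarrow> proj_rat \<Rightarrow> complex \<Rightarrow> complex" where
  "spectral_Eis k G S x \<tau> = continued_value k (spectral_series k G S x \<tau>)"

text \<open>
  The choices on which the spectral basis depends: representatives \<open>C\<close> of the cusps, a scaling
  matrix \<open>S x\<close> for each representative, and a representative \<open>x0\<close> of minimal amplitude.
\<close>

definition spectral_choice ::
    "(int^2^2) set \<Rightarrow> proj_rat set \<Rightarrow> (proj_rat \<Rightarrow> int^2^2) \<Rightarrow> proj_rat \<Rightarrow> bool" where
  "spectral_choice G C S x0 \<longleftrightarrow>
     cusp_representatives G C \<and>
     (\<forall>x\<in>C. S x \<in> carrier SL2Z \<and> proj_act (S x) Infty = x) \<and>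
     x0 \<in> C \<and> (\<forall>x\<in>C. cusp_amp x0 G dvd cusp_amp x G)"

definition spectral_basis ::
    "nat \<Rightarrow> nat \<Rightarrow> (int^2^2) set \<Rightarrow> proj_rat set \<Rightarrow> (proj_rat \<Rightarrow> int^2^2) \<Rightarrow> proj_rat \<Rightarrow>
     (complex \<Rightarrow> complex) set" where
  "spectral_basis k N G C S x0 =
     (if even k \<and> k \<ge> 4 then {spectral_Eis k G (S x) x | x. x \<in> C}
      else if odd k \<and> - mat 1 \<notin> G then
        {spectral_Eis k G (S x) x | x. x \<in> C \<and> \<not> irregular_cusp G x}
      else if k = 2 then
        {(\<lambda>\<tau>. spectral_Eis 2 G (S x) x \<tau> -
               of_nat (card (cusps_inside G N x)) / of_nat (card (cusps_inside G N x0)) *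
               spectral_Eis 2 G (S x0) x0 \<tau>) | x. x \<in> C - {x0}}
      else {})"


section \<open>Coefficient fields and Fourier expansions\<close>

abbreviation complex_ring :: "complex ring" where
  "complex_ring \<equiv> ring_of_type_algebra"

definition cyclotomic_field :: "nat \<Rightarrow> complex set" where
  "cyclotomic_field N =
     generate_field complex_ring {exp (2 * of_real pi * \<i> / of_nat N)}"

definition has_Fourier_expansion_over ::
    "complex set \<Rightarrow> nat \<Rightarrow> (complex \<Rightarrow> complex) \<Rightarrow> bool" where
  "has_Fourier_expansion_over K N f \<longleftrightarrow>
     (\<exists>A :: nat \<Rightarrow> complex. (\<forall>j. A j \<in> K) \<and>
        (\<forall>\<tau>\<in>upper_half_plane.
           (\<lambda>j. A j * exp (2 * of_real pi * \<i> * of_nat j * \<tau> / of_nat N)) sums f \<tau>))"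

end

theory Submission
  imports
    Defs
    "HOL-Complex_Analysis.Complex_Analysis"
    "HOL-Computational_Algebra.Squarefree"
begin

text \<open>
  Write \<open>z = c \<tau> + d\<close> for lattice points, \<open>G\<^sub>l(s)\<close> for the sum of \<open>z\<^sup>-\<^sup>k |z|\<^sup>-\<^sup>2\<^sup>s\<close> over all
  \<open>(c, d) \<equiv> l\<close> modulo \<open>N\<close>, and \<open>E\<^sub>l\<close> for the Eisenstein series, in which only coprime pairs
  occur.

  The continuation to \<open>Re (k + 2 s) > 1\<close> is obtained by finite differences. The function
  \<open>z\<^sup>-\<^sup>k |z|\<^sup>-\<^sup>2\<^sup>s\<close> is the derivative with respect to \<open>z\<close> of a function homogeneous of one degree
  more, and this derivative is a combination of the derivatives in the real directions \<open>1\<close> and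
  \<open>\<tau>\<close>. Subtracting the corresponding combination of finite differences with the steps
  \<open>N\<close> and \<open>N \<tau>\<close> leaves only the second order error of Taylor's formula, which is summable for
  \<open>Re (k + 2 s) > 1\<close>, while the differences themselves cancel over a residue class
  (\<open>reg_term_bound\<close>, \<open>reg_term_series_eq\<close>). Moebius inversion carries the continuation over to
  coprime pairs: \<open>E\<^sub>l\<close> is \<open>eps_level N\<close> times the sum of \<open>M\<^sub>r G\<^sub>m\<close> over the units \<open>r\<close> modulo
  \<open>N\<close>, where \<open>m = r\<^sup>-\<^sup>1 l\<close> and \<open>M\<^sub>r\<close> is the sum of \<open>\<mu>(n) n\<^sup>-\<^sup>k\<close> over \<open>n \<equiv> r\<close>
  (\<open>moebius_inversion_lattice\<close>, \<open>Eis_eq_moebius_sum\<close>). At \<open>s = 0\<close> the value of \<open>G\<^sub>l\<close> is the sum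
  over \<open>d\<close> followed by the sum over \<open>c\<close>; in weight \<open>2\<close> a term \<open>- \<pi> / (N\<^sup>2 Im \<tau>)\<close> is added, half of
  which comes from each of the two limits of the cotangent at \<open>\<plusminus> \<i> \<infinity>\<close> (\<open>G_value_weight_2\<close>).

  Each sum over \<open>d\<close> is a Lipschitz sum. Differentiating the reflection formula of the Gamma function
  expresses it, up to the factor \<open>(2 \<pi> \<i>)\<^sup>k\<close>, as a rational function with rational coefficients of
  \<open>exp (2 \<pi> \<i> (c \<tau> + d) / N)\<close> (\<open>Polygamma_reflection\<close>, \<open>lattice_row_lipschitz\<close>). Hence the
  holomorphic part of \<open>(2 \<pi> \<i>)\<^sup>-\<^sup>k G\<^sub>l\<close> has coefficients in the cyclotomic field
  (\<open>rows_sum\<close>, \<open>G_coeff_mem\<close>).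

  About the arithmetic of the single factors \<open>M\<^sub>r\<close> nothing is claimed; only their effect on the
  combination of the series matters. Moebius inversion on the line \<open>c = 0\<close>, where \<open>\<plusminus> 1\<close> are the only
  coprime points, shows that the numbers \<open>(2 \<pi> \<i>)\<^sup>k M\<^sub>r\<close> solve a linear system with coefficients in
  the cyclotomic field. A linear system that is solvable over \<open>\<complex>\<close> is solvable over any field
  containing its coefficients, and replacing one solution by another does not change the combination
  of the series (\<open>linear_system_solvable\<close>, \<open>convolution_cancel\<close>,
  \<open>rational_moebius_coefficients\<close>). So \<open>E\<^sub>l\<close> has coefficients in the cyclotomic field; in
  weight \<open>2\<close> this holds for \<open>E\<^sub>l + C / Im \<tau>\<close> with a constant \<open>C\<close> that does not depend on \<open>l\<close>
  (\<open>Eis_expansion\<close>).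

  For the first claim it remains to see that in weight \<open>2\<close> a holomorphic combination contains no
  multiple of \<open>1 / Im \<tau>\<close> (\<open>inverse_Im_not_holomorphic\<close>). For the second claim the cosets in the
  spectral series are described by the bottom rows of \<open>S\<^sup>-\<^sup>1 B\<close> up to sign. These rows are all
  coprime pairs in certain residue classes modulo \<open>N\<close>, because \<open>\<Gamma>(N)\<close> acts transitively on
  congruent coprime pairs, so \<open>E\<^bsub>k,x\<^esub>\<close> is a rational combination of the \<open>E\<^sub>l\<close>
  (\<open>spectral_Eis_even\<close>, \<open>spectral_Eis_disjoint\<close>). At a regular cusp in odd weight no two rows
  are opposite (\<open>regular_cusp_rows_disjoint\<close>). In weight \<open>2\<close> the number of residue classes is
  proportional to the number of cusps of \<open>\<Gamma>(N)\<close> over \<open>x\<close> (\<open>card_residues_eq_cusps\<close>), so the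
  multiples of \<open>1 / Im \<tau>\<close> cancel in the elements of the spectral basis.
\<close>

(* Keeps $ unambiguous as the notation for components of vectors. *)
no_notation fps_nth (infixl \<open>$\<close> 75)

section \<open>Holomorphic sums and lattice sums\<close>

text \<open>
  Weierstrass' theorem for sums over an arbitrary index set. Finitely many terms may violate the
  local majorant: the bounds for lattice sums fail for the few lattice points near the origin.
\<close>

lemma holomorphic_infsum:
  fixes f :: "'i \<Rightarrow> complex \<Rightarrow> complex"
  assumes S: "open S" and hol: "\<And>i. i \<in> I \<Longrightarrow> f i holomorphic_on S"
    and bnd: "\<And>s0. s0 \<in> S \<Longrightarrow> \<exists>r>0. \<exists>F M. cball s0 r \<subseteq> S \<and> finite F \<and> M summable_on I \<and>
                (\<forall>i\<in>I - F. \<forall>s\<in>cball s0 r. norm (f i s) \<le> M i)"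
  shows "(\<lambda>s. \<Sum>\<^sub>\<infinity>i\<in>I. f i s) holomorphic_on S"
    and "\<And>s. s \<in> S \<Longrightarrow> (\<lambda>i. norm (f i s)) summable_on I"
proof -
  have bnd': "\<exists>r>0. \<exists>M. cball s0 r \<subseteq> S \<and> M summable_on I \<and>
                (\<forall>i\<in>I. \<forall>s\<in>cball s0 r. norm (f i s) \<le> M i)" if s0: "s0 \<in> S" for s0
  proof -
    obtain r F M where r: "r > 0" "cball s0 r \<subseteq> S" "finite F" "M summable_on I"
      and M: "\<And>i s. i \<in> I - F \<Longrightarrow> s \<in> cball s0 r \<Longrightarrow> norm (f i s) \<le> M i"
      using bnd[OF s0] by blast
    have "\<exists>B. \<forall>s\<in>cball s0 r. norm (f i s) \<le> B" if "i \<in> I" for i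
    proof -
      have "continuous_on (cball s0 r) (f i)"
        using hol[OF that] r(2) holomorphic_on_imp_continuous_on holomorphic_on_subset by blast
      then have "compact (f i ` cball s0 r)" by (intro compact_continuous_image) auto
      then show ?thesis using compact_imp_bounded bounded_iff by (metis imageI)
    qed
    then obtain B where B: "\<And>i s. i \<in> I \<Longrightarrow> s \<in> cball s0 r \<Longrightarrow> norm (f i s) \<le> B i" by metis
    \<comment> \<open>The exceptional terms are continuous, hence bounded on the closed ball.\<close>
    define M' where "M' i = (if i \<in> F then B i else M i)" for i
    have 1: "M' summable_on (I - F)"
    proof -
      have "M summable_on (I - F)" using r(3,4) by (intro summable_on_cofin_subset) auto
      then show ?thesis by (rule summable_on_cong[THEN iffD1, rotated]) (auto simp: M'_def)
    qed
    have "M' summable_on ((I - F) \<union> (I \<inter> F))"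
      using 1 r(3) by (intro summable_on_Un_disjoint) auto
    then have "M' summable_on I" by (metis Int_Diff_Un Un_commute)
    moreover have "norm (f i s) \<le> M' i" if "i \<in> I" "s \<in> cball s0 r" for i s
      using B[OF that] M[of i s] that by (simp add: M'_def)
    ultimately show ?thesis using r(1,2) by blast
  qed
  show "(\<lambda>i. norm (f i s)) summable_on I" if sS: "s \<in> S" for s
  proof -
    obtain r M where r: "r > 0" "M summable_on I" and M: "\<And>i s'. i \<in> I \<Longrightarrow> s' \<in> cball s r \<Longrightarrow> norm (f i s') \<le> M i"
      using bnd'[OF sS] by blast
    show ?thesis by (rule summable_on_comparison_test[OF r(2)]) (use M r in auto)
  qed
  have "(\<lambda>s. \<Sum>\<^sub>\<infinity>i\<in>I. f i s) analytic_on S"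
  proof (unfold analytic_on_def, intro ballI)
    fix s0 assume s0: "s0 \<in> S"
    obtain r M where r: "r > 0" "cball s0 r \<subseteq> S" "M summable_on I"
      and M: "\<And>i s'. i \<in> I \<Longrightarrow> s' \<in> cball s0 r \<Longrightarrow> norm (f i s') \<le> M i"
      using bnd'[OF s0] by blast
    have u: "uniform_limit (cball s0 r) (\<lambda>J s. \<Sum>i\<in>J. f i s) (\<lambda>s. \<Sum>\<^sub>\<infinity>i\<in>I. f i s) (finite_subsets_at_top I)"
      by (rule Weierstrass_m_test_general[OF M r(3)])
    have ev: "\<forall>\<^sub>F J in finite_subsets_at_top I. continuous_on (cball s0 r) (\<lambda>s. \<Sum>i\<in>J. f i s) \<and>
            (\<lambda>s. \<Sum>i\<in>J. f i s) holomorphic_on ball s0 r"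
    proof (rule eventually_finite_subsets_at_top_weakI)
      fix J assume J: "finite J" "J \<subseteq> I"
      have h: "(\<lambda>s. \<Sum>i\<in>J. f i s) holomorphic_on S"
        using hol J by (intro holomorphic_intros) auto
      show "continuous_on (cball s0 r) (\<lambda>s. \<Sum>i\<in>J. f i s) \<and> (\<lambda>s. \<Sum>i\<in>J. f i s) holomorphic_on ball s0 r"
        using h r(2) ball_subset_cball[of s0 r]
        by (meson holomorphic_on_imp_continuous_on holomorphic_on_subset order_trans)
    qed
    have "(\<lambda>s. \<Sum>\<^sub>\<infinity>i\<in>I. f i s) holomorphic_on ball s0 r"
      by (rule holomorphic_uniform_limit[OF ev u]) auto
    then show "\<exists>\<epsilon>>0. (\<lambda>s. \<Sum>\<^sub>\<infinity>i\<in>I. f i s) holomorphic_on ball s0 \<epsilon>" using r(1) by blast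
  qed
  then show "(\<lambda>s. \<Sum>\<^sub>\<infinity>i\<in>I. f i s) holomorphic_on S" by (rule analytic_imp_holomorphic)
qed

lemma summable_on_product_nonneg:
  fixes f :: "'a \<Rightarrow> real" and g :: "'b \<Rightarrow> real"
  assumes f: "f summable_on A" "\<And>x. x \<in> A \<Longrightarrow> f x \<ge> 0" and g: "g summable_on B" "\<And>y. y \<in> B \<Longrightarrow> g y \<ge> 0"
  shows "(\<lambda>(x, y). f x * g y) summable_on (A \<times> B)"
proof (rule summable_on_SigmaI)
  show "((\<lambda>y. case (x, y) of (x, y) \<Rightarrow> f x * g y) has_sum (f x * infsum g B)) B" if "x \<in> A" for x
    using has_sum_cmult_right[OF has_sum_infsum[OF g(1)], of "f x"] by simp
  show "(\<lambda>x. f x * infsum g B) summable_on A" by (rule summable_on_cmult_left[OF f(1)])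
qed (use f g in auto)

lemma summable_on_int_powr:
  assumes "p > 1"
  shows "(\<lambda>c::int. (1 + \<bar>real_of_int c\<bar>) powr (- p)) summable_on UNIV"
proof -
  have "summable (\<lambda>n. real (Suc n) powr (- p))"
    using assms by (subst summable_Suc_iff) (simp add: summable_real_powr_iff)
  then have s: "(\<lambda>n::nat. real (Suc n) powr (- p)) summable_on UNIV"
    by (subst summable_on_UNIV_nonneg_real_iff) auto
  have 1: "(\<lambda>c::int. (1 + \<bar>real_of_int c\<bar>) powr (- p)) summable_on range int"
    using s by (subst summable_on_reindex) (auto simp: o_def inj_on_def)
  have 2: "(\<lambda>c::int. (1 + \<bar>real_of_int c\<bar>) powr (- p)) summable_on range (\<lambda>n. - int n)"
    using s by (subst summable_on_reindex) (auto simp: o_def inj_on_def)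
  have "range int \<union> range (\<lambda>n. - int n) = UNIV"
    by (auto simp: image_iff) (metis int_cases2)
  with summable_on_union[OF 1 2] show ?thesis by simp
qed

lemma summable_on_int2_powr:
  assumes "p > 1"
  shows "(\<lambda>(c::int,d::int). ((1 + \<bar>real_of_int c\<bar>) * (1 + \<bar>real_of_int d\<bar>)) powr (- p)) summable_on UNIV"
proof -
  let ?g = "\<lambda>c::int. (1 + \<bar>real_of_int c\<bar>) powr (- p)"
  have g: "?g summable_on UNIV" by (rule summable_on_int_powr[OF assms])
  have "(\<lambda>(c,d). ?g c * ?g d) summable_on (UNIV \<times> UNIV)"
    by (rule summable_on_product_nonneg[OF g _ g]) simp_all
  moreover have "(\<lambda>(c,d). ?g c * ?g d) = (\<lambda>(c::int,d::int). ((1 + \<bar>real_of_int c\<bar>) * (1 + \<bar>real_of_int d\<bar>)) powr (- p))"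
    by (auto simp: fun_eq_iff powr_mult)
  ultimately show ?thesis by simp
qed

text \<open>
  \<open>|c \<tau> + d|\<close> dominates both \<open>1 + |c|\<close> and \<open>1 + |d|\<close>, hence their geometric mean. With this
  lower bound a sum over the lattice is majorized by a product of two sums over \<open>\<int>\<close>.
\<close>

lemma lattice_lower_bound:
  assumes "Im \<tau> > 0"
  obtains C where "C > 0"
    "\<And>c d :: int. (c, d) \<noteq> (0, 0) \<Longrightarrow>
       C * sqrt ((1 + \<bar>real_of_int c\<bar>) * (1 + \<bar>real_of_int d\<bar>)) \<le> cmod (of_int c * \<tau> + of_int d)"
proof -
  \<comment> \<open>Large enough for \<open>|c|\<close>, \<open>|d|\<close> and \<open>1\<close> to be at most \<open>A |c \<tau> + d|\<close>.\<close>
  define A where "A = 1 + (1 + cmod \<tau>) / Im \<tau>"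
  have A: "A > 0" using assms unfolding A_def by (intro add_pos_nonneg divide_nonneg_pos) auto
  show thesis
  proof (rule that[of "1 / (2 * A)"])
    fix c d :: int assume cd: "(c, d) \<noteq> (0, 0)"
    let ?z = "of_int c * \<tau> + of_int d"
    have "\<bar>Im ?z\<bar> \<le> cmod ?z" by (rule abs_Im_le_cmod)
    then have "\<bar>real_of_int c\<bar> * Im \<tau> \<le> cmod ?z" using assms by (simp add: abs_mult)
    then have c1: "\<bar>real_of_int c\<bar> \<le> cmod ?z / Im \<tau>" using assms by (simp add: field_simps)
    have "\<bar>real_of_int d\<bar> = cmod (?z - of_int c * \<tau>)" by simp
    also have "\<dots> \<le> cmod ?z + \<bar>real_of_int c\<bar> * cmod \<tau>"
      by (rule order_trans[OF norm_triangle_ineq4]) (simp add: norm_mult)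
    also have "\<dots> \<le> cmod ?z + cmod ?z / Im \<tau> * cmod \<tau>" using c1 by (intro add_mono mult_right_mono) auto
    finally have d1: "\<bar>real_of_int d\<bar> \<le> cmod ?z + cmod ?z / Im \<tau> * cmod \<tau>" .
    have Az: "A * cmod ?z = cmod ?z + cmod ?z / Im \<tau> + cmod ?z / Im \<tau> * cmod \<tau>"
      by (simp add: A_def field_simps add_divide_distrib)
    have nn: "cmod ?z / Im \<tau> \<ge> 0" "cmod ?z / Im \<tau> * cmod \<tau> \<ge> 0" using assms by auto
    have c2: "\<bar>real_of_int c\<bar> \<le> A * cmod ?z" and d2: "\<bar>real_of_int d\<bar> \<le> A * cmod ?z"
      using c1 d1 nn Az by (auto simp: norm_ge_zero intro: order_trans)
    have "\<bar>real_of_int c\<bar> \<ge> 1 \<or> \<bar>real_of_int d\<bar> \<ge> 1" using cd by auto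
    then have o: "1 \<le> A * cmod ?z" using c2 d2 by linarith
    have "sqrt ((1 + \<bar>real_of_int c\<bar>) * (1 + \<bar>real_of_int d\<bar>)) \<le> sqrt ((2 * A * cmod ?z) * (2 * A * cmod ?z))"
      using c2 d2 o by (intro real_sqrt_le_mono mult_mono) auto
    also have "\<dots> = 2 * A * cmod ?z"
      using A by (subst real_sqrt_abs2) (simp add: abs_mult)
    finally show "1 / (2 * A) * sqrt ((1 + \<bar>real_of_int c\<bar>) * (1 + \<bar>real_of_int d\<bar>)) \<le> cmod ?z"
      using A by (simp add: field_simps)
  qed (use A in auto)
qed

lemma summable_on_lattice_powr:
  assumes "Im \<tau> > 0" "x > 2"
  shows "(\<lambda>(c::int, d::int). cmod (of_int c * \<tau> + of_int d) powr (- x)) summable_on UNIV"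
proof -
  obtain C where C: "C > 0"
    "\<And>c d :: int. (c, d) \<noteq> (0, 0) \<Longrightarrow>
       C * sqrt ((1 + \<bar>real_of_int c\<bar>) * (1 + \<bar>real_of_int d\<bar>)) \<le> cmod (of_int c * \<tau> + of_int d)"
    using lattice_lower_bound[OF assms(1)] by blast
  have s: "(\<lambda>p. C powr (-x) * (case p of (c::int,d::int) \<Rightarrow> ((1 + \<bar>real_of_int c\<bar>) * (1 + \<bar>real_of_int d\<bar>)) powr (- (x/2)))) summable_on UNIV"
    using summable_on_int2_powr[of "x/2"] assms(2) by (intro summable_on_cmult_right) auto
  show ?thesis
  proof (rule summable_on_comparison_test[OF s], clarify)
    fix c d :: int
    show "cmod (of_int c * \<tau> + of_int d) powr (- x) \<le>
         C powr (-x) * (((1 + \<bar>real_of_int c\<bar>) * (1 + \<bar>real_of_int d\<bar>)) powr (- (x/2)))"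
    proof (cases "(c, d) = (0, 0)")
      case False
      let ?q = "(1 + \<bar>real_of_int c\<bar>) * (1 + \<bar>real_of_int d\<bar>)"
      have "cmod (of_int c * \<tau> + of_int d) powr (- x) \<le> (C * sqrt ?q) powr (- x)"
        using C(2)[OF False] C(1) assms(2) by (intro powr_mono2') auto
      also have "\<dots> = C powr (-x) * ?q powr (- (x/2))"
        using C(1) by (simp add: powr_mult powr_half_sqrt[symmetric] powr_powr)
      finally show ?thesis .
    qed auto
  qed auto
qed

lemma finite_lattice_ball:
  assumes "Im \<tau> > 0"
  shows "finite {(c::int, d::int). cmod (of_int c * \<tau> + of_int d) < R}"
proof -
  obtain C where C: "C > 0"
    "\<And>c d :: int. (c, d) \<noteq> (0, 0) \<Longrightarrow>
       C * sqrt ((1 + \<bar>real_of_int c\<bar>) * (1 + \<bar>real_of_int d\<bar>)) \<le> cmod (of_int c * \<tau> + of_int d)"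
    using lattice_lower_bound[OF assms(1)] by blast
  define B where "B = \<lceil>(R / C)^2\<rceil>"
  have "{(c::int, d::int). cmod (of_int c * \<tau> + of_int d) < R} \<subseteq> insert (0,0) ({-B..B} \<times> {-B..B})"
  proof (rule subrelI)
    fix c d :: int assume "(c, d) \<in> {(c::int, d::int). cmod (of_int c * \<tau> + of_int d) < R}"
    then have lt: "cmod (of_int c * \<tau> + of_int d) < R" by simp
    show "(c, d) \<in> insert (0,0) ({-B..B} \<times> {-B..B})"
    proof (rule ccontr)
      assume n: "\<not> ?thesis"
      then have "(c, d) \<noteq> (0, 0)" by auto
      from C(2)[OF this] lt have "C * sqrt ((1 + \<bar>real_of_int c\<bar>) * (1 + \<bar>real_of_int d\<bar>)) < R" by linarith
      then have "sqrt ((1 + \<bar>real_of_int c\<bar>) * (1 + \<bar>real_of_int d\<bar>)) < R / C" using C(1) by (simp add: field_simps)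
      then have "(sqrt ((1 + \<bar>real_of_int c\<bar>) * (1 + \<bar>real_of_int d\<bar>)))^2 < (R / C)^2"
        by (intro power_strict_mono) auto
      then have *: "(1 + \<bar>real_of_int c\<bar>) * (1 + \<bar>real_of_int d\<bar>) < (R / C)^2" by simp
      have e: "(1 + \<bar>real_of_int c\<bar>) * (1 + \<bar>real_of_int d\<bar>) = 1 + \<bar>real_of_int c\<bar> + \<bar>real_of_int d\<bar> + \<bar>real_of_int c\<bar> * \<bar>real_of_int d\<bar>"
        by (simp add: algebra_simps)
      have "0 \<le> \<bar>real_of_int c\<bar> * \<bar>real_of_int d\<bar>" by simp
      then have "\<bar>real_of_int c\<bar> \<le> (R / C)^2" "\<bar>real_of_int d\<bar> \<le> (R / C)^2" using * e by linarith+
      then have "\<bar>c\<bar> \<le> B" "\<bar>d\<bar> \<le> B" unfolding B_def by linarith+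
      then show False using n by auto
    qed
  qed
  then show ?thesis by (rule finite_subset) auto
qed

section \<open>Homogeneous functions on the plane and their Taylor remainders\<close>

text \<open>
  The summands of the Eisenstein series are those with \<open>b = 0\<close>; the second exponent makes the family
  closed under derivatives along real lines. For \<open>a > 0\<close> the value at \<open>0\<close> is \<open>0\<close>, so that sums may
  run over all lattice points including the origin.
\<close>

definition hom_term :: "nat \<Rightarrow> nat \<Rightarrow> complex \<Rightarrow> complex \<Rightarrow> complex" where
  "hom_term a b s z = 1 / (z ^ a * cnj z ^ b * of_real (cmod z) powr (2 * s))"

lemma hom_term_exp:
  assumes "z \<noteq> 0"
  shows "hom_term a b s z = exp (- 2 * s * of_real (ln (cmod z))) / (z ^ a * cnj z ^ b)"
  using assms by (simp add: hom_term_def powr_def Ln_of_real exp_minus divide_simps)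

lemma norm_hom_term:
  assumes "z \<noteq> 0"
  shows "norm (hom_term a b s z) = cmod z powr (- (real (a + b) + 2 * Re s))"
proof -
  have "norm (hom_term a b s z) = 1 / (cmod z powr real (a + b) * cmod z powr (2 * Re s))"
    using assms
    by (simp add: hom_term_def norm_divide norm_mult norm_power norm_powr_real_powr powr_realpow power_add
        del: of_nat_add)
  also have "\<dots> = cmod z powr (- (real (a + b) + 2 * Re s))"
    using assms by (simp only: powr_minus powr_add) (simp add: field_simps)
  finally show ?thesis .
qed

lemma hom_term_0: "a > 0 \<Longrightarrow> hom_term a b s 0 = 0"
  by (simp add: hom_term_def)

lemma hom_term_holomorphic:
  assumes "a > 0"
  shows "(\<lambda>s. hom_term a b s z) holomorphic_on S"
proof (cases "z = 0")
  case True then show ?thesis using hom_term_0[OF assms] by simp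
next
  case False
  then show ?thesis by (subst hom_term_exp[OF False]) (intro holomorphic_intros; simp)
qed

text \<open>
  By Wirtinger calculus: \<open>|z|\<^sup>2\<^sup>s = z\<^sup>s (cnj z)\<^sup>s\<close>, so \<open>\<partial>/\<partial>z\<close> multiplies by \<open>- (a + s) / z\<close> and
  \<open>\<partial>/\<partial>(cnj z)\<close> by \<open>- (b + s) / cnj z\<close>. Since the complex powers of \<open>z\<close> itself are not single valued,
  the proof differentiates \<open>exp (- 2 s ln |z|)\<close> instead.
\<close>

lemma hom_term_line_deriv:
  fixes \<omega> v :: complex and t :: real
  defines "z \<equiv> \<omega> + of_real t * v"
  assumes z: "z \<noteq> 0"
  shows "((\<lambda>t. hom_term a b s (\<omega> + of_real t * v)) has_vector_derivative
    (- (of_nat a + s) * v * hom_term (Suc a) b s z - (of_nat b + s) * cnj v * hom_term a (Suc b) s z))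
    (at t)"
proof -
  let ?z = "\<lambda>t. \<omega> + of_real t * v"
  have z1: "(?z has_vector_derivative v) (at t)"
    by (auto intro!: derivative_eq_intros simp: has_vector_derivative_def scaleR_conv_of_real fun_eq_iff)
  have z2: "((\<lambda>t. cnj (?z t)) has_vector_derivative cnj v) (at t)"
    using bounded_linear.has_vector_derivative[OF bounded_linear_cnj z1] .
  have pw: "((\<lambda>t. g t ^ n) has_vector_derivative of_nat n * g t ^ (n - 1) * g') (at t)"
    if "(g has_vector_derivative g') (at t)" for g :: "real \<Rightarrow> complex" and g' n
  proof -
    have d: "((\<lambda>x. x ^ n) has_field_derivative of_nat n * g t ^ (n - 1)) (at (g t))"
      by (auto intro!: derivative_eq_intros)
    show ?thesis using field_vector_diff_chain_at[OF that d] by (simp add: o_def mult.commute)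
  qed
  define L where "L = (\<lambda>t. ln (cmod (?z t)))"
  define D where "D = (v / z + cnj v / cnj z) / 2"
  have Dre: "D = of_real ((Re z * Re v + Im z * Im v) / ((Re z)^2 + (Im z)^2))"
  proof -
    have "D = (v * cnj z + cnj v * z) / (2 * (z * cnj z))"
      using z by (simp add: D_def add_frac_eq mult_ac)
    also have "v * cnj z + cnj v * z = of_real (2 * (Re z * Re v + Im z * Im v))"
      by (simp add: complex_eq_iff algebra_simps)
    also have "2 * (z * cnj z) = of_real (2 * ((Re z)^2 + (Im z)^2))"
      by (simp add: complex_mult_cnj)
    also have "of_real (2 * (Re z * Re v + Im z * Im v)) / of_real (2 * ((Re z)^2 + (Im z)^2)) =
        complex_of_real ((2 * (Re z * Re v + Im z * Im v)) / (2 * ((Re z)^2 + (Im z)^2)))"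
      by (rule of_real_divide[symmetric])
    also have "(2 * (Re z * Re v + Im z * Im v)) / (2 * ((Re z)^2 + (Im z)^2)) =
        (Re z * Re v + Im z * Im v) / ((Re z)^2 + (Im z)^2)"
      by (rule mult_divide_mult_cancel_left) simp
    finally show ?thesis .
  qed
  have pos: "(Re z)^2 + (Im z)^2 > 0" using z by (simp add: complex_neq_0)
  have Lr: "(L has_real_derivative (Re z * Re v + Im z * Im v) / ((Re z)^2 + (Im z)^2)) (at t)"
  proof -
    have "L = (\<lambda>t. ln ((Re \<omega> + t * Re v)^2 + (Im \<omega> + t * Im v)^2) / 2)"
      by (auto simp: L_def cmod_def ln_sqrt fun_eq_iff)
    moreover have "((\<lambda>t. ln ((Re \<omega> + t * Re v)^2 + (Im \<omega> + t * Im v)^2) / 2) has_real_derivative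
       (Re z * Re v + Im z * Im v) / ((Re z)^2 + (Im z)^2)) (at t)"
    proof -
      let ?g = "\<lambda>t. (Re \<omega> + t * Re v)^2 + (Im \<omega> + t * Im v)^2"
      have g: "(?g has_real_derivative 2 * (Re z * Re v + Im z * Im v)) (at t)"
        by (auto intro!: derivative_eq_intros simp: z_def algebra_simps)
      have gt: "?g t = (Re z)^2 + (Im z)^2" by (simp add: z_def)
      have "((\<lambda>t. ln (?g t)) has_real_derivative 1 / ?g t * (2 * (Re z * Re v + Im z * Im v))) (at t)"
        by (rule DERIV_chain2[OF DERIV_ln_divide g]) (use pos gt in simp)
      from DERIV_cdivide[OF this, of 2]
      show ?thesis
        by (rule DERIV_cong) (simp only: gt mult_divide_mult_cancel_left times_divide_eq_left mult_1 nonzero_mult_div_cancel_left zero_neq_numeral not_False_eq_True divide_divide_eq_left mult.commute[of _ 2] simp_thms mult_divide_mult_cancel_left_if if_False, simp)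
    qed
    ultimately show ?thesis by simp
  qed
  then have L1: "((\<lambda>t. complex_of_real (L t)) has_vector_derivative D) (at t)"
    unfolding Dre by (metis bounded_linear.has_vector_derivative bounded_linear_of_real has_real_derivative_iff_has_vector_derivative)
  have E1: "((\<lambda>t. exp (- 2 * s * of_real (L t))) has_vector_derivative
       (- 2 * s * D) * exp (- 2 * s * of_real (L t))) (at t)"
  proof -
    have "((\<lambda>t. - 2 * s * of_real (L t)) has_vector_derivative (- 2 * s * D)) (at t)"
      by (rule has_vector_derivative_mult_right[OF L1])
    from field_vector_diff_chain_at[OF this DERIV_exp]
    show ?thesis by (simp add: o_def)
  qed
  have zt: "?z t = z" by (simp add: z_def)
  let ?P = "\<lambda>t. ?z t ^ a * cnj (?z t) ^ b"
  have P1: "(?P has_vector_derivative (z ^ a * (of_nat b * cnj z ^ (b - 1) * cnj v) +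
        (of_nat a * z ^ (a - 1) * v) * cnj z ^ b)) (at t)"
    using has_vector_derivative_mult[OF pw[OF z1, of a] pw[OF z2, of b]] by (simp add: zt)
  have P0: "?P t \<noteq> 0" using z zt by simp
  have I1: "((\<lambda>t. inverse (?P t)) has_vector_derivative
      (z ^ a * (of_nat b * cnj z ^ (b - 1) * cnj v) +
        (of_nat a * z ^ (a - 1) * v) * cnj z ^ b) * (- (inverse (?P t) ^ 2))) (at t)"
    using field_vector_diff_chain_at[OF P1 DERIV_inverse[OF P0]]
    by (simp only: o_def power2_eq_square power_Suc numeral_2_eq_2 power_0 mult_1_right)
  have F1: "((\<lambda>t. exp (- 2 * s * of_real (L t)) * inverse (?P t)) has_vector_derivative
     (exp (- 2 * s * of_real (L t)) * ((z ^ a * (of_nat b * cnj z ^ (b - 1) * cnj v) +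
        (of_nat a * z ^ (a - 1) * v) * cnj z ^ b) * (- (inverse (?P t) ^ 2))) +
      (- 2 * s * D) * exp (- 2 * s * of_real (L t)) * inverse (?P t))) (at t)"
    by (rule has_vector_derivative_mult[OF E1 I1])
  have val: "exp (- 2 * s * of_real (L t)) * ((z ^ a * (of_nat b * cnj z ^ (b - 1) * cnj v) +
        (of_nat a * z ^ (a - 1) * v) * cnj z ^ b) * (- (inverse (?P t) ^ 2))) +
      (- 2 * s * D) * exp (- 2 * s * of_real (L t)) * inverse (?P t) =
     - (of_nat a + s) * v * hom_term (Suc a) b s z - (of_nat b + s) * cnj v * hom_term a (Suc b) s z"
  proof -
    let ?E = "exp (- 2 * s * of_real (L t))" and ?Q = "z ^ a * cnj z ^ b"
    have A: "of_nat n * w ^ (n - 1) = w ^ n * (of_nat n / w)" if "w \<noteq> 0" for n and w :: complex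
      using that by (cases n) auto
    have h: "hom_term (Suc a) b s z = ?E * inverse ?Q * inverse z"
            "hom_term a (Suc b) s z = ?E * inverse ?Q * inverse (cnj z)"
      using z by (simp_all add: hom_term_exp L_def zt divide_inverse)
    have Q: "?Q \<noteq> 0" using z by simp
    have alg: "E * ((P * (B * y) + P * (A * x)) * (- (inverse P ^ 2))) + (- 2 * s * ((x + y) / 2)) * E * inverse P =
        - (A + s) * E * inverse P * x - (B + s) * E * inverse P * y"
      if "P \<noteq> 0" for E P A B x y :: complex
      using that by (simp add: field_simps power2_eq_square)
    have e1: "z ^ a * (of_nat b * cnj z ^ (b - 1) * cnj v) = ?Q * (of_nat b * (cnj v / cnj z))"
      using z by (subst A) (simp_all add: divide_inverse mult_ac)
    have e2: "of_nat a * z ^ (a - 1) * v * cnj z ^ b = ?Q * (of_nat a * (v / z))"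
      using z by (subst A) (simp_all add: divide_inverse mult_ac)
    show ?thesis unfolding h zt D_def e1 e2 alg[OF Q]
      by (simp add: divide_inverse mult_ac)
  qed
  show ?thesis
  proof (rule has_vector_derivative_transform_within_open[OF F1[unfolded val], of "{t. ?z t \<noteq> 0}"])
    show "open {t. ?z t \<noteq> 0}" by (intro open_Collect_neq continuous_intros)
    show "t \<in> {t. ?z t \<noteq> 0}" using z zt by simp
    fix t assume "t \<in> {t. ?z t \<noteq> 0}"
    then show "exp (- 2 * s * of_real (L t)) * inverse (?P t) = hom_term a b s (?z t)"
      by (simp add: hom_term_exp L_def field_simps)
  qed
qed

text \<open>
  The step is at most half the distance to the origin, so the second derivative along the segment is
  at most a constant times its size at \<open>\<omega>\<close>, and the remainder is two orders smaller than \<open>hom_term a 0 s \<omega>\<close>.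
\<close>

lemma hom_term_taylor:
  fixes n :: real and \<omega> v s :: complex and a :: nat
  defines "x \<equiv> real a + 2 + 2 * Re s"
  defines "B \<equiv> 4 * (real a + 2 + cmod s)^2 * (cmod v)^2 * (2 powr x * cmod \<omega> powr (- x))"
  assumes n: "n \<ge> 0" and \<omega>: "\<omega> \<noteq> 0" "2 * n * cmod v \<le> cmod \<omega>" and x: "x \<ge> 0"
  shows "norm (hom_term a 0 s (\<omega> + of_real n * v) - hom_term a 0 s \<omega>
           - of_real n * (- (of_nat a + s) * v * hom_term (Suc a) 0 s \<omega> - s * cnj v * hom_term a 1 s \<omega>))
         \<le> B * n * n"
proof -
  define z where "z t = \<omega> + of_real t * v" for t :: real
  \<comment> \<open>The segment stays away from the singularity at \<open>0\<close>.\<close>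
  have zb: "cmod \<omega> / 2 \<le> cmod (z t)" if "t \<in> {0..n}" for t
  proof -
    have "cmod \<omega> \<le> cmod (z t) + cmod (of_real t * v)"
      unfolding z_def by (metis add_diff_cancel_right' norm_triangle_ineq4)
    also have "cmod (of_real t * v) \<le> n * cmod v"
      using that by (simp add: norm_mult mult_right_mono)
    finally show ?thesis using \<omega>(2) by simp
  qed
  have z0: "z t \<noteq> 0" if "t \<in> {0..n}" for t
    using zb[OF that] \<omega>(1) by auto
  define f0 where "f0 t = hom_term a 0 s (z t)" for t
  define f1 where "f1 t = - (of_nat a + s) * v * hom_term (Suc a) 0 s (z t) - s * cnj v * hom_term a 1 s (z t)" for t
  define f2 where "f2 t = - (of_nat a + s) * v * (- (of_nat (Suc a) + s) * v * hom_term (Suc (Suc a)) 0 s (z t) - s * cnj v * hom_term (Suc a) 1 s (z t))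
      - s * cnj v * (- (of_nat a + s) * v * hom_term (Suc a) 1 s (z t) - (1 + s) * cnj v * hom_term a 2 s (z t))" for t
  have d0: "(f0 has_vector_derivative f1 t) (at t within {0..n})" if "t \<in> {0..n}" for t
    using hom_term_line_deriv[of \<omega> t v a 0 s] z0[OF that]
    unfolding f0_def f1_def z_def by (auto intro: has_vector_derivative_at_within)
  have d1: "(f1 has_vector_derivative f2 t) (at t within {0..n})" if "t \<in> {0..n}" for t
  proof -
    have A: "((\<lambda>t. hom_term (Suc a) 0 s (z t)) has_vector_derivative
        (- (of_nat (Suc a) + s) * v * hom_term (Suc (Suc a)) 0 s (z t) - s * cnj v * hom_term (Suc a) 1 s (z t))) (at t)"
      using hom_term_line_deriv[of \<omega> t v "Suc a" 0 s] z0[OF that] unfolding z_def by simp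
    have C: "((\<lambda>t. hom_term a 1 s (z t)) has_vector_derivative
        (- (of_nat a + s) * v * hom_term (Suc a) 1 s (z t) - (1 + s) * cnj v * hom_term a 2 s (z t))) (at t)"
      using hom_term_line_deriv[of \<omega> t v a 1 s] z0[OF that] unfolding z_def by (simp add: numeral_2_eq_2)
    have "(f1 has_vector_derivative f2 t) (at t)"
      unfolding f1_def[abs_def] f2_def
      by (rule has_vector_derivative_diff[OF has_vector_derivative_mult_right[OF A] has_vector_derivative_mult_right[OF C]])
    then show ?thesis by (rule has_vector_derivative_at_within)
  qed
  define Y where "Y = 2 powr x * cmod \<omega> powr (- x)"
  have Y0: "Y \<ge> 0" by (simp add: Y_def)
  have hb: "cmod (hom_term p q s (z t)) \<le> Y" if t: "t \<in> {0..n}" and pq: "p + q = a + 2" for t p q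
  proof -
    have "cmod (hom_term p q s (z t)) = cmod (z t) powr (- x)"
    proof -
      have "real (p + q) + 2 * Re s = x" using pq by (simp add: x_def)
      then show ?thesis by (simp only: norm_hom_term[OF z0[OF t]])
    qed
    also have "\<dots> \<le> (cmod \<omega> / 2) powr (- x)"
      using zb[OF t] x \<omega>(1) by (intro powr_mono2') auto
    also have "\<dots> = Y"
      using \<omega>(1) by (simp add: Y_def powr_divide powr_minus field_simps)
    finally show ?thesis .
  qed
  define m where "m = real a + 2 + cmod s"
  have m0: "m \<ge> 0" by (simp add: m_def)
  have b1: "cmod (of_nat a + s) \<le> m" "cmod (of_nat (Suc a) + s) \<le> m" "cmod s \<le> m" "cmod (1 + s) \<le> m"
  proof -
    have "cmod (of_nat a + s) \<le> real a + cmod s" by (metis norm_of_nat norm_triangle_ineq)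
    then show "cmod (of_nat a + s) \<le> m" by (simp add: m_def)
    have "cmod (of_nat (Suc a) + s) \<le> real (Suc a) + cmod s" by (metis norm_of_nat norm_triangle_ineq)
    then show "cmod (of_nat (Suc a) + s) \<le> m" by (simp add: m_def)
    have "cmod (1 + s) \<le> 1 + cmod s" by (metis norm_one norm_triangle_ineq)
    then show "cmod (1 + s) \<le> m" by (simp add: m_def)
  qed (simp add: m_def)
  have tm: "cmod (p * u * (q * w * h)) \<le> m^2 * (cmod v)^2 * Y"
    if "cmod p \<le> m" "cmod q \<le> m" "cmod u = cmod v" "cmod w = cmod v" "cmod h \<le> Y" for p q u w h
  proof -
    have "cmod (p * u * (q * w * h)) = (cmod p * cmod q) * (cmod v)^2 * cmod h"
      using that by (simp add: norm_mult power2_eq_square mult_ac)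
    also have "\<dots> \<le> (m * m) * (cmod v)^2 * Y"
      using that m0 Y0 by (intro mult_mono) auto
    finally show ?thesis by (simp add: power2_eq_square)
  qed
  have f2b: "norm (f2 t) \<le> B" if t: "t \<in> {0..n}" for t
  proof -
    let ?T1 = "(of_nat a + s) * v * ((of_nat (Suc a) + s) * v * hom_term (Suc (Suc a)) 0 s (z t))"
    let ?T2 = "(of_nat a + s) * v * (s * cnj v * hom_term (Suc a) 1 s (z t))"
    let ?T3 = "s * cnj v * ((of_nat a + s) * v * hom_term (Suc a) 1 s (z t))"
    let ?T4 = "s * cnj v * ((1 + s) * cnj v * hom_term a 2 s (z t))"
    have "f2 t = ?T1 + ?T2 + ?T3 + ?T4" by (simp add: f2_def algebra_simps)
    then have "norm (f2 t) \<le> cmod ?T1 + cmod ?T2 + cmod ?T3 + cmod ?T4"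
      by (metis (no_types, lifting) add_mono_thms_linordered_semiring(3) norm_triangle_le order_refl)
    also have "\<dots> \<le> m^2 * (cmod v)^2 * Y + m^2 * (cmod v)^2 * Y + m^2 * (cmod v)^2 * Y + m^2 * (cmod v)^2 * Y"
      by (intro add_mono tm b1 hb[OF t]) auto
    also have "\<dots> = B" by (simp add: B_def m_def Y_def)
    finally show ?thesis .
  qed
  have B0: "B \<ge> 0" by (simp add: B_def)
  have s1: "norm (f1 t - f1 0) \<le> B * n" if t: "t \<in> {0..n}" for t
  proof -
    have "norm (f1 t - f1 0) \<le> B * norm (t - 0)"
    proof (rule differentiable_bound[where f' = "\<lambda>t h. h *\<^sub>R f2 t" and S = "{0..n}"])
      show "(f1 has_derivative (\<lambda>h. h *\<^sub>R f2 u)) (at u within {0..n})" if "u \<in> {0..n}" for u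
        using d1[OF that] by (simp add: has_vector_derivative_def)
      show "onorm (\<lambda>h. h *\<^sub>R f2 u) \<le> B" if "u \<in> {0..n}" for u
        using f2b[OF that] by (intro onorm_le) (simp, metis abs_ge_zero mult.commute mult_right_mono)
    qed (use n t in auto)
    also have "\<dots> \<le> B * n" using t B0 by (intro mult_left_mono) auto
    finally show ?thesis .
  qed
  define g where "g t = f0 t - of_real t * f1 0" for t
  have "norm (g n - g 0) \<le> (B * n) * norm (n - 0)"
  proof (rule differentiable_bound[where f' = "\<lambda>t h. h *\<^sub>R (f1 t - f1 0)" and S = "{0..n}"])
    show "(g has_derivative (\<lambda>h. h *\<^sub>R (f1 u - f1 0))) (at u within {0..n})" if u: "u \<in> {0..n}" for u
    proof -
      have "((\<lambda>t. of_real t * f1 0) has_vector_derivative f1 0) (at u within {0..n})"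
        by (auto intro!: derivative_eq_intros simp: has_vector_derivative_def scaleR_conv_of_real fun_eq_iff)
      from has_vector_derivative_diff[OF d0[OF u] this] show ?thesis
        by (simp add: has_vector_derivative_def g_def[abs_def])
    qed
    show "onorm (\<lambda>h. h *\<^sub>R (f1 u - f1 0)) \<le> B * n" if "u \<in> {0..n}" for u
      using s1[OF that] by (intro onorm_le) (simp, metis abs_ge_zero mult.commute mult_right_mono)
  qed (use n in auto)
  moreover have "g n - g 0 = hom_term a 0 s (\<omega> + of_real n * v) - hom_term a 0 s \<omega>
           - of_real n * (- (of_nat a + s) * v * hom_term (Suc a) 0 s \<omega> - s * cnj v * hom_term a 1 s \<omega>)"
    by (simp add: g_def f0_def f1_def z_def)
  ultimately show ?thesis using n by simp
qed

section \<open>Regularized lattice sums\<close>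

definition lattice_point :: "complex \<Rightarrow> int \<times> int \<Rightarrow> complex" where
  "lattice_point \<tau> p = of_int (fst p) * \<tau> + of_int (snd p)"

definition res_class :: "nat \<Rightarrow> int \<times> int \<Rightarrow> (int \<times> int) set" where
  "res_class N l = {(c, d). [c = fst l] (mod int N) \<and> [d = snd l] (mod int N)}"

text \<open>
  In \<open>D\<^sub>\<tau> F - cnj \<tau> D\<^sub>1 F\<close>, with \<open>D\<^sub>v\<close> the derivative in the direction \<open>v\<close>, the derivatives with respect
  to \<open>cnj z\<close> cancel and \<open>(\<tau> - cnj \<tau>) \<partial>F/\<partial>z\<close> is left. For \<open>F = hom_term (k - 1) 0 s\<close> this is
  \<open>- (\<tau> - cnj \<tau>) (k - 1 + s) hom_term k 0 s\<close>. So the quotient below approximates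
  \<open>- hom_term k 0 s \<omega>\<close> by differences with the steps \<open>N \<tau>\<close> and \<open>N\<close>, which preserve a residue class.
\<close>

definition reg_term :: "nat \<Rightarrow> nat \<Rightarrow> complex \<Rightarrow> complex \<Rightarrow> complex \<Rightarrow> complex" where
  "reg_term k N \<tau> s \<omega> = hom_term k 0 s \<omega> +
     ((hom_term (k - 1) 0 s (\<omega> + of_nat N * \<tau>) - hom_term (k - 1) 0 s \<omega>)
      - cnj \<tau> * (hom_term (k - 1) 0 s (\<omega> + of_nat N) - hom_term (k - 1) 0 s \<omega>)) /
     (of_nat N * (\<tau> - cnj \<tau>) * (of_nat (k - 1) + s))"

text \<open>
  The first order terms cancel, so the term decays like \<open>|\<omega>|\<close> to the power \<open>- Re (k + 2 s) - 1\<close>: one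
  order is gained over \<open>hom_term k 0 s\<close>.
\<close>

lemma reg_term_bound:
  assumes k: "k \<ge> 2" and N: "N \<ge> 1" and \<tau>: "Im \<tau> > 0"
    and s: "Re (of_nat k + 2 * s) > 1" and \<omega>: "\<omega> \<noteq> 0" "2 * real N * (1 + cmod \<tau>) \<le> cmod \<omega>"
  shows "norm (reg_term k N \<tau> s \<omega>) \<le>
    4 * real N * (1 + cmod \<tau>)^3 / Im \<tau> * ((real k + 1 + cmod s)^2 *
      (2 powr (real k + 1 + 2 * Re s) * cmod \<omega> powr (- (real k + 1 + 2 * Re s))))"
proof -
  define K where "K = k - 1"
  have kK: "k = Suc K" "K \<ge> 1" using k by (auto simp: K_def)
  define x where "x = real k + 1 + 2 * Re s"
  define Y where "Y = (real k + 1 + cmod s)^2 * (2 powr x * cmod \<omega> powr (- x))"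
  have Y0: "Y \<ge> 0" by (simp add: Y_def)
  have xK: "x = real K + 2 + 2 * Re s" by (simp add: x_def kK)
  have x0: "x \<ge> 0" using s by (simp add: x_def)
  define E where "E v = hom_term K 0 s (\<omega> + of_real (real N) * v) - hom_term K 0 s \<omega>
           - of_real (real N) * (- (of_nat K + s) * v * hom_term (Suc K) 0 s \<omega> - s * cnj v * hom_term K 1 s \<omega>)" for v
  have Eb: "norm (E v) \<le> 4 * (cmod v)^2 * Y * real N * real N" if v: "cmod v \<le> 1 + cmod \<tau>" for v
  proof -
    have "2 * real N * cmod v \<le> cmod \<omega>"
      using \<omega>(2) v by (meson mult_left_mono mult_nonneg_nonneg of_nat_0_le_iff order_trans zero_le_numeral)
    from hom_term_taylor[OF _ \<omega>(1) this, of K s] x0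
    have "norm (E v) \<le> 4 * (real K + 2 + cmod s)^2 * (cmod v)^2 * (2 powr x * cmod \<omega> powr (- x)) * real N * real N"
      unfolding E_def xK by simp
    moreover have "real K + 2 = real k + 1" by (simp add: kK)
    ultimately show ?thesis by (simp only: Y_def mult_ac)
  qed
  have Ks: "cmod (of_nat K + s) \<ge> 1/2"
  proof -
    have "Re (of_nat K + s) \<ge> 1/2" using s kK by simp
    then show ?thesis using complex_Re_le_cmod order_trans by blast
  qed
  then have Ks0: "of_nat K + s \<noteq> 0" by auto
  have t0: "\<tau> - cnj \<tau> \<noteq> 0" using \<tau> by (auto simp: complex_eq_iff)
  have N0: "complex_of_nat N \<noteq> 0" using N by simp
  \<comment> \<open>The terms with \<open>hom_term K 1\<close> cancel between the directions \<open>\<tau>\<close> and \<open>1\<close>.\<close>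
  have "reg_term k N \<tau> s \<omega> = (E \<tau> - cnj \<tau> * E 1) / (of_nat N * (\<tau> - cnj \<tau>) * (of_nat K + s))"
  proof -
    have "E \<tau> - cnj \<tau> * E 1 = (hom_term K 0 s (\<omega> + of_nat N * \<tau>) - hom_term K 0 s \<omega>)
      - cnj \<tau> * (hom_term K 0 s (\<omega> + of_nat N) - hom_term K 0 s \<omega>)
      + (of_nat N * (\<tau> - cnj \<tau>) * (of_nat K + s)) * hom_term k 0 s \<omega>"
      by (simp add: E_def kK algebra_simps)
    then show ?thesis
      using t0 N0 Ks0 unfolding reg_term_def K_def[symmetric] by (simp add: add_divide_distrib)
  qed
  then have "norm (reg_term k N \<tau> s \<omega>) = norm (E \<tau> - cnj \<tau> * E 1) / (real N * (2 * Im \<tau>) * cmod (of_nat K + s))"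
  proof -
    have "cmod (\<tau> - cnj \<tau>) = 2 * Im \<tau>" using \<tau> by (simp add: complex_diff_cnj norm_mult)
    then show ?thesis using \<open>reg_term k N \<tau> s \<omega> = _\<close> by (simp add: norm_divide norm_mult)
  qed
  also have "\<dots> \<le> norm (E \<tau> - cnj \<tau> * E 1) / (real N * (2 * Im \<tau>) * (1/2))"
    using Ks \<tau> N by (intro divide_left_mono mult_left_mono mult_pos_pos) (auto intro: less_le_trans[of 0 "1/2"])
  also have "\<dots> = norm (E \<tau> - cnj \<tau> * E 1) / (real N * Im \<tau>)" by simp
  also have "\<dots> \<le> (4 * (1 + cmod \<tau>)^3 * Y * real N * real N) / (real N * Im \<tau>)"
  proof (rule divide_right_mono)
    have "norm (E \<tau> - cnj \<tau> * E 1) \<le> norm (E \<tau>) + cmod \<tau> * norm (E 1)"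
      by (rule order_trans[OF norm_triangle_ineq4]) (simp add: norm_mult)
    also have "\<dots> \<le> 4 * (cmod \<tau>)^2 * Y * real N * real N + cmod \<tau> * (4 * (cmod 1)^2 * Y * real N * real N)"
      by (intro add_mono mult_left_mono Eb) auto
    also have "\<dots> = ((cmod \<tau>)^2 + cmod \<tau>) * (4 * Y * real N * real N)" by (simp add: algebra_simps)
    also have "\<dots> \<le> (1 + cmod \<tau>)^3 * (4 * Y * real N * real N)"
      using Y0 by (intro mult_right_mono) (auto simp: power3_eq_cube power2_eq_square algebra_simps)
    finally show "norm (E \<tau> - cnj \<tau> * E 1) \<le> 4 * (1 + cmod \<tau>)^3 * Y * real N * real N" by (simp add: mult_ac)
  qed (use \<tau> in auto)
  also have "\<dots> = 4 * real N * (1 + cmod \<tau>)^3 / Im \<tau> * Y" using N by (simp add: field_simps)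
  finally show ?thesis unfolding Y_def x_def .
qed

abbreviation half_plane :: "nat \<Rightarrow> real \<Rightarrow> complex set" where
  "half_plane k b \<equiv> {s. Re (of_nat k + 2 * s) > b}"

lemma half_plane_open: "open (half_plane k b)"
  by (intro open_Collect_less continuous_intros)

lemma half_plane_connected: "connected (half_plane k b)"
proof -
  have "half_plane k b = {s. Re s > (b - real k) / 2}" by (auto simp: field_simps)
  then show ?thesis using convex_connected[OF convex_halfspace_Re_gt] by metis
qed

lemma half_plane_cball:
  assumes "s0 \<in> half_plane k b"
  obtains r where "r > 0" "cball s0 r \<subseteq> half_plane k b"
    "\<And>s. s \<in> cball s0 r \<Longrightarrow> Re (of_nat k + 2 * s) \<ge> (Re (of_nat k + 2 * s0) + b) / 2"
    "\<And>s. s \<in> cball s0 r \<Longrightarrow> Re s \<le> Re s0 + r \<and> cmod s \<le> cmod s0 + r"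
proof -
  define r where "r = (Re (of_nat k + 2 * s0) - b) / 4"
  have r: "r > 0" using assms by (simp add: r_def)
  have *: "Re s0 - r \<le> Re s \<and> Re s \<le> Re s0 + r \<and> cmod s \<le> cmod s0 + r" if "s \<in> cball s0 r" for s
  proof -
    have d: "cmod (s0 - s) \<le> r" using that by (simp add: dist_norm)
    have "\<bar>Re (s0 - s)\<bar> \<le> r" using abs_Re_le_cmod d order_trans by blast
    moreover have "cmod s \<le> cmod s0 + cmod (s0 - s)"
      by (metis add_diff_cancel_right' diff_diff_eq2 norm_minus_commute norm_triangle_sub)
    ultimately show ?thesis using d by auto
  qed
  have **: "Re (of_nat k + 2 * s) \<ge> (Re (of_nat k + 2 * s0) + b) / 2" if "s \<in> cball s0 r" for s
    using *[OF that] by (simp add: r_def field_simps)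
  have "cball s0 r \<subseteq> half_plane k b"
  proof
    fix s assume "s \<in> cball s0 r"
    from **[OF this] assms show "s \<in> half_plane k b" by simp
  qed
  then show thesis using that r * ** by blast
qed

lemma summable_on_lattice_point_powr:
  assumes "Im \<tau> > 0" "x > 2"
  shows "(\<lambda>p. cmod (lattice_point \<tau> p) powr (- x)) summable_on I"
  by (rule summable_on_subset_banach[of _ UNIV])
     (use summable_on_lattice_powr[OF assms] in \<open>simp_all add: lattice_point_def case_prod_unfold\<close>)

lemma finite_lattice_point_ball: "Im \<tau> > 0 \<Longrightarrow> finite {p. cmod (lattice_point \<tau> p) < R}"
  using finite_lattice_ball[of \<tau> R] by (simp add: lattice_point_def case_prod_unfold)

lemma norm_hom_term_le:
  assumes "a > 0"
  shows "norm (hom_term a 0 s z) \<le> cmod z powr (- (real a + 2 * Re s))"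
  using norm_hom_term[of z a 0 s] hom_term_0[OF assms, of 0 s] by (cases "z = 0") auto

lemma hom_term_summable:
  assumes "Im \<tau> > 0" "a > 0" "real a + 2 * Re s > 2"
  shows "(\<lambda>p. norm (hom_term a 0 s (lattice_point \<tau> p))) summable_on I"
  by (rule summable_on_comparison_test[OF summable_on_lattice_point_powr[OF assms(1,3)]])
     (use norm_hom_term_le[OF assms(2)] in auto)

lemma hom_term_series_holomorphic:
  assumes \<tau>: "Im \<tau> > 0" and k: "k > 0"
  shows "(\<lambda>s. \<Sum>\<^sub>\<infinity>p\<in>I. hom_term k 0 s (lattice_point \<tau> p)) holomorphic_on half_plane k 2"
proof (rule holomorphic_infsum(1)[OF half_plane_open])
  show "(\<lambda>s. hom_term k 0 s (lattice_point \<tau> p)) holomorphic_on half_plane k 2" for p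
    by (rule hom_term_holomorphic[OF k])
  fix s0 assume s0: "s0 \<in> half_plane k 2"
  obtain r where r: "r > 0" "cball s0 r \<subseteq> half_plane k 2"
    "\<And>s. s \<in> cball s0 r \<Longrightarrow> Re (of_nat k + 2 * s) \<ge> (Re (of_nat k + 2 * s0) + 2) / 2"
    using half_plane_cball[OF s0] by metis
  define x where "x = (Re (of_nat k + 2 * s0) + 2) / 2"
  have x: "x > 2" using s0 by (simp add: x_def)
  have "norm (hom_term k 0 s (lattice_point \<tau> p)) \<le> cmod (lattice_point \<tau> p) powr (- x)"
    if p: "p \<in> I - {p. cmod (lattice_point \<tau> p) < 1}" and s: "s \<in> cball s0 r" for p s
  proof -
    have "real k + 2 * Re s \<ge> x" using r(3)[OF s] by (simp add: x_def)
    then have "cmod (lattice_point \<tau> p) powr (- (real k + 2 * Re s)) \<le> cmod (lattice_point \<tau> p) powr (- x)"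
      using p by (intro powr_mono) auto
    then show ?thesis using norm_hom_term_le[OF k] order_trans by blast
  qed
  then show "\<exists>r>0. \<exists>F M. cball s0 r \<subseteq> half_plane k 2 \<and> finite F \<and> M summable_on I \<and>
                (\<forall>p\<in>I - F. \<forall>s\<in>cball s0 r. norm (hom_term k 0 s (lattice_point \<tau> p)) \<le> M p)"
    using r(1,2) finite_lattice_point_ball[OF \<tau>, of 1] summable_on_lattice_point_powr[OF \<tau> x, of I]
    by (intro exI[of _ r] conjI exI[of _ "{p. cmod (lattice_point \<tau> p) < 1}"]
          exI[of _ "\<lambda>p. cmod (lattice_point \<tau> p) powr (- x)"]) auto
qed

text \<open>
  The exponent \<open>Re (k + 2 s) + 1\<close> of the decay exceeds \<open>2\<close> exactly for \<open>Re (k + 2 s) > 1\<close>.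
\<close>

lemma reg_term_series:
  assumes \<tau>: "Im \<tau> > 0" and k: "k \<ge> 2" and N: "N \<ge> 1"
  shows "(\<lambda>s. \<Sum>\<^sub>\<infinity>p\<in>I. reg_term k N \<tau> s (lattice_point \<tau> p)) holomorphic_on half_plane k 1" (is ?hol)
    and "\<And>s. s \<in> half_plane k 1 \<Longrightarrow> (\<lambda>p. norm (reg_term k N \<tau> s (lattice_point \<tau> p))) summable_on I"
proof -
  have hol: "(\<lambda>s. reg_term k N \<tau> s (lattice_point \<tau> p)) holomorphic_on half_plane k 1" for p
  proof -
    have t0: "\<tau> - cnj \<tau> \<noteq> 0" using \<tau> by (auto simp: complex_eq_iff)
    have ks: "of_nat (k - 1) + s \<noteq> 0" if "s \<in> half_plane k 1" for s
    proof -
      have "Re (of_nat (k - 1) + s) > 0" using that k by (simp add: of_nat_diff)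
      then show ?thesis by (metis less_irrefl zero_complex.sel(1))
    qed
    have k1: "k - 1 > 0" "k > 0" using k by auto
    show ?thesis unfolding reg_term_def
      by (intro holomorphic_intros hom_term_holomorphic k1) (use t0 ks N in auto)
  qed
  have bnd: "\<exists>r>0. \<exists>F M. cball s0 r \<subseteq> half_plane k 1 \<and> finite F \<and> M summable_on I \<and>
                (\<forall>p\<in>I - F. \<forall>s\<in>cball s0 r. norm (reg_term k N \<tau> s (lattice_point \<tau> p)) \<le> M p)"
    if s0: "s0 \<in> half_plane k 1" for s0
  proof -
    obtain r where r: "r > 0" "cball s0 r \<subseteq> half_plane k 1"
      "\<And>s. s \<in> cball s0 r \<Longrightarrow> Re (of_nat k + 2 * s) \<ge> (Re (of_nat k + 2 * s0) + 1) / 2"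
      "\<And>s. s \<in> cball s0 r \<Longrightarrow> Re s \<le> Re s0 + r \<and> cmod s \<le> cmod s0 + r"
      using half_plane_cball[OF s0] by metis
    define x where "x = (Re (of_nat k + 2 * s0) + 1) / 2 + 1"
    have x: "x > 2" using s0 by (simp add: x_def)
    define R where "R = max 1 (2 * real N * (1 + cmod \<tau>))"
    define C where "C = 4 * real N * (1 + cmod \<tau>)^3 / Im \<tau>"
    have C: "C \<ge> 0" using \<tau> by (simp add: C_def)
    define D where "D = (real k + 1 + (cmod s0 + r))^2 * 2 powr (real k + 1 + 2 * (Re s0 + r))"
    have "norm (reg_term k N \<tau> s (lattice_point \<tau> p)) \<le> C * (D * cmod (lattice_point \<tau> p) powr (- x))"
      if p: "p \<in> I - {p. cmod (lattice_point \<tau> p) < R}" and s: "s \<in> cball s0 r" for p s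
    proof -
      let ?\<omega> = "lattice_point \<tau> p"
      have w: "cmod ?\<omega> \<ge> 1" "2 * real N * (1 + cmod \<tau>) \<le> cmod ?\<omega>" using p by (auto simp: R_def)
      then have w0: "?\<omega> \<noteq> 0" by auto
      have s1: "Re (of_nat k + 2 * s) > 1" using r(2) s by auto
      have "norm (reg_term k N \<tau> s ?\<omega>) \<le> C * ((real k + 1 + cmod s)^2 *
          (2 powr (real k + 1 + 2 * Re s) * cmod ?\<omega> powr (- (real k + 1 + 2 * Re s))))"
        unfolding C_def by (rule reg_term_bound[OF k N \<tau> s1 w0 w(2)])
      also have "\<dots> \<le> C * ((real k + 1 + (cmod s0 + r))^2 *
          (2 powr (real k + 1 + 2 * (Re s0 + r)) * cmod ?\<omega> powr (- x)))"
      proof (intro mult_left_mono[OF _ C] mult_mono power_mono)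
        show "2 powr (real k + 1 + 2 * Re s) \<le> 2 powr (real k + 1 + 2 * (Re s0 + r))"
          using r(4)[OF s] by (intro powr_mono) auto
        show "cmod ?\<omega> powr (- (real k + 1 + 2 * Re s)) \<le> cmod ?\<omega> powr (- x)"
          using r(3)[OF s] w by (intro powr_mono) (auto simp: x_def field_simps)
      qed (use r(4)[OF s] in auto)
      finally show ?thesis by (simp add: D_def mult_ac)
    qed
    moreover have "(\<lambda>p. C * (D * cmod (lattice_point \<tau> p) powr (- x))) summable_on I"
      by (intro summable_on_cmult_right summable_on_lattice_point_powr \<tau> x)
    ultimately show ?thesis using r(1,2) finite_lattice_point_ball[OF \<tau>, of R]
      by (intro exI[of _ r] conjI exI[of _ "{p. cmod (lattice_point \<tau> p) < R}"]
            exI[of _ "\<lambda>p. C * (D * cmod (lattice_point \<tau> p) powr (- x))"]) auto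
  qed
  show ?hol by (rule holomorphic_infsum(1)[OF half_plane_open hol bnd])
  show "(\<lambda>p. norm (reg_term k N \<tau> s (lattice_point \<tau> p))) summable_on I" if "s \<in> half_plane k 1" for s
    by (rule holomorphic_infsum(2)[OF half_plane_open hol bnd that])
qed

lemma cong_add_multiple:
  fixes a c x :: int
  assumes "[a = 0] (mod int N)"
  shows "[c + a = x] (mod int N) \<longleftrightarrow> [c = x] (mod int N)"
    and "[c - a = x] (mod int N) \<longleftrightarrow> [c = x] (mod int N)"
proof -
  have d: "int N dvd a" using assms by (simp add: cong_0_iff)
  have "c + a - x = a + (c - x)" "c - a - x = - a + (c - x)" by simp_all
  then show "[c + a = x] (mod int N) \<longleftrightarrow> [c = x] (mod int N)"
    "[c - a = x] (mod int N) \<longleftrightarrow> [c = x] (mod int N)"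
    unfolding cong_iff_dvd_diff using dvd_add_right_iff[OF d] dvd_add_right_iff[of "int N" "- a"] d
    by (metis, metis dvd_minus_iff)
qed

lemma infsum_res_class_shift:
  assumes "[a = 0] (mod int N)" "[b = 0] (mod int N)"
  shows "(\<Sum>\<^sub>\<infinity>p\<in>res_class N l. f (lattice_point \<tau> p + of_int a * \<tau> + of_int b)) = (\<Sum>\<^sub>\<infinity>p\<in>res_class N l. f (lattice_point \<tau> p))"
proof (rule infsum_reindex_bij_witness[where i = "\<lambda>p. (fst p - a, snd p - b)" and j = "\<lambda>p. (fst p + a, snd p + b)"])
  fix p assume p: "p \<in> res_class N l"
  show "(fst p + a, snd p + b) \<in> res_class N l" "(fst p - a, snd p - b) \<in> res_class N l"
    using p by (simp_all add: res_class_def case_prod_unfold cong_add_multiple[OF assms(1)] cong_add_multiple[OF assms(2)])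
  show "f (lattice_point \<tau> (fst p + a, snd p + b)) = f (lattice_point \<tau> p + of_int a * \<tau> + of_int b)"
    by (simp add: lattice_point_def distrib_right add_ac)
qed simp_all

lemma has_sum_diff:
  fixes f g :: "'i \<Rightarrow> complex"
  assumes "(f has_sum a) A" "(g has_sum b) A"
  shows "((\<lambda>x. f x - g x) has_sum (a - b)) A"
  using has_sum_add[OF assms(1) has_sum_uminusI[OF assms(2)]] by simp

text \<open>
  For \<open>Re (k + 2 s) > 3\<close> the sum of \<open>hom_term (k - 1) 0 s\<close> converges absolutely itself and is invariant
  under the translations by \<open>N\<close> and \<open>N \<tau>\<close>, so the differences contribute nothing.
\<close>

lemma reg_term_series_eq:
  assumes \<tau>: "Im \<tau> > 0" and k: "k \<ge> 2" and N: "N \<ge> 1" and s: "Re (of_nat k + 2 * s) > 3"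
  shows "(\<Sum>\<^sub>\<infinity>p\<in>res_class N l. reg_term k N \<tau> s (lattice_point \<tau> p)) =
         (\<Sum>\<^sub>\<infinity>p\<in>res_class N l. hom_term k 0 s (lattice_point \<tau> p))"
proof -
  define A where "A = res_class N l"
  define c where "c = of_nat N * (\<tau> - cnj \<tau>) * (of_nat (k - 1) + s)"
  let ?F = "hom_term (k - 1) 0 s"
  have k1: "k - 1 > 0" "k > 0" using k by auto
  have s1: "(\<lambda>p. hom_term k 0 s (lattice_point \<tau> p)) summable_on A"
    by (rule abs_summable_summable[OF hom_term_summable[OF \<tau> k1(2)]]) (use s in simp)
  have s2: "(\<lambda>p. ?F (lattice_point \<tau> p)) summable_on A" for A
    by (rule abs_summable_summable[OF hom_term_summable[OF \<tau> k1(1)]]) (use s k in \<open>simp add: of_nat_diff\<close>)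
  have sh: "(\<lambda>p. ?F (lattice_point \<tau> p + of_int a * \<tau> + of_int b)) summable_on A" for a b :: int
  proof -
    have "(\<lambda>p. ?F (lattice_point \<tau> p)) summable_on ((\<lambda>p. (fst p + a, snd p + b)) ` A)" by (rule s2)
    then show ?thesis
      using summable_on_reindex[of "\<lambda>p. (fst p + a, snd p + b)" A "\<lambda>p. ?F (lattice_point \<tau> p)"]
      by (simp add: inj_on_def o_def lattice_point_def distrib_right add_ac prod_eq_iff)
  qed
  have e: "(\<Sum>\<^sub>\<infinity>p\<in>A. ?F (lattice_point \<tau> p + of_int a * \<tau> + of_int b)) = (\<Sum>\<^sub>\<infinity>p\<in>A. ?F (lattice_point \<tau> p))"
    if "[a = 0] (mod int N)" "[b = 0] (mod int N)" for a b
    unfolding A_def by (rule infsum_res_class_shift[OF that])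
  have hs: "((\<lambda>p. ?F (lattice_point \<tau> p + of_int a * \<tau> + of_int b)) has_sum (\<Sum>\<^sub>\<infinity>p\<in>A. ?F (lattice_point \<tau> p))) A"
    if "[a = 0] (mod int N)" "[b = 0] (mod int N)" for a b
    using has_sum_infsum[OF sh[of a b]] e[OF that] by simp
  have "((\<lambda>p. hom_term k 0 s (lattice_point \<tau> p) + ((?F (lattice_point \<tau> p + of_int (int N) * \<tau> + of_int 0) - ?F (lattice_point \<tau> p + of_int 0 * \<tau> + of_int 0))
      - cnj \<tau> * (?F (lattice_point \<tau> p + of_int 0 * \<tau> + of_int (int N)) - ?F (lattice_point \<tau> p + of_int 0 * \<tau> + of_int 0))) * inverse c)
     has_sum ((\<Sum>\<^sub>\<infinity>p\<in>A. hom_term k 0 s (lattice_point \<tau> p)) + (((\<Sum>\<^sub>\<infinity>p\<in>A. ?F (lattice_point \<tau> p)) - (\<Sum>\<^sub>\<infinity>p\<in>A. ?F (lattice_point \<tau> p)))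
      - cnj \<tau> * ((\<Sum>\<^sub>\<infinity>p\<in>A. ?F (lattice_point \<tau> p)) - (\<Sum>\<^sub>\<infinity>p\<in>A. ?F (lattice_point \<tau> p)))) * inverse c)) A"
    by (intro has_sum_add has_sum_diff has_sum_cmult_left has_sum_cmult_right hs has_sum_infsum s1) (auto simp: cong_def)
  then have "((\<lambda>p. reg_term k N \<tau> s (lattice_point \<tau> p)) has_sum (\<Sum>\<^sub>\<infinity>p\<in>A. hom_term k 0 s (lattice_point \<tau> p))) A"
    by (simp add: reg_term_def c_def divide_inverse)
  then show ?thesis unfolding A_def by (rule infsumI)
qed

section \<open>The Lipschitz formula\<close>

text \<open>
  The logarithmic derivative of \<open>\<Gamma>(z) \<Gamma>(1 - z) = \<pi> / sin (\<pi> z)\<close>.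
\<close>

lemma Digamma_reflection:
  fixes z :: complex
  assumes z: "z \<notin> \<int>"
  shows "Digamma z - Digamma (1 - z) = - (of_real pi * cot (of_real pi * z))"
proof -
  have z1: "1 - z \<notin> \<int>" using z by (metis Ints_1 Ints_diff add_diff_cancel_left' diff_add_cancel)
  have n: "z \<notin> \<int>\<^sub>\<le>\<^sub>0" "1 - z \<notin> \<int>\<^sub>\<le>\<^sub>0" using z z1 nonpos_Ints_subset_Ints by blast+
  have s0: "sin (of_real pi * z) \<noteq> 0"
  proof
    assume "sin (of_real pi * z) = 0"
    then obtain m :: int where "of_real pi * z = of_real (of_int m * pi)" by (auto simp: sin_eq_0)
    then have "z = of_int m" by (simp add: field_simps)
    with z show False by simp
  qed
  have "((\<lambda>z. Gamma z * Gamma (1 - z)) has_field_derivative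
      Gamma z * Gamma (1 - z) * (Digamma z - Digamma (1 - z))) (at z)"
    using n by (auto intro!: derivative_eq_intros simp: algebra_simps)
  moreover have "((\<lambda>z. of_real pi / sin (of_real pi * z)) has_field_derivative
      of_real pi / sin (of_real pi * z) * (- (of_real pi * cot (of_real pi * z)))) (at z)"
    using s0 by (auto intro!: derivative_eq_intros simp: cot_def field_simps)
  ultimately have "Gamma z * Gamma (1 - z) * (Digamma z - Digamma (1 - z)) =
      of_real pi / sin (of_real pi * z) * (- (of_real pi * cot (of_real pi * z)))"
    unfolding Gamma_reflection_complex by (rule DERIV_unique)
  then show ?thesis unfolding Gamma_reflection_complex mult_cancel_left using s0 by simp
qed

lemma sum_int_interval_Suc:
  fixes f :: "int \<Rightarrow> complex"
  shows "sum f {- int (Suc m)..<int (Suc m)} = sum f {- int m..<int m} + f (int m) + f (- int m - 1)"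
proof -
  have "{- int (Suc m)..<int (Suc m)} = insert (int m) (insert (- int m - 1) {- int m..<int m})" by auto
  then show ?thesis by simp
qed

text \<open>
  The sum is not absolutely convergent; the half-open summation range matches the limit formula of
  the Digamma function at \<open>z\<close> and at \<open>1 - z\<close>. With \<open>1 / 0 = 0\<close> and \<open>cot 0 = 0\<close> the formula also holds
  at \<open>z = 0\<close>, which covers the row through the origin.
\<close>

lemma cot_partial_fractions:
  fixes z :: complex
  assumes z: "z \<notin> \<int> \<or> z = 0"
  shows "(\<lambda>m. \<Sum>j\<in>{- int m..<int m}. 1 / (z + of_int j)) \<longlonglongrightarrow> of_real pi * cot (of_real pi * z)"
proof (cases "z = 0")
  case True
  have "(\<Sum>j\<in>{- int m..<int m}. 1 / (0 + of_int j)) = - (1 / complex_of_nat m)" for m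
  proof (induction m)
    case (Suc m)
    have "complex_of_int (- int m - 1) = - of_nat (Suc m)" by simp
    then have "1 / (0 + of_int (- int m - 1)) = - (1 / complex_of_nat (Suc m))"
      by (simp only: add_0 divide_minus_right)
    then show ?case unfolding sum_int_interval_Suc Suc by simp
  qed simp
  moreover have "(\<lambda>m. - (1 / complex_of_nat m)) \<longlonglongrightarrow> - 0"
    by (intro tendsto_minus lim_1_over_n)
  ultimately show ?thesis using True by simp
next
  case False
  with z have z: "z \<notin> \<int>" by simp
  have z0: "z \<noteq> 0" "1 - z \<noteq> 0" using z by auto
  have "(\<lambda>m. (of_real (ln (real m)) - (\<Sum>n<m. inverse (1 - z + of_nat n))) -
       (of_real (ln (real m)) - (\<Sum>n<m. inverse (z + of_nat n)))) \<longlonglongrightarrow> Digamma (1 - z) - Digamma z"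
    by (intro tendsto_diff Digamma_LIMSEQ z0)
  moreover have "(of_real (ln (real m)) - (\<Sum>n<m. inverse (1 - z + of_nat n))) -
       (of_real (ln (real m)) - (\<Sum>n<m. inverse (z + of_nat n))) =
      (\<Sum>j\<in>{- int m..<int m}. 1 / (z + of_int j))" for m
  proof (induction m)
    case (Suc m)
    have "1 / (z + of_int (- int m - 1)) = - inverse (1 - z + of_nat m)"
    proof -
      have "z + of_int (- int m - 1) = - (1 - z + of_nat m)" by simp
      then show ?thesis by (simp only: divide_inverse mult_1 inverse_minus_eq)
    qed
    then show ?case unfolding sum_int_interval_Suc Suc[symmetric] by (simp add: divide_inverse)
  qed simp
  moreover have "Digamma (1 - z) - Digamma z = of_real pi * cot (of_real pi * z)"
    using Digamma_reflection[OF z] by (simp add: algebra_simps)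
  ultimately show ?thesis by simp
qed

lemma exp_2pii_eq_1_iff: "exp (2 * of_real pi * \<i> * z) = 1 \<longleftrightarrow> z \<in> \<int>"
proof
  assume "exp (2 * of_real pi * \<i> * z) = 1"
  then obtain n :: int where n: "Re (2 * of_real pi * \<i> * z) = 0" "Im (2 * of_real pi * \<i> * z) = of_int (2 * n) * pi"
    unfolding exp_eq_1 by blast
  then have "z = of_int n" by (auto simp: complex_eq_iff)
  then show "z \<in> \<int>" by simp
next
  assume "z \<in> \<int>"
  then obtain n where "z = of_int n" by (auto elim: Ints_cases)
  then show "exp (2 * of_real pi * \<i> * z) = 1"
    by (auto simp: exp_eq_1 intro!: exI[of _ n])
qed

lemma pi_cot_exp:
  assumes z: "z \<notin> \<int>"
  shows "of_real pi * cot (of_real pi * z) =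
    - (of_real pi * \<i> * (1 + exp (2 * of_real pi * \<i> * z)) / (1 - exp (2 * of_real pi * \<i> * z)))"
proof -
  define w where "w = exp (\<i> * (of_real pi * z))"
  have w0: "w \<noteq> 0" by (simp add: w_def)
  have q: "exp (2 * of_real pi * \<i> * z) = w * w"
    by (simp add: w_def exp_add[symmetric] algebra_simps)
  have q1: "w * w \<noteq> 1" using exp_2pii_eq_1_iff[of z] z q by simp
  have iw: "exp (- (\<i> * (of_real pi * z))) = inverse w" by (simp add: w_def exp_minus)
  have f: "(A / 2) / (B / (2 * \<i>)) = \<i> * (A / B)" for A B :: complex
    by (simp only: divide_divide_eq_right) simp
  have cancel: "A / w / (B / w) = A / B" for A B using w0 by simp
  have "cot (of_real pi * z) = \<i> * ((w + inverse w) / (w - inverse w))"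
    unfolding cot_def cos_exp_eq sin_exp_eq w_def[symmetric] iw f by simp
  also have "w + inverse w = (w * w + 1) / w" using w0 by (simp add: add_divide_distrib inverse_eq_divide)
  also have "w - inverse w = (w * w - 1) / w" using w0 by (simp add: diff_divide_distrib inverse_eq_divide)
  also have "(w * w + 1) / w / ((w * w - 1) / w) = (w * w + 1) / (w * w - 1)"
    by (rule cancel)
  also have "\<dots> = (1 + w * w) / - (1 - w * w)" by (simp only: minus_diff_eq add.commute)
  finally show ?thesis unfolding q by (simp only: divide_minus_right times_divide_eq_right mult_minus_right mult.assoc)
qed

text \<open>
  The numerator of the \<open>n\<close>-th iterate of \<open>q d/dq\<close> on \<open>(1 + q) / (2 (1 - q))\<close> over the denominator
  \<open>(1 - q)\<^sup>n\<^sup>+\<^sup>1\<close>. Up to \<open>- 2 \<pi> \<i>\<close> the initial function is \<open>\<pi> cot (\<pi> z)\<close> in terms of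
  \<open>q = exp (2 \<pi> \<i> z)\<close>.
\<close>

fun lipschitz_poly :: "nat \<Rightarrow> complex poly" where
  "lipschitz_poly 0 = [:1/2, 1/2:]"
| "lipschitz_poly (Suc n) = [:0, 1:] * ([:1, -1:] * pderiv (lipschitz_poly n) + Polynomial.smult (of_nat (Suc n)) (lipschitz_poly n))"

definition lipschitz_fun :: "nat \<Rightarrow> complex \<Rightarrow> complex" where
  "lipschitz_fun n q = poly (lipschitz_poly n) q / (1 - q) ^ Suc n"

lemma lipschitz_fun_deriv:
  assumes q: "q \<noteq> 1" "q \<noteq> 0"
  shows "(lipschitz_fun n has_field_derivative lipschitz_fun (Suc n) q / q) (at q)"
proof -
  let ?p = "lipschitz_poly n"
  have pd: "((\<lambda>q. (1 - q) ^ Suc n) has_field_derivative of_nat (Suc n) * (1 - q) ^ n * (- 1)) (at q)"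
    by (rule DERIV_cong[OF DERIV_power_Suc[where D = "-1"]]) (auto intro!: derivative_eq_intros)
  have "((\<lambda>q. poly ?p q / (1 - q) ^ Suc n) has_field_derivative
      (poly (pderiv ?p) q * (1 - q) ^ Suc n - poly ?p q * (of_nat (Suc n) * (1 - q) ^ n * (- 1))) / ((1 - q) ^ Suc n * (1 - q) ^ Suc n)) (at q)"
    by (rule DERIV_divide[OF poly_DERIV pd]) (use q in simp)
  moreover have "(poly (pderiv ?p) q * (1 - q) ^ Suc n - poly ?p q * (of_nat (Suc n) * (1 - q) ^ n * (- 1))) / ((1 - q) ^ Suc n * (1 - q) ^ Suc n)
     = lipschitz_fun (Suc n) q / q"
  proof -
    have "poly (pderiv ?p) q * (1 - q) ^ Suc n - poly ?p q * (of_nat (Suc n) * (1 - q) ^ n * (- 1))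
       = (1 - q) ^ n * ((1 - q) * poly (pderiv ?p) q + of_nat (Suc n) * poly ?p q)"
      by (simp add: algebra_simps)
    moreover have "poly (lipschitz_poly (Suc n)) q = q * ((1 - q) * poly (pderiv ?p) q + of_nat (Suc n) * poly ?p q)"
      by (simp only: lipschitz_poly.simps poly_mult poly_add Polynomial.poly_smult poly_pCons poly_0) (simp add: algebra_simps)
    ultimately show ?thesis using q by (simp add: lipschitz_fun_def)
  qed
  ultimately show ?thesis unfolding lipschitz_fun_def[abs_def] by metis
qed

text \<open>
  Repeated differentiation of the Digamma reflection: \<open>d/dz\<close> acts on functions of \<open>exp (2 \<pi> \<i> z)\<close> as
  \<open>2 \<pi> \<i> q d/dq\<close>.
\<close>

lemma Polygamma_reflection:
  fixes z :: complex
  assumes z: "z \<notin> \<int>"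
  shows "Polygamma n z - (-1) ^ n * Polygamma n (1 - z) =
    (2 * of_real pi * \<i>) ^ Suc n * lipschitz_fun n (exp (2 * of_real pi * \<i> * z))"
  using z
proof (induction n arbitrary: z)
  case 0
  have e: "(2 * of_real pi * \<i>) ^ Suc 0 * lipschitz_fun 0 q = of_real pi * \<i> * (1 + q) / (1 - q)" for q
  proof -
    have "lipschitz_fun 0 q = (1 + q) / (2 * (1 - q))"
      by (simp add: lipschitz_fun_def add_divide_distrib[symmetric])
    moreover have "(2 * P * \<i>) ^ Suc 0 * (Y / (2 * Z)) = P * \<i> * Y / Z" for P Y Z :: complex by simp
    ultimately show ?thesis by (simp only:)
  qed
  show ?case unfolding e using Digamma_reflection[OF 0] pi_cot_exp[OF 0] by simp
next
  case (Suc n)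
  note z = Suc.prems
  have z1: "1 - z \<notin> \<int>" using z by (metis Ints_1 Ints_diff add_diff_cancel_left' diff_add_cancel)
  have n: "z \<notin> \<int>\<^sub>\<le>\<^sub>0" "1 - z \<notin> \<int>\<^sub>\<le>\<^sub>0" using z z1 nonpos_Ints_subset_Ints by blast+
  let ?e = "\<lambda>z. exp (2 * of_real pi * \<i> * z)"
  have e1: "?e z \<noteq> 1" using exp_2pii_eq_1_iff[of z] z by auto
  have A: "((\<lambda>z. Polygamma n z - (-1) ^ n * Polygamma n (1 - z)) has_field_derivative
      Polygamma (Suc n) z - (-1) ^ Suc n * Polygamma (Suc n) (1 - z)) (at z)"
    using n by (auto intro!: derivative_eq_intros)
  have e: "(?e has_field_derivative 2 * of_real pi * \<i> * ?e z) (at z)"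
    by (auto intro!: derivative_eq_intros)
  have "((\<lambda>z. lipschitz_fun n (?e z)) has_field_derivative
      lipschitz_fun (Suc n) (?e z) / ?e z * (2 * of_real pi * \<i> * ?e z)) (at z)"
    by (rule DERIV_chain2[OF lipschitz_fun_deriv e]) (use e1 in auto)
  from DERIV_cmult[OF this, of "(2 * of_real pi * \<i>) ^ Suc n"]
  have B: "((\<lambda>z. (2 * of_real pi * \<i>) ^ Suc n * lipschitz_fun n (?e z)) has_field_derivative
      (2 * of_real pi * \<i>) ^ Suc (Suc n) * lipschitz_fun (Suc n) (?e z)) (at z)"
    by (rule DERIV_cong) (simp add: field_simps)
  have o: "open (- (\<int> :: complex set))" using closed_Ints by auto
  have "((\<lambda>z. Polygamma n z - (-1) ^ n * Polygamma n (1 - z)) has_field_derivative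
      (2 * of_real pi * \<i>) ^ Suc (Suc n) * lipschitz_fun (Suc n) (?e z)) (at z)"
    by (rule has_field_derivative_transform_within_open[OF B o]) (use z Suc.IH in auto)
  from DERIV_unique[OF A this] show ?case .
qed

lemma summable_on_int_shift_power:
  fixes z :: complex
  assumes m: "m \<ge> 2"
  shows "(\<lambda>j::int. norm (1 / (z + of_int j) ^ m)) summable_on UNIV"
proof -
  define J where "J = 2 * (cmod z + 1)"
  define F where "F = {j::int. \<bar>real_of_int j\<bar> \<le> J}"
  have fin: "finite F"
  proof (rule finite_subset)
    show "F \<subseteq> {-\<lceil>J\<rceil>..\<lceil>J\<rceil>}"
    proof
      fix j assume "j \<in> F"
      then have "\<bar>real_of_int j\<bar> \<le> J" by (simp add: F_def)
      then have "j \<le> \<lceil>J\<rceil>" "- j \<le> \<lceil>J\<rceil>" by linarith+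
      then show "j \<in> {-\<lceil>J\<rceil>..\<lceil>J\<rceil>}" by simp
    qed
  qed simp
  have s: "(\<lambda>j::int. 2 ^ m * (1 + \<bar>real_of_int j\<bar>) powr (- real m)) summable_on (UNIV - F)"
    by (rule summable_on_subset_banach[OF summable_on_cmult_right[OF summable_on_int_powr]]) (use m in auto)
  have "(\<lambda>j::int. norm (1 / (z + of_int j) ^ m)) summable_on (UNIV - F)"
  proof (rule summable_on_comparison_test[OF s])
    fix j assume "j \<in> UNIV - F"
    then have j: "\<bar>real_of_int j\<bar> > J" by (simp add: F_def)
    have "\<bar>real_of_int j\<bar> = cmod ((z + of_int j) - z)" by simp
    also have "\<dots> \<le> cmod (z + of_int j) + cmod z" by (rule norm_triangle_ineq4)
    finally have b: "(1 + \<bar>real_of_int j\<bar>) / 2 \<le> cmod (z + of_int j)" using j by (simp add: J_def)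
    have "norm (1 / (z + of_int j) ^ m) = 1 / cmod (z + of_int j) ^ m" by (simp add: norm_divide norm_power)
    also have "\<dots> \<le> 1 / ((1 + \<bar>real_of_int j\<bar>) / 2) ^ m"
      using b by (intro divide_left_mono power_mono mult_pos_pos zero_less_power) auto
    also have "\<dots> = 2 ^ m * (1 + \<bar>real_of_int j\<bar>) powr (- real m)"
    proof -
      have conv: "1 / (a / 2) ^ m = 2 ^ m * a powr (- real m)" if "a > 0" for a :: real
      proof -
        have "a powr (- real m) = 1 / a ^ m" using that by (simp add: powr_minus_divide powr_realpow)
        then show ?thesis by (simp add: power_divide)
      qed
      show ?thesis by (rule conv) simp
    qed
    finally show "norm (1 / (z + of_int j) ^ m) \<le> 2 ^ m * (1 + \<bar>real_of_int j\<bar>) powr (- real m)" .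
  qed (rule norm_ge_zero)
  from summable_on_union[OF this summable_on_finite[OF fin]]
  have "(\<lambda>j::int. norm (1 / (z + of_int j) ^ m)) summable_on ((UNIV - F) \<union> F)" .
  moreover have "(UNIV - F) \<union> F = UNIV" by blast
  ultimately show ?thesis by (simp only:)
qed

text \<open>
  The two halves of the sum over \<open>\<int>\<close> are the series of the Polygamma function at \<open>z\<close> and at
  \<open>1 - z\<close>.
\<close>

lemma lipschitz_has_sum:
  fixes z :: complex
  assumes z: "z \<notin> \<int>" and n: "n \<ge> 1"
  shows "((\<lambda>j::int. 1 / (z + of_int j) ^ Suc n) has_sum
    ((-1) ^ Suc n / fact n * ((2 * of_real pi * \<i>) ^ Suc n * lipschitz_fun n (exp (2 * of_real pi * \<i> * z))))) UNIV"
proof -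
  let ?f = "\<lambda>j::int. 1 / (z + of_int j) ^ Suc n"
  have S: "?f summable_on A" for A
    by (rule summable_on_subset_banach[OF abs_summable_summable[OF summable_on_int_shift_power]]) (use n in auto)
  have z0: "z \<noteq> 0" "1 - z \<noteq> 0" using z by auto
  have 1: "(?f has_sum ((-1) ^ Suc n * Polygamma n z / fact n)) (range int)"
  proof -
    have "(?f \<circ> int) summable_on UNIV" using S[of "range int"] by (subst (asm) summable_on_reindex) auto
    then have h: "((?f \<circ> int) has_sum infsum (?f \<circ> int) UNIV) UNIV" by (rule has_sum_infsum)
    have "(?f \<circ> int) sums ((-1) ^ Suc n * Polygamma n z / fact n)"
      using Polygamma_LIMSEQ[OF z0(1), of n] n by (simp add: o_def divide_inverse)
    with has_sum_imp_sums[OF h] have "infsum (?f \<circ> int) UNIV = (-1) ^ Suc n * Polygamma n z / fact n"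
      by (rule sums_unique2)
    with h show ?thesis by (subst has_sum_reindex) auto
  qed
  \<comment> \<open>The shift by \<open>1\<close> lists the negative integers, since \<open>z - k - 1 = - (1 - z + k)\<close>.\<close>
  have 2: "(?f has_sum (Polygamma n (1 - z) / fact n)) (range (\<lambda>k. - int k - 1))"
  proof -
    let ?g = "\<lambda>k::nat. - int k - 1"
    have inj: "inj ?g" by (auto simp: inj_on_def)
    have "(?f \<circ> ?g) summable_on UNIV" using S[of "range ?g"] inj by (subst (asm) summable_on_reindex) auto
    then have h: "((?f \<circ> ?g) has_sum infsum (?f \<circ> ?g) UNIV) UNIV" by (rule has_sum_infsum)
    have A: "(\<lambda>k. (-1) ^ Suc n * inverse ((1 - z + of_nat k) ^ Suc n)) sums
        ((-1) ^ Suc n * ((-1) ^ Suc n * Polygamma n (1 - z) / fact n))"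
      by (rule sums_mult[OF Polygamma_LIMSEQ[OF z0(2)]]) (use n in simp)
    have B: "(-1) ^ Suc n * inverse ((1 - z + of_nat k) ^ Suc n) = (?f \<circ> ?g) k" for k
    proof -
      have "z + of_int (?g k) = (-1) * (1 - z + of_nat k)" by simp
      then have "(z + of_int (?g k)) ^ Suc n = (-1) ^ Suc n * (1 - z + of_nat k) ^ Suc n"
        by (simp only: power_mult_distrib)
      moreover have "inverse ((-1) ^ Suc n :: complex) = (-1) ^ Suc n"
        by (metis inverse_minus_eq inverse_1 power_inverse)
      ultimately show ?thesis by (simp only: o_def divide_inverse mult_1 inverse_mult_distrib)
    qed
    have "(?f \<circ> ?g) sums ((-1) ^ Suc n * ((-1) ^ Suc n * Polygamma n (1 - z) / fact n))"
      using A unfolding B .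
    moreover have "((-1) ^ Suc n :: complex) * ((-1) ^ Suc n * Polygamma n (1 - z) / fact n) = Polygamma n (1 - z) / fact n"
      by (simp add: mult.assoc[symmetric] power_mult_distrib[symmetric] times_divide_eq_right[symmetric] del: times_divide_eq_right)
    ultimately have "(?f \<circ> ?g) sums (Polygamma n (1 - z) / fact n)" by (simp only:)
    with has_sum_imp_sums[OF h] have "infsum (?f \<circ> ?g) UNIV = Polygamma n (1 - z) / fact n"
      by (rule sums_unique2)
    with h inj show ?thesis by (subst has_sum_reindex) auto
  qed
  have d: "range int \<inter> range (\<lambda>k. - int k - 1) = {}" by auto
  have u: "range int \<union> range (\<lambda>k. - int k - 1) = UNIV"
  proof -
    have "j \<in> range int \<union> range (\<lambda>k. - int k - 1)" for j
    proof (cases "j \<ge> 0")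
      case True then show ?thesis by (intro UnI1 range_eqI[of _ _ "nat j"]) simp
    next
      case False then show ?thesis by (intro UnI2 range_eqI[of _ _ "nat (- j - 1)"]) simp
    qed
    then show ?thesis by blast
  qed
  have sgn: "(-1) ^ Suc n * (x - (-1) ^ n * y) = (-1) ^ Suc n * x + y" for x y :: complex
    by (cases "even n") auto
  have "(-1) ^ Suc n * Polygamma n z / fact n + Polygamma n (1 - z) / fact n =
      (-1) ^ Suc n / fact n * (Polygamma n z - (-1) ^ n * Polygamma n (1 - z))"
    unfolding times_divide_eq_left sgn by (simp only: add_divide_distrib)
  with has_sum_Un_disjoint[OF 1 2 d] show ?thesis unfolding u Polygamma_reflection[OF z] by simp
qed

text \<open>
  Termwise application of \<open>q d/dq\<close> to the geometric series. The constant term \<open>1/2\<close> of the initial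
  function disappears for \<open>n > 0\<close>, in accordance with \<open>0\<^sup>n = 0\<close>.
\<close>

lemma lipschitz_fun_series:
  assumes q: "norm q < 1"
  shows "(\<lambda>m. (if m = 0 then 1 / 2 else 1) * of_nat m ^ n * q ^ m) sums lipschitz_fun n q"
  using q
proof (induction n arbitrary: q)
  case 0
  have q1: "q \<noteq> 1" using 0 by auto
  have "(\<lambda>m. q ^ m) sums (1 / (1 - q))" by (rule geometric_sums[OF 0])
  from sums_diff[OF this sums_single[of 0 "\<lambda>_. 1/2"]]
  have "(\<lambda>m. q ^ m - (if m = 0 then 1 / 2 else 0)) sums (1 / (1 - q) - 1 / 2)" .
  moreover have "q ^ m - (if m = 0 then 1 / 2 else 0) = (if m = 0 then 1 / 2 else 1) * of_nat m ^ 0 * q ^ m" for m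
    by auto
  moreover have "1 / (1 - q) - 1 / 2 = lipschitz_fun 0 q"
    using q1 by (simp add: lipschitz_fun_def field_simps)
  ultimately show ?case by simp
next
  case (Suc n)
  show ?case
  proof (cases "q = 0")
    case True
    have "(\<lambda>m. (if m = 0 then 1 / 2 else 1) * of_nat m ^ Suc n * q ^ m) = (\<lambda>m. 0)"
      using True by (auto simp: fun_eq_iff)
    moreover have "lipschitz_fun (Suc n) q = 0" using True by (simp add: lipschitz_fun_def)
    ultimately show ?thesis by simp
  next
    case False
    let ?c = "\<lambda>n m. (if m = 0 then 1 / 2 else 1) * of_nat m ^ n :: complex"
    have q1: "q \<noteq> 1" using Suc.prems by auto
    have sm: "summable (\<lambda>m. ?c n m * z ^ m)" if "norm z < 1" for z
      using Suc.IH[OF that] by (simp add: sums_iff)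
    have "((\<lambda>z. \<Sum>m. ?c n m * z ^ m) has_field_derivative (\<Sum>m. diffs (?c n) m * q ^ m)) (at q)"
      by (rule termdiffs_strong'[OF sm Suc.prems])
    then have "(lipschitz_fun n has_field_derivative (\<Sum>m. diffs (?c n) m * q ^ m)) (at q)"
    proof (rule has_field_derivative_transform_within_open)
      show "open (ball 0 1 :: complex set)" "q \<in> ball 0 1" using Suc.prems by auto
      show "(\<Sum>m. ?c n m * z ^ m) = lipschitz_fun n z" if "z \<in> ball 0 1" for z
        using Suc.IH[of z] that by (simp add: sums_iff)
    qed
    with lipschitz_fun_deriv[OF q1 False]
    have e: "lipschitz_fun (Suc n) q / q = (\<Sum>m. diffs (?c n) m * q ^ m)" by (rule DERIV_unique)
    have "summable (\<lambda>m. diffs (?c n) m * q ^ m)"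
      by (rule termdiff_converges[OF Suc.prems sm])
    then have "(\<lambda>m. q * (diffs (?c n) m * q ^ m)) sums (q * (\<Sum>m. diffs (?c n) m * q ^ m))"
      by (intro sums_mult summable_sums)
    moreover have "q * (diffs (?c n) m * q ^ m) = ?c (Suc n) (Suc m) * q ^ Suc m" for m
      by (simp add: diffs_def)
    moreover have "q * (\<Sum>m. diffs (?c n) m * q ^ m) = lipschitz_fun (Suc n) q"
      using e False by (simp add: field_simps)
    ultimately have "(\<lambda>m. ?c (Suc n) (Suc m) * q ^ Suc m) sums lipschitz_fun (Suc n) q" by simp
    then have "(\<lambda>m. ?c (Suc n) m * q ^ m) sums (lipschitz_fun (Suc n) q + ?c (Suc n) 0 * q ^ 0)"
      by (rule sums_Suc)
    then show ?thesis by simp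
  qed
qed

section \<open>Linear systems over subfields of the complex numbers\<close>

text \<open>
  Closure of \<open>K\<close> under the operations of the type \<open>complex\<close>, with \<open>inverse 0 = 0\<close> included, makes
  membership a matter of applying introduction rules to the shape of a term.
\<close>

locale complex_subfield =
  fixes K :: "complex set"
  assumes one_mem: "1 \<in> K"
    and add_mem: "x \<in> K \<Longrightarrow> y \<in> K \<Longrightarrow> x + y \<in> K"
    and uminus_mem: "x \<in> K \<Longrightarrow> - x \<in> K"
    and mult_mem: "x \<in> K \<Longrightarrow> y \<in> K \<Longrightarrow> x * y \<in> K"
    and inverse_mem: "x \<in> K \<Longrightarrow> inverse x \<in> K"
begin

lemma zero_mem: "0 \<in> K"
  using add_mem[OF one_mem uminus_mem[OF one_mem]] by simp

lemma diff_mem: "x \<in> K \<Longrightarrow> y \<in> K \<Longrightarrow> x - y \<in> K"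
  using add_mem[OF _ uminus_mem, of x y] by simp

lemma divide_mem: "x \<in> K \<Longrightarrow> y \<in> K \<Longrightarrow> x / y \<in> K"
  using mult_mem[OF _ inverse_mem, of x y] by (simp add: divide_inverse)

lemma power_mem: "x \<in> K \<Longrightarrow> x ^ n \<in> K"
  by (induction n) (auto intro: one_mem mult_mem)

lemma sum_mem: "(\<And>i. i \<in> I \<Longrightarrow> f i \<in> K) \<Longrightarrow> sum f I \<in> K"
  by (induction I rule: infinite_finite_induct) (auto intro: zero_mem add_mem)

lemma of_nat_mem: "of_nat n \<in> K"
  by (induction n) (auto intro: zero_mem one_mem add_mem)

lemma of_int_mem: "of_int n \<in> K"
  by (cases n rule: int_cases2) (auto intro: of_nat_mem uminus_mem simp: of_int_of_nat_eq)

lemma numeral_mem: "numeral n \<in> K"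
  using of_nat_mem[of "numeral n"] by simp

lemmas mem_intros = zero_mem one_mem add_mem uminus_mem mult_mem inverse_mem diff_mem divide_mem
  power_mem sum_mem of_nat_mem of_int_mem numeral_mem

text \<open>
  Gaussian elimination: the solution \<open>x\<close> over \<open>\<complex>\<close> only guarantees that the system is consistent, and
  elimination stays inside \<open>K\<close>. The induction removes one unknown, either because it does not occur
  or by means of an equation in which it does.
\<close>

lemma linear_system_solvable:
  assumes "finite J"
    and "\<And>e j. e \<in> E \<Longrightarrow> j \<in> J \<Longrightarrow> a e j \<in> K" and "\<And>e. e \<in> E \<Longrightarrow> b e \<in> K"
    and "\<And>e. e \<in> E \<Longrightarrow> (\<Sum>j\<in>J. a e j * x j) = b e"
  shows "\<exists>y. (\<forall>j\<in>J. y j \<in> K) \<and> (\<forall>e\<in>E. (\<Sum>j\<in>J. a e j * y j) = b e)"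
  using assms
proof (induction J arbitrary: a b rule: finite_induct)
  case empty
  then show ?case by auto
next
  case (insert i J)
  show ?case
  proof (cases "\<forall>e\<in>E. a e i = 0")
    case True
    have "\<exists>y. (\<forall>j\<in>J. y j \<in> K) \<and> (\<forall>e\<in>E. (\<Sum>j\<in>J. a e j * y j) = b e)"
    proof (rule insert.IH)
      fix e assume e: "e \<in> E"
      show "(\<Sum>j\<in>J. a e j * x j) = b e"
        using insert.prems(3)[OF e] insert.hyps True e by simp
    qed (use insert.prems in auto)
    then obtain y where y: "\<And>j. j \<in> J \<Longrightarrow> y j \<in> K" "\<And>e. e \<in> E \<Longrightarrow> (\<Sum>j\<in>J. a e j * y j) = b e" by blast
    let ?y = "y(i := 0)"
    have "(\<Sum>j\<in>J. a e j * ?y j) = (\<Sum>j\<in>J. a e j * y j)" for e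
      by (rule sum.cong) (use insert.hyps in auto)
    then have "\<forall>e\<in>E. (\<Sum>j\<in>insert i J. a e j * ?y j) = b e"
      using insert.hyps y(2) by simp
    moreover have "\<forall>j\<in>insert i J. ?y j \<in> K" using y(1) zero_mem by auto
    ultimately show ?thesis by blast
  next
    case False
    then obtain e0 where e0: "e0 \<in> E" "a e0 i \<noteq> 0" by blast
    define r where "r e = a e i / a e0 i" for e
    have rK: "r e \<in> K" if "e \<in> E" for e
      using insert.prems(1) that e0 by (auto simp: r_def intro!: divide_mem)
    have "\<exists>y. (\<forall>j\<in>J. y j \<in> K) \<and> (\<forall>e\<in>E. (\<Sum>j\<in>J. (a e j - r e * a e0 j) * y j) = b e - r e * b e0)"
    proof (rule insert.IH)
      fix e assume e: "e \<in> E"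
      have 1: "a e i * x i + (\<Sum>j\<in>J. a e j * x j) = b e"
        using insert.prems(3)[OF e] insert.hyps by simp
      have 2: "a e0 i * x i + (\<Sum>j\<in>J. a e0 j * x j) = b e0"
        using insert.prems(3)[OF e0(1)] insert.hyps by simp
      have "(\<Sum>j\<in>J. (a e j - r e * a e0 j) * x j) = (\<Sum>j\<in>J. a e j * x j) - r e * (\<Sum>j\<in>J. a e0 j * x j)"
        by (simp add: algebra_simps sum_subtractf sum_distrib_left)
      also have "\<dots> = b e - r e * b e0"
        unfolding 1[symmetric] 2[symmetric] using e0 by (simp add: r_def algebra_simps)
      finally show "(\<Sum>j\<in>J. (a e j - r e * a e0 j) * x j) = b e - r e * b e0" .
    next
      fix e j assume "e \<in> E" "j \<in> J"
      then show "a e j - r e * a e0 j \<in> K" using insert.prems(1) e0 rK by (intro mem_intros) auto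
    next
      fix e assume "e \<in> E"
      then show "b e - r e * b e0 \<in> K" using insert.prems(2) e0 rK by (intro mem_intros) auto
    qed
    then obtain y where y: "\<And>j. j \<in> J \<Longrightarrow> y j \<in> K"
      "\<And>e. e \<in> E \<Longrightarrow> (\<Sum>j\<in>J. (a e j - r e * a e0 j) * y j) = b e - r e * b e0" by blast
    define t where "t = (b e0 - (\<Sum>j\<in>J. a e0 j * y j)) / a e0 i"
    let ?y = "y(i := t)"
    have tK: "t \<in> K" unfolding t_def using insert.prems e0 y(1) by (intro mem_intros) auto
    have c: "(\<Sum>j\<in>J. a e j * ?y j) = (\<Sum>j\<in>J. a e j * y j)" for e
      by (rule sum.cong) (use insert.hyps in auto)
    have "(\<Sum>j\<in>insert i J. a e j * ?y j) = b e" if e: "e \<in> E" for e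
    proof -
      have "(\<Sum>j\<in>J. a e j * y j) - r e * (\<Sum>j\<in>J. a e0 j * y j) = b e - r e * b e0"
        using y(2)[OF e] by (simp add: algebra_simps sum_subtractf sum_distrib_left)
      moreover have "a e i * t = r e * b e0 - r e * (\<Sum>j\<in>J. a e0 j * y j)"
        using e0 by (simp add: t_def r_def algebra_simps diff_divide_distrib)
      moreover have "(\<Sum>j\<in>insert i J. a e j * ?y j) = a e i * t + (\<Sum>j\<in>J. a e j * y j)"
        using insert.hyps c[of e] by simp
      ultimately show ?thesis by (simp only: diff_eq_eq) (simp only: algebra_simps)
    qed
    moreover have "\<forall>j\<in>insert i J. ?y j \<in> K" using y(1) tK by auto
    ultimately show ?thesis by blast
  qed
qed

end

lemma complex_subfield_of_subfield:
  assumes "subfield K complex_ring"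
  shows "complex_subfield K"
proof -
  note E = subfieldE[OF assms]
  have ops: "x \<otimes>\<^bsub>complex_ring\<^esub> y = x * y" "x \<oplus>\<^bsub>complex_ring\<^esub> y = x + y"
    "\<one>\<^bsub>complex_ring\<^esub> = 1" "\<zero>\<^bsub>complex_ring\<^esub> = 0" "carrier complex_ring = UNIV" for x y
    by (simp_all add: ring_of_type_algebra_def)
  interpret R: ring complex_ring by (rule ring_from_type_algebra)
  have um: "\<ominus>\<^bsub>complex_ring\<^esub> x = - x" for x :: complex
    using R.minus_equality[of "-x" x] by (simp add: ops)
  note S = subringE[OF subfieldE(1)[OF assms]]
  show ?thesis
  proof
    show "1 \<in> K" using S(3) by (simp add: ops)
    show "x + y \<in> K" if "x \<in> K" "y \<in> K" for x y using S(7)[OF that] by (simp add: ops)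
    show "x * y \<in> K" if "x \<in> K" "y \<in> K" for x y using S(6)[OF that] by (simp add: ops)
    show "- x \<in> K" if "x \<in> K" for x using S(5)[OF that] by (simp add: um)
    show "inverse x \<in> K" if x: "x \<in> K" for x
    proof (cases "x = 0")
      case True then show ?thesis using x by simp
    next
      case False
      then have "x \<in> Units (complex_ring\<lparr>carrier := K\<rparr>)"
        using subfield.subfield_Units[OF assms] x by (simp add: ops)
      then obtain y where "y \<in> K" "y * x = 1" by (auto simp: Units_def ops)
      then have "inverse x = y" using False by (simp add: field_simps)
      then show ?thesis using \<open>y \<in> K\<close> by simp
    qed
  qed
qed

lemma complex_subfield_cyclotomic: "complex_subfield (cyclotomic_field N)"
proof -
  interpret F: field complex_ring by (rule field_from_type_algebra)
  show ?thesis unfolding cyclotomic_field_def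
    by (intro complex_subfield_of_subfield F.generate_field_is_subfield) (simp add: ring_of_type_algebra_def)
qed

lemma root_of_unity_in_cyclotomic: "exp (2 * of_real pi * \<i> / of_nat N) \<in> cyclotomic_field N"
  unfolding cyclotomic_field_def by (rule generate_field.incl) simp

section \<open>Moebius inversion over residue classes\<close>

definition moebius_mu :: "nat \<Rightarrow> complex" where
  "moebius_mu n = (if squarefree n then (-1) ^ card (prime_factors n) else 0)"

lemma norm_moebius_mu_le: "norm (moebius_mu n) \<le> 1"
  by (simp add: moebius_mu_def norm_power)

lemma moebius_mu_1 [simp]: "moebius_mu (Suc 0) = 1"
  by (simp add: moebius_mu_def)

lemma moebius_mu_prime_mult:
  assumes p: "Factorial_Ring.prime p" and d: "d > 0"
  shows "moebius_mu (p * d) = (if p dvd d then 0 else - moebius_mu d)"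
proof (cases "p dvd d")
  case True
  then have "p ^ 2 dvd p * d" by (simp add: power2_eq_square)
  then have "\<not> squarefree (p * d)"
    using p unfolding squarefree_def by (metis not_prime_unit)
  then show ?thesis using True by (simp add: moebius_mu_def)
next
  case False
  then have pd: "coprime p d" using p by (simp add: prime_imp_coprime)
  have sf: "squarefree (p * d) \<longleftrightarrow> squarefree d"
    using squarefree_mult_coprime[OF pd squarefree_prime[OF p]] squarefree_multD(2)[of p d] by blast
  have "prime_factors (p * d) = insert p (prime_factors d)"
    using p d by (simp add: prime_factors_product prime_prime_factors)
  moreover have "p \<notin> prime_factors d" using False by auto
  ultimately have "card (prime_factors (p * d)) = Suc (card (prime_factors d))" by simp
  then show ?thesis using False sf by (simp add: moebius_mu_def)
qed

text \<open>
  For a prime \<open>p\<close> dividing \<open>n\<close> the divisors \<open>d\<close> and \<open>p d\<close> with \<open>d\<close> prime to \<open>p\<close> cancel in pairs,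
  and the divisors divisible by \<open>p\<^sup>2\<close> contribute nothing.
\<close>

lemma sum_moebius_mu_divisors:
  assumes n: "n > 0"
  shows "(\<Sum>d | d dvd n. moebius_mu d) = (if n = 1 then 1 else 0)"
proof (cases "n = 1")
  case False
  then obtain p where p: "Factorial_Ring.prime p" "p dvd n" using prime_factor_nat by blast
  let ?A = "{d. d dvd n \<and> \<not> p dvd d}"
  have fin: "finite {d. d dvd n}" using n by simp
  have eq: "{d. d dvd n \<and> p dvd d} = (\<lambda>d. p * d) ` {d. p * d dvd n}"
    by (auto elim!: dvdE)
  have fin2: "finite {d. p * d dvd n}"
    by (rule finite_subset[OF _ fin]) (auto intro: dvd_mult_right)
  have "(\<Sum>d | d dvd n \<and> p dvd d. moebius_mu d) = (\<Sum>d | p * d dvd n. moebius_mu (p * d))"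
    unfolding eq by (subst sum.reindex) (use p in \<open>auto simp: inj_on_def prime_gt_0_nat\<close>)
  also have "\<dots> = (\<Sum>d | p * d dvd n \<and> \<not> p dvd d. - moebius_mu d)"
  proof (rule sum.mono_neutral_cong_right[OF fin2])
    show "\<forall>i\<in>{d. p * d dvd n} - {d. p * d dvd n \<and> \<not> p dvd d}. moebius_mu (p * i) = 0"
      using moebius_mu_prime_mult[OF p(1)] n by (auto intro: Nat.gr0I)
    show "moebius_mu (p * x) = - moebius_mu x" if "x \<in> {d. p * d dvd n \<and> \<not> p dvd d}" for x
      using moebius_mu_prime_mult[OF p(1), of x] that n by (cases "x = 0") auto
  qed auto
  also have "{d. p * d dvd n \<and> \<not> p dvd d} = ?A"
  proof -
    have "p * d dvd n \<longleftrightarrow> d dvd n" if "\<not> p dvd d" for d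
      using divides_mult[of p n d] p that by (auto simp: prime_imp_coprime intro: dvd_mult_right)
    then show ?thesis by auto
  qed
  finally have 1: "(\<Sum>d | d dvd n \<and> p dvd d. moebius_mu d) = - (\<Sum>d\<in>?A. moebius_mu d)" by (simp add: sum_negf)
  have "{d. d dvd n} = ?A \<union> {d. d dvd n \<and> p dvd d}" by auto
  moreover have "finite ?A" "finite {d. d dvd n \<and> p dvd d}"
    by (rule finite_subset[OF _ fin], blast)+
  then have "sum moebius_mu (?A \<union> {d. d dvd n \<and> p dvd d}) = (\<Sum>d\<in>?A. moebius_mu d) + (\<Sum>d | d dvd n \<and> p dvd d. moebius_mu d)"
    by (rule sum.union_disjoint) blast
  ultimately have "(\<Sum>d | d dvd n. moebius_mu d) = (\<Sum>d\<in>?A. moebius_mu d) + (\<Sum>d | d dvd n \<and> p dvd d. moebius_mu d)"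
    by (simp only:)
  then show ?thesis unfolding 1 using False by simp
qed (auto simp: n)

definition unit_residues :: "nat \<Rightarrow> int set" where
  "unit_residues N = {r \<in> {0..<int N}. coprime r (int N)}"

definition inv_mod :: "nat \<Rightarrow> int \<Rightarrow> int" where
  "inv_mod N r = (SOME t. [r * t = 1] (mod int N))"

lemma inv_mod: "coprime r (int N) \<Longrightarrow> [r * inv_mod N r = 1] (mod int N)"
  unfolding inv_mod_def by (rule someI_ex) (rule cong_solve_coprime_int)

definition scale_pair :: "int \<Rightarrow> int \<times> int \<Rightarrow> int \<times> int" where
  "scale_pair t l = (t * fst l, t * snd l)"

definition moebius_series :: "nat \<Rightarrow> int \<Rightarrow> complex \<Rightarrow> complex" where
  "moebius_series N r w = (\<Sum>\<^sub>\<infinity>n | n \<ge> 1 \<and> [int n = r] (mod int N). moebius_mu n * of_nat n powr (- w))"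

lemma norm_summable_prod:
  fixes f :: "'a \<Rightarrow> complex" and g :: "'b \<Rightarrow> complex"
  assumes f: "(\<lambda>x. norm (f x)) summable_on A" and g: "(\<lambda>y. norm (g y)) summable_on B"
  shows "((\<lambda>(x, y). f x * g y) has_sum (infsum f A * infsum g B)) (A \<times> B)"
proof -
  have "(\<lambda>p. norm (case p of (x, y) \<Rightarrow> f x * g y)) summable_on (A \<times> B)"
    using summable_on_product_nonneg[OF f _ g] by (simp add: case_prod_unfold norm_mult)
  then have s: "(\<lambda>(x, y). f x * g y) summable_on (A \<times> B)" by (rule abs_summable_summable)
  have "infsum (\<lambda>(x, y). f x * g y) (A \<times> B) = (\<Sum>\<^sub>\<infinity>x\<in>A. \<Sum>\<^sub>\<infinity>y\<in>B. f x * g y)"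
    by (rule infsum_Sigma'_banach[OF s, symmetric])
  also have "\<dots> = (\<Sum>\<^sub>\<infinity>x\<in>A. f x * infsum g B)"
    by (simp only: infsum_cmult_right')
  also have "\<dots> = infsum f A * infsum g B" by (rule infsum_cmult_left')
  finally show ?thesis using has_sum_infsum[OF s] by simp
qed

lemma norm_nat_powr: "n \<ge> 1 \<Longrightarrow> norm (complex_of_nat n powr (- w)) = real n powr (- Re w)"
  using norm_powr_real_powr[of "complex_of_nat n" "- w"] by simp

lemma moebius_terms_summable:
  assumes "Re w > 1"
  shows "(\<lambda>n. norm (moebius_mu n * of_nat n powr (- w))) summable_on {n. n \<ge> 1 \<and> P n}"
proof (rule summable_on_comparison_test)
  have "(\<lambda>n::nat. real n powr (- Re w)) summable_on UNIV"
    using assms by (subst summable_on_UNIV_nonneg_real_iff) (auto simp: summable_real_powr_iff)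
  then show "(\<lambda>n::nat. real n powr (- Re w)) summable_on {n. n \<ge> 1 \<and> P n}"
    by (rule summable_on_subset_banach) simp
  fix n :: nat assume n: "n \<in> {n. n \<ge> 1 \<and> P n}"
  have "norm (moebius_mu n * of_nat n powr (- w)) = norm (moebius_mu n) * real n powr (- Re w)"
    using n by (simp add: norm_mult norm_nat_powr)
  also have "\<dots> \<le> 1 * real n powr (- Re w)" by (intro mult_right_mono norm_moebius_mu_le) simp
  finally show "norm (moebius_mu n * of_nat n powr (- w)) \<le> real n powr (- Re w)" by simp
qed simp

text \<open>
  The sum of \<open>\<mu>(n)\<close> over the common divisors \<open>n\<close> of \<open>c\<close> and \<open>d\<close> detects coprime pairs. Exchanging the
  sums and writing the pairs divisible by \<open>n\<close> as \<open>n p\<close>, with \<open>p \<equiv> n\<^sup>-\<^sup>1 l\<close>, gives the right-hand side,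
  once the \<open>n\<close> are collected by their residues. The function \<open>u\<close> is kept general, because besides the
  Eisenstein series it will be the function \<open>d\<^sup>-\<^sup>k\<close> supported on the line \<open>c = 0\<close>.
\<close>

lemma moebius_inversion_lattice:
  fixes u :: "int \<times> int \<Rightarrow> complex" and w :: complex and l :: "int \<times> int"
  assumes N: "N \<ge> 1" and l: "gcd (gcd (fst l) (snd l)) (int N) = 1" and w: "Re w > 1"
    and hom: "\<And>n p. n \<ge> 1 \<Longrightarrow> u (scale_pair (int n) p) = of_nat n powr (- w) * u p"
    and sm: "(\<lambda>p. norm (u p)) summable_on UNIV" and u0: "u (0, 0) = 0"
  shows "(\<Sum>\<^sub>\<infinity>p\<in>{p \<in> res_class N l. gcd (fst p) (snd p) = 1}. u p) =
    (\<Sum>r\<in>unit_residues N. moebius_series N r w * (\<Sum>\<^sub>\<infinity>p\<in>res_class N (scale_pair (inv_mod N r) l). u p))"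
proof -
  define A where "A r = {n::nat. n \<ge> 1 \<and> [int n = r] (mod int N)}" for r
  define C where "C r = res_class N (scale_pair (inv_mod N r) l) - {(0, 0)}" for r
  define D where "D v = {n::nat. n \<ge> 1 \<and> int n dvd fst v \<and> int n dvd snd v}" for v :: "int \<times> int"
  define V where "V = res_class N l - {(0, 0)}"
  define B where "B r = {(v, n). v \<in> V \<and> n \<in> D v \<and> [int n = r] (mod int N)}" for r
  define h where "h = (\<lambda>(v, n). moebius_mu n * u v)"
  let ?G = "\<lambda>r. \<Sum>\<^sub>\<infinity>p\<in>res_class N (scale_pair (inv_mod N r) l). u p"
  have G: "infsum u (C r) = ?G r" for r
    unfolding C_def by (rule infsum_cong_neutral) (auto simp: u0)
  have step: "(h has_sum (moebius_series N r w * ?G r)) (B r)" if r: "r \<in> unit_residues N" for r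
  proof -
    have inv: "[r * inv_mod N r = 1] (mod int N)" using r by (intro inv_mod) (simp add: unit_residues_def)
    have "((\<lambda>(n, v). (moebius_mu n * of_nat n powr (- w)) * u v) has_sum (moebius_series N r w * infsum u (C r))) (A r \<times> C r)"
      unfolding moebius_series_def A_def
      by (rule norm_summable_prod[OF moebius_terms_summable[OF w] summable_on_subset_banach[OF sm]]) simp
    also have "((\<lambda>(n, v). (moebius_mu n * of_nat n powr (- w)) * u v) has_sum (moebius_series N r w * infsum u (C r))) (A r \<times> C r)
       \<longleftrightarrow> (h has_sum (moebius_series N r w * infsum u (C r))) (B r)"
    proof (rule has_sum_reindex_bij_witness[where j = "\<lambda>(n, v). (scale_pair (int n) v, n)"
            and i = "\<lambda>(v, n). (n, (fst v div int n, snd v div int n))"])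
      fix x assume x: "x \<in> A r \<times> C r"
      obtain n v where nv: "x = (n, v)" by (cases x) blast
      have n: "n \<ge> 1" "[int n = r] (mod int N)" using x nv by (auto simp: A_def)
      have v: "[fst v = inv_mod N r * fst l] (mod int N)" "[snd v = inv_mod N r * snd l] (mod int N)" "v \<noteq> (0, 0)"
        using x nv by (auto simp: C_def res_class_def scale_pair_def)
      have *: "[int n * a = b] (mod int N)" if "[a = inv_mod N r * b] (mod int N)" for a b
      proof -
        have "[int n * a = r * (inv_mod N r * b)] (mod int N)" by (rule cong_mult[OF n(2) that])
        moreover have "[(r * inv_mod N r) * b = 1 * b] (mod int N)" by (rule cong_mult[OF inv cong_refl])
        ultimately show ?thesis by (simp add: mult.assoc) (metis cong_trans)
      qed
      show "(case (case x of (n, v) \<Rightarrow> (scale_pair (int n) v, n)) of (v, n) \<Rightarrow> (n, fst v div int n, snd v div int n)) = x"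
        using n nv by (simp add: scale_pair_def)
      show "(case x of (n, v) \<Rightarrow> (scale_pair (int n) v, n)) \<in> B r"
      proof -
        have "fst v \<noteq> 0 \<or> snd v \<noteq> 0" using v(3) by (simp add: prod_eq_iff)
        then have "int n * fst v \<noteq> 0 \<or> int n * snd v \<noteq> 0" using n(1) by simp
        then show ?thesis
          using n *[OF v(1)] *[OF v(2)] unfolding nv prod.case
          by (simp add: B_def V_def D_def scale_pair_def res_class_def)
      qed
      show "h (case x of (n, v) \<Rightarrow> (scale_pair (int n) v, n)) = (case x of (n, v) \<Rightarrow> (moebius_mu n * of_nat n powr (- w)) * u v)"
        using n nv by (simp add: h_def hom)
    next
      fix x assume x: "x \<in> B r"
      obtain v n where nv: "x = (v, n)" by (cases x) blast
      have n: "n \<ge> 1" "[int n = r] (mod int N)" and d: "int n dvd fst v" "int n dvd snd v"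
        and v: "[fst v = fst l] (mod int N)" "[snd v = snd l] (mod int N)" "v \<noteq> (0, 0)"
        using x nv by (auto simp: B_def V_def D_def res_class_def)
      have *: "[a div int n = inv_mod N r * b] (mod int N)" if "[a = b] (mod int N)" "int n dvd a" for a b
      proof -
        have "[int n * inv_mod N r = 1] (mod int N)"
          using cong_mult[OF n(2) cong_refl, of "inv_mod N r"] inv by (metis cong_trans)
        then have "[(int n * inv_mod N r) * (a div int n) = 1 * (a div int n)] (mod int N)"
          by (rule cong_mult[OF _ cong_refl])
        moreover have "(int n * inv_mod N r) * (a div int n) = inv_mod N r * a" using that(2) by auto
        moreover have "[inv_mod N r * a = inv_mod N r * b] (mod int N)" by (rule cong_mult[OF cong_refl that(1)])
        ultimately show ?thesis by (metis cong_sym cong_trans mult_1)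
      qed
      have nz: "(fst v div int n, snd v div int n) \<noteq> (0, 0)"
        using v(3) d by (auto simp: prod_eq_iff dvd_div_eq_0_iff)
      show "(case (case x of (v, n) \<Rightarrow> (n, fst v div int n, snd v div int n)) of (n, v) \<Rightarrow> (scale_pair (int n) v, n)) = x"
        using d nv by (simp add: scale_pair_def)
      show "(case x of (v, n) \<Rightarrow> (n, fst v div int n, snd v div int n)) \<in> A r \<times> C r"
        using n nz *[OF v(1) d(1)] *[OF v(2) d(2)] unfolding nv prod.case
        by (simp add: A_def C_def res_class_def scale_pair_def)
    qed (rule refl)
    finally show ?thesis unfolding G .
  qed
  have fU: "finite (unit_residues N)"
    by (rule finite_subset[of _ "{0..<int N}"]) (auto simp: unit_residues_def)
  have "(h has_sum (\<Sum>r\<in>unit_residues N. moebius_series N r w * ?G r)) (\<Union>r\<in>unit_residues N. B r)"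
  proof (rule sum_has_sum[OF fU step])
    fix r r' assume rr: "r \<in> unit_residues N" "r' \<in> unit_residues N" "r \<noteq> r'"
    have "\<not> [r = r'] (mod int N)" using rr by (auto simp: unit_residues_def cong_def)
    moreover have "[r = r'] (mod int N)" if "x \<in> B r" "x \<in> B r'" for x
    proof -
      from that have "[int (snd x) = r] (mod int N)" "[int (snd x) = r'] (mod int N)" by (auto simp: B_def)
      then show ?thesis by (metis cong_sym cong_trans)
    qed
    ultimately show "B r \<inter> B r' = {}" by blast
  qed
  also have "(\<Union>r\<in>unit_residues N. B r) = Sigma V D"
  proof
    show "(\<Union>r\<in>unit_residues N. B r) \<subseteq> Sigma V D" by (auto simp: B_def)
    show "Sigma V D \<subseteq> (\<Union>r\<in>unit_residues N. B r)"
    proof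
      fix x assume "x \<in> Sigma V D"
      then obtain v n where x: "x = (v, n)" "v \<in> V" "n \<in> D v" by blast
      \<comment> \<open>A common divisor \<open>n\<close> of a pair congruent to \<open>l\<close> is a unit modulo \<open>N\<close>, as \<open>l\<close> is primitive.\<close>
      define g where "g = gcd (int n) (int N)"
      have g: "g dvd fst v" "g dvd snd v" "g dvd int N"
        using x by (auto simp: D_def g_def intro: dvd_trans[of _ "int n"])
      have "g dvd b" if "[a = b] (mod int N)" "g dvd a" for a b
        using that g(3) by (metis cong_dvd_iff cong_dvd_modulus)
      then have "g dvd fst l" "g dvd snd l"
        using x g(1,2) by (auto simp: V_def res_class_def)
      then have "g dvd 1" using g(3) l by (metis gcd_greatest)
      then have "coprime (int n) (int N)" using g_def by (simp add: coprime_iff_gcd_eq_1)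
      then have "int n mod int N \<in> unit_residues N" using N by (simp add: unit_residues_def)
      moreover have "x \<in> B (int n mod int N)" using x by (simp add: B_def)
      ultimately show "x \<in> (\<Union>r\<in>unit_residues N. B r)" by blast
    qed
  qed
  finally have S: "(h has_sum (\<Sum>r\<in>unit_residues N. moebius_series N r w * ?G r)) (Sigma V D)" .
  have "((\<lambda>v. if gcd (fst v) (snd v) = 1 then u v else 0) has_sum (\<Sum>r\<in>unit_residues N. moebius_series N r w * ?G r)) V"
  proof (rule has_sum_SigmaD[OF S])
    fix v assume v: "v \<in> V"
    define g where "g = nat (gcd (fst v) (snd v))"
    have g0: "g > 0" using v by (auto simp: g_def V_def prod_eq_iff)
    have gi: "int g = gcd (fst v) (snd v)" by (simp add: g_def)
    have D: "D v = {n. n dvd g}"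
    proof -
      have "int n dvd fst v \<and> int n dvd snd v \<longleftrightarrow> n dvd g" for n
        by (metis gcd_greatest_iff gi int_dvd_int_iff)
      then show ?thesis using g0 by (auto simp: D_def Suc_le_eq intro: Nat.gr0I)
    qed
    have "(\<Sum>n\<in>D v. h (v, n)) = (\<Sum>n | n dvd g. moebius_mu n) * u v"
      by (simp add: h_def D sum_distrib_right)
    also have "\<dots> = (if gcd (fst v) (snd v) = 1 then u v else 0)"
      unfolding sum_moebius_mu_divisors[OF g0] using gi by auto
    finally show "((\<lambda>n. h (v, n)) has_sum (if gcd (fst v) (snd v) = 1 then u v else 0)) (D v)"
      using g0 D by (intro has_sum_finiteI) auto
  qed
  also have "((\<lambda>v. if gcd (fst v) (snd v) = 1 then u v else 0) has_sum (\<Sum>r\<in>unit_residues N. moebius_series N r w * ?G r)) V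
     \<longleftrightarrow> (u has_sum (\<Sum>r\<in>unit_residues N. moebius_series N r w * ?G r)) {p \<in> res_class N l. gcd (fst p) (snd p) = 1}"
    by (rule has_sum_cong_neutral) (auto simp: V_def)
  finally show ?thesis by (rule infsumI)
qed

section \<open>Continuation of the Eisenstein series\<close>

lemma hom_term_scale:
  assumes n: "n \<ge> 1"
  shows "hom_term k 0 s (of_nat n * z) = of_nat n powr (- (of_nat k + 2 * s)) * hom_term k 0 s z"
proof (cases "z = 0")
  case True
  then show ?thesis by (cases "k = 0") (simp_all add: hom_term_def)
next
  case False
  have nz: "of_nat n * z \<noteq> 0" using n False by simp
  have l: "ln (cmod (of_nat n * z)) = ln (real n) + ln (cmod z)"
    using n False by (simp add: norm_mult ln_mult)
  have pw: "complex_of_nat n powr (- (of_nat k + 2 * s)) =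
      exp (- 2 * s * of_real (ln (real n))) / of_nat n ^ k"
  proof -
    have L: "Ln (complex_of_nat n) = of_real (ln (real n))"
      using n by (metis Ln_of_real of_nat_0_less_iff of_real_of_nat_eq less_le_trans zero_less_one)
    have e: "exp (of_real (ln (real n))) = complex_of_nat n"
      using n by (metis exp_of_real exp_ln of_nat_0_less_iff of_real_of_nat_eq less_le_trans zero_less_one)
    have "complex_of_nat n powr (- (of_nat k + 2 * s)) = exp (- 2 * s * of_real (ln (real n)) + of_nat k * - of_real (ln (real n)))"
      using n L by (simp add: powr_def algebra_simps)
    also have "\<dots> = exp (- 2 * s * of_real (ln (real n))) * exp (- of_real (ln (real n))) ^ k"
      by (simp only: exp_add exp_of_nat_mult)
    also have "exp (- of_real (ln (real n))) = inverse (complex_of_nat n)" by (simp add: exp_minus e)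
    finally show ?thesis by (simp add: divide_inverse power_inverse)
  qed
  show ?thesis
    unfolding hom_term_exp[OF nz] hom_term_exp[OF False] pw l
    by (simp add: exp_add[symmetric] algebra_simps power_mult_distrib)
qed

lemma lattice_point_scale: "lattice_point \<tau> (scale_pair n p) = of_int n * lattice_point \<tau> p"
  by (simp add: lattice_point_def scale_pair_def algebra_simps)

lemma moebius_series_holomorphic:
  "(\<lambda>s. moebius_series N r (of_nat k + 2 * s)) holomorphic_on half_plane k 1"
  unfolding moebius_series_def
proof (rule holomorphic_infsum(1)[OF half_plane_open])
  let ?I = "{n::nat. n \<ge> 1 \<and> [int n = r] (mod int N)}"
  show "(\<lambda>s. moebius_mu n * of_nat n powr (- (of_nat k + 2 * s))) holomorphic_on half_plane k 1" if "n \<in> ?I" for n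
    using that by (intro holomorphic_intros) auto
  fix s0 assume s0: "s0 \<in> half_plane k 1"
  obtain \<rho> where \<rho>: "\<rho> > 0" "cball s0 \<rho> \<subseteq> half_plane k 1"
    "\<And>s. s \<in> cball s0 \<rho> \<Longrightarrow> Re (of_nat k + 2 * s) \<ge> (Re (of_nat k + 2 * s0) + 1) / 2"
    using half_plane_cball[OF s0] by metis
  define x where "x = (Re (of_nat k + 2 * s0) + 1) / 2"
  have x: "x > 1" using s0 by (simp add: x_def)
  have "(\<lambda>n::nat. real n powr (- x)) summable_on UNIV"
    using x by (subst summable_on_UNIV_nonneg_real_iff) (auto simp: summable_real_powr_iff)
  then have sm: "(\<lambda>n::nat. real n powr (- x)) summable_on ?I"
    by (rule summable_on_subset_banach) simp
  have "norm (moebius_mu n * of_nat n powr (- (of_nat k + 2 * s))) \<le> real n powr (- x)"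
    if n: "n \<in> ?I - {}" and s: "s \<in> cball s0 \<rho>" for n s
  proof -
    have n1: "n \<ge> 1" using n by simp
    have "norm (moebius_mu n * of_nat n powr (- (of_nat k + 2 * s))) = norm (moebius_mu n) * real n powr (- Re (of_nat k + 2 * s))"
      by (simp only: norm_mult norm_nat_powr[OF n1])
    also have "\<dots> \<le> 1 * real n powr (- x)"
      using \<rho>(3)[OF s] n1 by (intro mult_mono norm_moebius_mu_le powr_mono) (auto simp: x_def field_simps)
    finally show ?thesis by simp
  qed
  then show "\<exists>r>0. \<exists>F M. cball s0 r \<subseteq> half_plane k 1 \<and> finite F \<and> M summable_on ?I \<and>
         (\<forall>n\<in>?I - F. \<forall>s\<in>cball s0 r. norm (moebius_mu n * of_nat n powr (- (of_nat k + 2 * s))) \<le> M n)"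
    using \<rho>(1,2) sm
    by (intro exI[of _ \<rho>] conjI exI[of _ "{}"] exI[of _ "\<lambda>n. real n powr (- x)"]) auto
qed

text \<open>
  The regularized sums and the Moebius inversion are available for \<open>Re (k + 2 s) > 3\<close> first, while the
  series are given on \<open>Re (k + 2 s) > 2\<close>; the identity theorem closes the gap.
\<close>

lemma half_plane_identity:
  assumes "f holomorphic_on half_plane k 2" "g holomorphic_on half_plane k 2"
    and "\<And>s. s \<in> half_plane k 3 \<Longrightarrow> f s = g s" and "s \<in> half_plane k 2"
  shows "f s = g s"
proof (rule analytic_continuation_open[of "half_plane k 3" "half_plane k 2" f g])
  have "2 \<in> half_plane k 3" by simp
  then show "half_plane k 3 \<noteq> {}" by blast
  show "half_plane k 3 \<subseteq> half_plane k 2" by auto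
qed (rule half_plane_open half_plane_connected assms | assumption)+

lemma reg_term_series_eq_hom_term_series:
  assumes \<tau>: "Im \<tau> > 0" and k: "k \<ge> 2" and N: "N \<ge> 1" and s: "s \<in> half_plane k 2"
  shows "(\<Sum>\<^sub>\<infinity>p\<in>res_class N l. reg_term k N \<tau> s (lattice_point \<tau> p)) =
         (\<Sum>\<^sub>\<infinity>p\<in>res_class N l. hom_term k 0 s (lattice_point \<tau> p))"
proof (rule half_plane_identity[OF _ _ _ s])
  have "half_plane k 2 \<subseteq> half_plane k 1" by auto
  then show "(\<lambda>s. \<Sum>\<^sub>\<infinity>p\<in>res_class N l. reg_term k N \<tau> s (lattice_point \<tau> p)) holomorphic_on half_plane k 2"
    by (rule holomorphic_on_subset[OF reg_term_series(1)[OF \<tau> k N]])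
  show "(\<lambda>s. \<Sum>\<^sub>\<infinity>p\<in>res_class N l. hom_term k 0 s (lattice_point \<tau> p)) holomorphic_on half_plane k 2"
    using hom_term_series_holomorphic[OF \<tau>, of k] k by simp
  fix s assume "s \<in> half_plane k 3"
  then have "Re (of_nat k + 2 * s) > 3" by simp
  then show "(\<Sum>\<^sub>\<infinity>p\<in>res_class N l. reg_term k N \<tau> s (lattice_point \<tau> p)) =
         (\<Sum>\<^sub>\<infinity>p\<in>res_class N l. hom_term k 0 s (lattice_point \<tau> p))"
    by (rule reg_term_series_eq[OF \<tau> k N])
qed

text \<open>
  The elements of additive order \<open>N\<close> in \<open>(\<int>/N\<int>)\<^sup>2\<close>, as a condition on arbitrary lifts; it is also the
  condition for the residue class to contain coprime pairs.
\<close>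

definition primitive_mod :: "nat \<Rightarrow> int \<times> int \<Rightarrow> bool" where
  "primitive_mod N l \<longleftrightarrow> gcd (gcd (fst l) (snd l)) (int N) = 1"

text \<open>
  The Eisenstein series after Moebius inversion, with regularized sums over residue classes.
\<close>

definition Eis_cont :: "nat \<Rightarrow> nat \<Rightarrow> int \<times> int \<Rightarrow> complex \<Rightarrow> complex \<Rightarrow> complex" where
  "Eis_cont k N l \<tau> s = eps_level N * (of_real (Im \<tau>) powr s *
     (\<Sum>r\<in>unit_residues N. moebius_series N r (of_nat k + 2 * s) *
        (\<Sum>\<^sub>\<infinity>p\<in>res_class N (scale_pair (inv_mod N r) l). reg_term k N \<tau> s (lattice_point \<tau> p))))"

lemma Eis_series_eq:
  "Eis_series k N l \<tau> s = eps_level N * (of_real (Im \<tau>) powr s *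
     (\<Sum>\<^sub>\<infinity>p\<in>{p \<in> res_class N l. gcd (fst p) (snd p) = 1}. hom_term k 0 s (lattice_point \<tau> p)))"
proof -
  have S: "{(c, d). [c = fst l] (mod int N) \<and> [d = snd l] (mod int N) \<and> gcd c d = 1} =
      {p \<in> res_class N l. gcd (fst p) (snd p) = 1}"
    by (auto simp: res_class_def)
  show ?thesis unfolding Eis_series_def S
    by (simp add: infsum_cmult_right'[symmetric] hom_term_def lattice_point_def case_prod_unfold)
qed

lemma Eis_cont_holomorphic:
  assumes \<tau>: "Im \<tau> > 0" and k: "k \<ge> 2" and N: "N \<ge> 1"
  shows "Eis_cont k N l \<tau> holomorphic_on half_plane k 1"
proof -
  have "Im \<tau> \<noteq> 0" using \<tau> by simp
  then show ?thesis unfolding Eis_cont_def[abs_def]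
    by (intro holomorphic_intros moebius_series_holomorphic reg_term_series(1)[OF \<tau> k N])
qed

lemma Eis_series_eq_cont:
  assumes \<tau>: "Im \<tau> > 0" and k: "k \<ge> 2" and N: "N \<ge> 1" and l: "primitive_mod N l" and s: "s \<in> half_plane k 2"
  shows "Eis_series k N l \<tau> s = Eis_cont k N l \<tau> s"
proof (rule half_plane_identity[OF _ _ _ s])
  have "Im \<tau> \<noteq> 0" using \<tau> by simp
  then show "Eis_series k N l \<tau> holomorphic_on half_plane k 2"
    unfolding Eis_series_eq[abs_def] using k
    by (intro holomorphic_intros hom_term_series_holomorphic[OF \<tau>]) auto
  have "half_plane k 2 \<subseteq> half_plane k 1" by auto
  then show "Eis_cont k N l \<tau> holomorphic_on half_plane k 2"
    by (rule holomorphic_on_subset[OF Eis_cont_holomorphic[OF \<tau> k N]])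
  fix s assume "s \<in> half_plane k 3"
  then have s: "Re (of_nat k + 2 * s) > 3" by simp
  let ?u = "\<lambda>p. hom_term k 0 s (lattice_point \<tau> p)"
  have "(\<Sum>\<^sub>\<infinity>p\<in>{p \<in> res_class N l. gcd (fst p) (snd p) = 1}. ?u p) =
    (\<Sum>r\<in>unit_residues N. moebius_series N r (of_nat k + 2 * s) * (\<Sum>\<^sub>\<infinity>p\<in>res_class N (scale_pair (inv_mod N r) l). ?u p))"
  proof (rule moebius_inversion_lattice[OF N])
    show "gcd (gcd (fst l) (snd l)) (int N) = 1" using l by (simp add: primitive_mod_def)
    show "Re (of_nat k + 2 * s) > 1" using s by simp
    show "?u (scale_pair (int n) p) = of_nat n powr (- (of_nat k + 2 * s)) * ?u p" if "n \<ge> 1" for n p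
      unfolding lattice_point_scale using hom_term_scale[OF that] by simp
    show "(\<lambda>p. norm (?u p)) summable_on UNIV"
      by (rule hom_term_summable[OF \<tau>]) (use s k in auto)
    show "?u (0, 0) = 0" using k by (simp add: lattice_point_def hom_term_0)
  qed
  also have "\<dots> = (\<Sum>r\<in>unit_residues N. moebius_series N r (of_nat k + 2 * s) *
      (\<Sum>\<^sub>\<infinity>p\<in>res_class N (scale_pair (inv_mod N r) l). reg_term k N \<tau> s (lattice_point \<tau> p)))"
    unfolding reg_term_series_eq[OF \<tau> k N s] ..
  finally show "Eis_series k N l \<tau> s = Eis_cont k N l \<tau> s"
    unfolding Eis_series_eq Eis_cont_def by simp
qed

text \<open>
  Uniqueness of continuation, by the identity theorem on a half plane.
\<close>

lemma continued_value_eqI: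
  assumes k: "k \<ge> 2" and g: "g holomorphic_on half_plane k 1"
    and eq: "\<And>s. s \<in> half_plane k 2 \<Longrightarrow> g s = F s"
  shows "continued_value k F = g 0"
  unfolding continued_value_def
proof (rule the_equality)
  show "\<exists>h. h holomorphic_on half_plane k 1 \<and>
         (\<forall>s. Re (of_nat k + 2 * s) > 2 \<longrightarrow> h s = F s) \<and> g 0 = h 0"
    using g eq by (intro exI[of _ g]) auto
  fix v assume "\<exists>h. h holomorphic_on half_plane k 1 \<and>
         (\<forall>s. Re (of_nat k + 2 * s) > 2 \<longrightarrow> h s = F s) \<and> v = h 0"
  then obtain h where h: "h holomorphic_on half_plane k 1"
    "\<And>s. Re (of_nat k + 2 * s) > 2 \<Longrightarrow> h s = F s" "v = h 0" by blast
  have "h 0 = g 0"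
  proof (rule analytic_continuation_open[of "half_plane k 2" "half_plane k 1" h g])
    have "2 \<in> half_plane k 2" by simp
    then show "half_plane k 2 \<noteq> {}" by blast
    show "0 \<in> half_plane k 1" using k by simp
    show "half_plane k 2 \<subseteq> half_plane k 1" by auto
    show "h s = g s" if "s \<in> half_plane k 2" for s using h(2)[of s] eq[OF that] that by simp
  qed (rule half_plane_open half_plane_connected g h)+
  then show "v = g 0" using h by simp
qed

definition G_value :: "nat \<Rightarrow> nat \<Rightarrow> int \<times> int \<Rightarrow> complex \<Rightarrow> complex" where
  "G_value k N l \<tau> = (\<Sum>\<^sub>\<infinity>p\<in>res_class N l. reg_term k N \<tau> 0 (lattice_point \<tau> p))"

lemma Eis_eq_cont:
  assumes \<tau>: "Im \<tau> > 0" and k: "k \<ge> 2" and N: "N \<ge> 1" and l: "primitive_mod N l"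
  shows "Eis k N l \<tau> = Eis_cont k N l \<tau> 0"
  unfolding Eis_def
  by (rule continued_value_eqI[OF k Eis_cont_holomorphic[OF \<tau> k N]]) (simp add: Eis_series_eq_cont[OF \<tau> k N l])

lemma continued_value_Eis_combination:
  assumes \<tau>: "Im \<tau> > 0" and k: "k \<ge> 2" and N: "N \<ge> 1" and l: "\<And>l. l \<in> L \<Longrightarrow> primitive_mod N l"
    and F: "\<And>s. s \<in> half_plane k 2 \<Longrightarrow> F s = (\<Sum>l\<in>L. c l * Eis_series k N l \<tau> s)"
  shows "continued_value k F = (\<Sum>l\<in>L. c l * Eis k N l \<tau>)"
proof -
  have "continued_value k F = (\<Sum>l\<in>L. c l * Eis_cont k N l \<tau> 0)"
  proof (rule continued_value_eqI[OF k])
    show "(\<lambda>s. \<Sum>l\<in>L. c l * Eis_cont k N l \<tau> s) holomorphic_on half_plane k 1"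
      by (intro holomorphic_intros Eis_cont_holomorphic[OF \<tau> k N])
    show "(\<Sum>l\<in>L. c l * Eis_cont k N l \<tau> s) = F s" if "s \<in> half_plane k 2" for s
      unfolding F[OF that] using l by (intro sum.cong refl) (simp add: Eis_series_eq_cont[OF \<tau> k N _ that])
  qed
  also have "\<dots> = (\<Sum>l\<in>L. c l * Eis k N l \<tau>)"
    using l by (intro sum.cong refl) (simp add: Eis_eq_cont[OF \<tau> k N])
  finally show ?thesis .
qed

lemma Eis_eq_moebius_sum:
  assumes \<tau>: "Im \<tau> > 0" and k: "k \<ge> 2" and N: "N \<ge> 1" and l: "primitive_mod N l"
  shows "Eis k N l \<tau> = eps_level N *
    (\<Sum>r\<in>unit_residues N. moebius_series N r (of_nat k) * G_value k N (scale_pair (inv_mod N r) l) \<tau>)"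
  using \<tau> unfolding Eis_eq_cont[OF assms] Eis_cont_def G_value_def by simp

section \<open>Fourier expansion of lattice sums\<close>

definition unity_root :: "nat \<Rightarrow> int \<Rightarrow> complex" where
  "unity_root N b = exp (2 * of_real pi * \<i> * (of_int b / of_nat N))"

text \<open>
  The \<open>j\<close>-th power of the local parameter \<open>exp (2 \<pi> \<i> \<tau> / N)\<close> at \<open>\<infinity>\<close>.
\<close>

definition qexp :: "nat \<Rightarrow> complex \<Rightarrow> nat \<Rightarrow> complex" where
  "qexp N \<tau> j = exp (2 * of_real pi * \<i> * of_nat j * \<tau> / of_nat N)"

text \<open>
  By \<open>1 / 0 = 0\<close> the origin is excluded from the row \<open>c = 0\<close>.
\<close>

definition lattice_row :: "nat \<Rightarrow> nat \<Rightarrow> int \<Rightarrow> complex \<Rightarrow> int \<Rightarrow> complex" where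
  "lattice_row k N b \<tau> c = (\<Sum>\<^sub>\<infinity>d | [d = b] (mod int N). 1 / (of_int c * \<tau> + of_int d) ^ k)"

definition lipschitz_const :: "nat \<Rightarrow> nat \<Rightarrow> complex" where
  "lipschitz_const k N = (-1) ^ k / (fact (k - 1) * of_nat N ^ k)"

text \<open>
  The twisted divisor sum that is the coefficient of \<open>q\<^sup>j\<close> in the double series of
  \<open>m\<^sup>k\<^sup>-\<^sup>1 \<zeta>\<^sup>b\<^sup>m q\<^sup>c\<^sup>m\<close> over \<open>m \<ge> 1\<close> and positive \<open>c \<equiv> a\<close>.
\<close>

definition div_coeff :: "nat \<Rightarrow> nat \<Rightarrow> int \<Rightarrow> int \<Rightarrow> nat \<Rightarrow> complex" where
  "div_coeff k N a b j =
     (\<Sum>m | m \<ge> 1 \<and> m dvd j \<and> j \<ge> 1 \<and> [int (j div m) = a] (mod int N). of_nat m ^ (k - 1) * unity_root N b ^ m)"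

lemma bij_betw_res_class_int:
  assumes "N \<ge> 1"
  shows "bij_betw (\<lambda>j. b + int N * j) UNIV {d. [d = b] (mod int N)}"
proof (rule bij_betw_byWitness[where f' = "\<lambda>d. (d - b) div int N"])
  show "\<forall>j\<in>UNIV. (b + int N * j - b) div int N = j" using assms by simp
  show "\<forall>d\<in>{d. [d = b] (mod int N)}. b + int N * ((d - b) div int N) = d"
    by (auto simp: cong_iff_dvd_diff)
  show "range (\<lambda>j. b + int N * j) \<subseteq> {d. [d = b] (mod int N)}"
    by (auto simp: cong_iff_dvd_diff)
qed simp

text \<open>
  Sums over \<open>\<int>\<close> are compared along the same exhaustion as the conditionally convergent partial
  fractions of the cotangent.
\<close>

lemma has_sum_int_tendsto:
  fixes f :: "int \<Rightarrow> complex"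
  assumes "(f has_sum S) UNIV"
  shows "(\<lambda>m. \<Sum>j\<in>{- int m..<int m}. f j) \<longlonglongrightarrow> S"
proof -
  have "filterlim (\<lambda>m. {- int m..<int m}) (finite_subsets_at_top UNIV) sequentially"
    unfolding filterlim_finite_subsets_at_top
  proof (intro allI impI)
    fix Y :: "int set" assume Y: "finite Y \<and> Y \<subseteq> UNIV"
    define M where "M = nat (Max (insert 0 (abs ` Y)) + 1)"
    have "Y \<subseteq> {- int m..<int m}" if "m \<ge> M" for m
    proof
      fix y assume "y \<in> Y"
      then have "\<bar>y\<bar> \<le> Max (insert 0 (abs ` Y))" using Y by (intro Max_ge) auto
      moreover have "Max (insert 0 (abs ` Y)) + 1 \<le> int m" using that by (simp add: M_def)
      ultimately show "y \<in> {- int m..<int m}" by auto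
    qed
    then show "\<forall>\<^sub>F m in sequentially. finite {- int m..<int m} \<and> Y \<subseteq> {- int m..<int m} \<and> {- int m..<int m} \<subseteq> UNIV"
      by (intro eventually_sequentiallyI[of M]) auto
  qed
  with assms show ?thesis unfolding has_sum_def by (rule filterlim_compose)
qed

lemma sum_int_telescope:
  fixes f :: "int \<Rightarrow> complex"
  shows "(\<Sum>j\<in>{- int m..<int m}. f (j + 1) - f j) = f (int m) - f (- int m)"
proof (induction m)
  case (Suc m)
  have e: "- int m - 1 = - int (Suc m)" "- int (Suc m) + 1 = - int m" "int m + 1 = int (Suc m)" by simp_all
  show ?case unfolding sum_int_interval_Suc Suc e by (simp only: algebra_simps)
qed simp

lemma summable_on_power_geometric:
  assumes "0 \<le> \<rho>" "\<rho> < 1"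
  shows "(\<lambda>m::nat. real m ^ n * \<rho> ^ m) summable_on UNIV"
proof -
  have "norm (complex_of_real \<rho>) < 1" using assms by simp
  from sums_summable[OF lipschitz_fun_series[OF this, of n]]
  have "summable (\<lambda>m. (if m = 0 then 1 / 2 else 1) * of_nat m ^ n * complex_of_real \<rho> ^ m)" .
  then have "summable (\<lambda>m. complex_of_real (real (Suc m) ^ n * \<rho> ^ (Suc m)))"
    by (subst (asm) summable_Suc_iff[symmetric]) simp
  then have "summable (\<lambda>m. real (Suc m) ^ n * \<rho> ^ (Suc m))" by (simp only: summable_of_real_iff)
  then have "summable (\<lambda>m. real m ^ n * \<rho> ^ m)" by (subst (asm) summable_Suc_iff)
  then show ?thesis using assms by (subst summable_on_UNIV_nonneg_real_iff) auto
qed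

lemma not_Ints_if_Im: "Im z \<noteq> 0 \<Longrightarrow> z \<notin> \<int>"
  by (auto elim!: Ints_cases)

lemma lattice_row_lipschitz:
  assumes k: "k \<ge> 2" and N: "N \<ge> 1" and w: "(of_int c * \<tau> + of_int b) / of_nat N \<notin> \<int>"
  shows "lattice_row k N b \<tau> c = lipschitz_const k N * ((2 * of_real pi * \<i>) ^ k *
     lipschitz_fun (k - 1) (exp (2 * of_real pi * \<i> * ((of_int c * \<tau> + of_int b) / of_nat N))))"
proof -
  define n where "n = k - 1"
  have n: "n \<ge> 1" "k = Suc n" using k by (auto simp: n_def)
  let ?w = "(of_int c * \<tau> + of_int b) / of_nat N"
  let ?L = "(2 * of_real pi * \<i>) ^ Suc n * lipschitz_fun n (exp (2 * of_real pi * \<i> * ?w))"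
  have N0: "complex_of_nat N \<noteq> 0" using N by simp
  have "((\<lambda>j. inverse (of_nat N ^ Suc n) * (1 / (?w + of_int j) ^ Suc n)) has_sum
      (inverse (of_nat N ^ Suc n) * ((-1) ^ Suc n / fact n * ?L))) UNIV"
    by (rule has_sum_cmult_right[OF lipschitz_has_sum[OF w n(1)]])
  also have "(\<lambda>j. inverse (of_nat N ^ Suc n) * (1 / (?w + of_int j) ^ Suc n)) =
     (\<lambda>j. 1 / (of_int c * \<tau> + of_int (b + int N * j)) ^ Suc n)"
  proof
    fix j
    have "of_int c * \<tau> + of_int (b + int N * j) = of_nat N * (?w + of_int j)"
      using N0 by (simp add: field_simps)
    then show "inverse (of_nat N ^ Suc n) * (1 / (?w + of_int j) ^ Suc n) = 1 / (of_int c * \<tau> + of_int (b + int N * j)) ^ Suc n"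
      by (simp only: power_mult_distrib divide_inverse inverse_mult_distrib mult_1)
  qed
  finally have "((\<lambda>d. 1 / (of_int c * \<tau> + of_int d) ^ Suc n) has_sum
      (inverse (of_nat N ^ Suc n) * ((-1) ^ Suc n / fact n * ?L))) {d. [d = b] (mod int N)}"
    by (simp only: has_sum_reindex_bij_betw[OF bij_betw_res_class_int[OF N], of "\<lambda>d. 1 / (of_int c * \<tau> + of_int d) ^ Suc n"])
  then have "lattice_row k N b \<tau> c = inverse (of_nat N ^ Suc n) * ((-1) ^ Suc n / fact n * ?L)"
    unfolding lattice_row_def n(2) by (rule infsumI)
  also have "\<dots> = lipschitz_const k N * ?L" unfolding lipschitz_const_def n_def[symmetric] n(2)
    by (simp only: divide_inverse inverse_mult_distrib mult_ac diff_Suc_1)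
  finally show ?thesis unfolding n_def[symmetric] n(2)[symmetric] .
qed

text \<open>
  The Lipschitz formula turns the rows into a Lambert series, a double series over \<open>(c, m)\<close> in the
  powers \<open>q\<^sup>c\<^sup>m\<close>; it converges absolutely and is rearranged by \<open>j = c m\<close>.
\<close>

lemma positive_rows:
  assumes k: "k \<ge> 2" and N: "N \<ge> 1" and \<tau>: "Im \<tau> > 0"
  obtains T where
    "((\<lambda>c. lattice_row k N b \<tau> (int c)) has_sum (lipschitz_const k N * ((2 * of_real pi * \<i>) ^ k * T))) {c. c \<ge> 1 \<and> [int c = a] (mod int N)}"
    "(\<lambda>j. div_coeff k N a b j * qexp N \<tau> j) sums T"
proof -
  define A where "A = {c::nat. c \<ge> 1 \<and> [int c = a] (mod int N)}"
  define M where "M = {m::nat. m \<ge> 1}"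
  define t where "t = (\<lambda>(c::nat, m::nat). of_nat m ^ (k - 1) * unity_root N b ^ m * qexp N \<tau> (c * m))"
  define \<rho> where "\<rho> = exp (- 2 * pi * Im \<tau> / real N)"
  define q where "q c = exp (2 * of_real pi * \<i> * ((of_int (int c) * \<tau> + of_int b) / of_nat N))" for c
  have N0: "complex_of_nat N \<noteq> 0" using N by simp
  have \<rho>: "0 < \<rho>" "\<rho> < 1" using \<tau> N by (auto simp: \<rho>_def)
  have nz: "norm (unity_root N b) = 1" by (simp add: unity_root_def)
  have nq: "norm (qexp N \<tau> j) = \<rho> ^ j" for j
  proof -
    have "norm (qexp N \<tau> j) = exp (real j * (- 2 * pi * Im \<tau> / real N))"
      by (simp add: qexp_def)
    then show ?thesis by (simp only: exp_of_nat_mult \<rho>_def)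
  qed
  have tq: "t (c, m) = of_nat m ^ (k - 1) * q c ^ m" for c m
  proof -
    have "q c ^ m = exp (of_nat m * (2 * of_real pi * \<i> * ((of_int (int c) * \<tau> + of_int b) / of_nat N)))"
      by (simp only: q_def exp_of_nat_mult)
    also have "of_nat m * (2 * of_real pi * \<i> * ((of_int (int c) * \<tau> + of_int b) / of_nat N)) =
        of_nat m * (2 * of_real pi * \<i> * (of_int b / of_nat N)) + 2 * of_real pi * \<i> * of_nat (c * m) * \<tau> / of_nat N"
      by (simp add: add_divide_distrib algebra_simps)
    also have "exp \<dots> = unity_root N b ^ m * qexp N \<tau> (c * m)"
      by (simp only: exp_add exp_of_nat_mult unity_root_def qexp_def)
    finally show ?thesis by (simp add: t_def)
  qed
  have sm: "(\<lambda>x. norm (t x)) summable_on (A \<times> M)"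
  proof (rule summable_on_comparison_test)
    have 1: "(\<lambda>c::nat. inverse \<rho> * \<rho> ^ c) summable_on A"
      using summable_on_power_geometric[of \<rho> 0] \<rho>
      by (intro summable_on_cmult_right) (auto intro: summable_on_subset_banach)
    have 2: "(\<lambda>m::nat. real m ^ (k - 1) * \<rho> ^ m) summable_on M"
      by (rule summable_on_subset_banach[OF summable_on_power_geometric]) (use \<rho> in auto)
    show "(\<lambda>(c, m). (inverse \<rho> * \<rho> ^ c) * (real m ^ (k - 1) * \<rho> ^ m)) summable_on (A \<times> M)"
      by (rule summable_on_product_nonneg[OF 1 _ 2]) (use \<rho> in auto)
    fix x assume x: "x \<in> A \<times> M"
    obtain c m where cm: "x = (c, m)" by (cases x) blast
    have c: "c \<ge> 1" "m \<ge> 1" using x cm by (auto simp: A_def M_def)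
    \<comment> \<open>This is \<open>(c - 1) (m - 1) \<ge> 0\<close>; it separates the variables in the majorant \<open>\<rho>\<^sup>c\<^sup>m\<close>.\<close>
    have le: "c + m \<le> Suc (c * m)"
    proof -
      obtain c' m' where "c = Suc c'" "m = Suc m'" using c by (metis Suc_le_D One_nat_def)
      then show ?thesis by simp
    qed
    have "\<rho> * \<rho> ^ (c * m) \<le> \<rho> ^ (c + m)"
      using power_decreasing[OF le, of \<rho>] \<rho> by simp
    then have "\<rho> ^ (c * m) \<le> inverse \<rho> * \<rho> ^ c * \<rho> ^ m" using \<rho> by (simp add: field_simps power_add)
    then have "real m ^ (k - 1) * \<rho> ^ (c * m) \<le> real m ^ (k - 1) * (inverse \<rho> * \<rho> ^ c * \<rho> ^ m)"
      by (intro mult_left_mono) auto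
    then show "norm (t x) \<le> (case x of (c, m) \<Rightarrow> (inverse \<rho> * \<rho> ^ c) * (real m ^ (k - 1) * \<rho> ^ m))"
      unfolding cm by (simp add: t_def norm_mult norm_power nz nq mult_ac)
  qed simp
  have smt: "t summable_on (A \<times> M)" by (rule abs_summable_summable[OF sm])
  define T where "T = infsum t (A \<times> M)"
  have T: "(t has_sum T) (A \<times> M)" unfolding T_def by (rule has_sum_infsum[OF smt])
  have inner: "((\<lambda>m. t (c, m)) has_sum lipschitz_fun (k - 1) (q c)) M" if c: "c \<in> A" for c
  proof -
    have "norm (q c) = \<rho> ^ c"
    proof -
      have "t (c, 1) = q c" using tq[of c 1] by simp
      then show ?thesis by (simp add: t_def norm_mult nz nq flip: \<open>t (c, 1) = q c\<close>)
    qed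
    moreover have "\<rho> ^ c < 1" using \<rho> c by (auto simp: A_def power_less_one_iff)
    ultimately have s: "(\<lambda>m. (if m = 0 then 1 / 2 else 1) * of_nat m ^ (k - 1) * q c ^ m) sums lipschitz_fun (k - 1) (q c)"
      by (intro lipschitz_fun_series) simp
    have k1: "k - 1 \<noteq> 0" using k by simp
    have "(\<lambda>m. (if m = 0 then 1 / 2 else 1) * of_nat m ^ (k - 1) * q c ^ m) = (\<lambda>m. t (c, m))"
      using k1 by (auto simp: tq fun_eq_iff)
    with s have s: "(\<lambda>m. t (c, m)) sums lipschitz_fun (k - 1) (q c)" by simp
    have "(\<lambda>m. t (c, m)) summable_on M"
      using summable_on_SigmaD1[of "\<lambda>c m. t (c, m)" A "\<lambda>_. M" c] smt c by simp
    then have h: "((\<lambda>m. t (c, m)) has_sum infsum (\<lambda>m. t (c, m)) M) M" by (rule has_sum_infsum)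
    have "((\<lambda>m. t (c, m)) has_sum infsum (\<lambda>m. t (c, m)) M) UNIV"
      by (rule has_sum_cong_neutral[THEN iffD1, OF _ _ _ h]) (use k1 in \<open>auto simp: M_def t_def\<close>)
    from sums_unique2[OF has_sum_imp_sums[OF this] s] h show ?thesis by simp
  qed
  have rows: "((\<lambda>c. lipschitz_fun (k - 1) (q c)) has_sum T) A"
    by (rule has_sum_SigmaD[OF T inner])
  have rw: "lattice_row k N b \<tau> (int c) = lipschitz_const k N * ((2 * of_real pi * \<i>) ^ k * lipschitz_fun (k - 1) (q c))" if c: "c \<in> A" for c
    unfolding q_def
  proof (rule lattice_row_lipschitz[OF k N])
    have "Im ((of_int (int c) * \<tau> + of_int b) / of_nat N) = real c * Im \<tau> / real N" by (simp add: Im_divide_of_nat)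
    also have "\<dots> > 0" using c \<tau> N by (auto simp: A_def)
    finally have p: "0 < Im ((of_int (int c) * \<tau> + of_int b) / of_nat N)" .
    show "(of_int (int c) * \<tau> + of_int b) / of_nat N \<notin> \<int>"
      by (rule not_Ints_if_Im[OF less_imp_neq[OF p, THEN not_sym]])
  qed
  have P1: "((\<lambda>c. lattice_row k N b \<tau> (int c)) has_sum (lipschitz_const k N * ((2 * of_real pi * \<i>) ^ k * T))) A"
    by (rule has_sum_cong[THEN iffD2, OF rw has_sum_cmult_right[OF has_sum_cmult_right[OF rows]]])
  define D where "D j = {m. m \<ge> 1 \<and> m dvd j \<and> j \<ge> 1 \<and> [int (j div m) = a] (mod int N)}" for j :: nat
  have "(t has_sum T) (A \<times> M) \<longleftrightarrow> ((\<lambda>(j, m). of_nat m ^ (k - 1) * unity_root N b ^ m * qexp N \<tau> j) has_sum T) (Sigma UNIV D)"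
  proof (rule has_sum_reindex_bij_witness[where j = "\<lambda>(c, m). (c * m, m)" and i = "\<lambda>(j, m). (j div m, m)"])
    fix x assume "x \<in> A \<times> M"
    then obtain c m where x: "x = (c, m)" "c \<in> A" "m \<ge> 1" by (auto simp: M_def)
    show "(case case x of (c, m) \<Rightarrow> (c * m, m) of (j, m) \<Rightarrow> (j div m, m)) = x" using x by simp
    show "(case x of (c, m) \<Rightarrow> (c * m, m)) \<in> Sigma UNIV D" using x by (simp add: D_def A_def)
    show "(case case x of (c, m) \<Rightarrow> (c * m, m) of (j, m) \<Rightarrow> of_nat m ^ (k - 1) * unity_root N b ^ m * qexp N \<tau> j) = t x"
      using x by (simp add: t_def)
  next
    fix x assume "x \<in> Sigma UNIV D"
    then obtain j m where x: "x = (j, m)" "m \<in> D j" by blast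
    show "(case case x of (j, m) \<Rightarrow> (j div m, m) of (c, m) \<Rightarrow> (c * m, m)) = x" using x by (simp add: D_def)
    have "j div m \<ge> 1" using x by (auto simp: D_def dvd_imp_le div_greater_zero_iff Suc_le_eq)
    then show "(case x of (j, m) \<Rightarrow> (j div m, m)) \<in> A \<times> M" using x by (simp add: D_def A_def M_def)
  qed (rule refl)
  with T have "((\<lambda>(j, m). of_nat m ^ (k - 1) * unity_root N b ^ m * qexp N \<tau> j) has_sum T) (Sigma UNIV D)" by simp
  then have "((\<lambda>j. div_coeff k N a b j * qexp N \<tau> j) has_sum T) UNIV"
  proof (rule has_sum_SigmaD)
    fix j :: nat
    have "finite (D j)" by (rule finite_subset[of _ "{..j}"]) (auto simp: D_def dest: dvd_imp_le)
    then show "((\<lambda>m. case (j, m) of (j, m) \<Rightarrow> of_nat m ^ (k - 1) * unity_root N b ^ m * qexp N \<tau> j) has_sum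
        (div_coeff k N a b j * qexp N \<tau> j)) (D j)"
      by (intro has_sum_finiteI) (simp_all add: div_coeff_def D_def sum_distrib_right)
  qed
  then have P2: "(\<lambda>j. div_coeff k N a b j * qexp N \<tau> j) sums T" by (rule has_sum_imp_sums)
  show thesis using that P1 P2 unfolding A_def by blast
qed

lemma lattice_row_uminus: "lattice_row k N b \<tau> (- c) = (-1) ^ k * lattice_row k N (- b) \<tau> c"
proof -
  have "lattice_row k N b \<tau> (- c) = (\<Sum>\<^sub>\<infinity>d | [d = - b] (mod int N). (-1) ^ k * (1 / (of_int c * \<tau> + of_int d) ^ k))"
    unfolding lattice_row_def
  proof (rule infsum_reindex_bij_witness[where i = uminus and j = uminus])
    fix d assume d: "d \<in> {d. [d = b] (mod int N)}"
    show "- d \<in> {d. [d = - b] (mod int N)}" using d by (simp add: cong_minus_minus_iff)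
    have "of_int (- c) * \<tau> + of_int d = (-1) * (of_int c * \<tau> + of_int (- d))" by simp
    then have "(of_int (- c) * \<tau> + of_int d) ^ k = (-1) ^ k * (of_int c * \<tau> + of_int (- d)) ^ k"
      by (simp only: power_mult_distrib)
    moreover have "inverse ((-1) ^ k :: complex) = (-1) ^ k"
      by (metis inverse_minus_eq inverse_1 power_inverse)
    ultimately show "(-1) ^ k * (1 / (of_int c * \<tau> + of_int (- d)) ^ k) = 1 / (of_int (- c) * \<tau> + of_int d) ^ k"
      by (simp only: divide_inverse inverse_mult_distrib mult_1)
  next
    fix d assume d: "d \<in> {d. [d = - b] (mod int N)}"
    show "- d \<in> {d. [d = b] (mod int N)}" using d cong_minus_minus_iff[of d "- b" "int N"] by simp
  qed simp_all
  then show ?thesis unfolding lattice_row_def by (simp only: infsum_cmult_right')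
qed

text \<open>
  The row \<open>c = 0\<close>, which supplies the constant term.
\<close>

definition H_value :: "nat \<Rightarrow> nat \<Rightarrow> int \<Rightarrow> complex" where
  "H_value k N b = (\<Sum>\<^sub>\<infinity>d | [d = b] (mod int N). 1 / of_int d ^ k)"

text \<open>
  The coefficients are normalized by \<open>(2 \<pi> \<i>)\<^sup>-\<^sup>k\<close>. Rows with \<open>c < 0\<close> are reflected to rows with \<open>c > 0\<close>,
  which accounts for the second divisor sum.
\<close>

definition G_coeff :: "nat \<Rightarrow> nat \<Rightarrow> int \<times> int \<Rightarrow> nat \<Rightarrow> complex" where
  "G_coeff k N l j =
     (if j = 0 \<and> [fst l = 0] (mod int N) then H_value k N (snd l) / (2 * of_real pi * \<i>) ^ k else 0) +
     lipschitz_const k N * (div_coeff k N (fst l) (snd l) j + (-1) ^ k * div_coeff k N (- fst l) (- snd l) j)"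

lemma rows_sum:
  assumes k: "k \<ge> 2" and N: "N \<ge> 1" and \<tau>: "Im \<tau> > 0"
  obtains S where
    "(lattice_row k N b \<tau> has_sum ((2 * of_real pi * \<i>) ^ k * S)) {c. [c = a] (mod int N)}"
    "(\<lambda>j. G_coeff k N (a, b) j * qexp N \<tau> j) sums S"
proof -
  let ?P = "(2 * of_real pi * \<i>) ^ k :: complex"
  have P0: "?P \<noteq> 0" by simp
  obtain T1 where T1:
    "((\<lambda>c. lattice_row k N b \<tau> (int c)) has_sum (lipschitz_const k N * (?P * T1))) {c. c \<ge> 1 \<and> [int c = a] (mod int N)}"
    "(\<lambda>j. div_coeff k N a b j * qexp N \<tau> j) sums T1" using positive_rows[OF k N \<tau>] by blast
  obtain T2 where T2:
    "((\<lambda>c. lattice_row k N (- b) \<tau> (int c)) has_sum (lipschitz_const k N * (?P * T2))) {c. c \<ge> 1 \<and> [int c = - a] (mod int N)}"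
    "(\<lambda>j. div_coeff k N (- a) (- b) j * qexp N \<tau> j) sums T2" using positive_rows[OF k N \<tau>] by blast
  define A1 where "A1 = {c::int. c \<ge> 1 \<and> [c = a] (mod int N)}"
  define A2 where "A2 = {c::int. c \<le> -1 \<and> [c = a] (mod int N)}"
  define A3 where "A3 = {c::int. c = 0 \<and> [c = a] (mod int N)}"
  define h where "h = (if [a = 0] (mod int N) then H_value k N b / ?P else 0)"
  have 1: "(lattice_row k N b \<tau> has_sum (lipschitz_const k N * (?P * T1))) A1"
  proof -
    have "bij_betw int {c. c \<ge> 1 \<and> [int c = a] (mod int N)} A1"
      by (rule bij_betw_byWitness[where f' = nat]) (auto simp: A1_def)
    from has_sum_reindex_bij_betw[OF this, of "lattice_row k N b \<tau>"] T1(1) show ?thesis by simp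
  qed
  have 2: "(lattice_row k N b \<tau> has_sum ((-1) ^ k * (lipschitz_const k N * (?P * T2)))) A2"
  proof -
    have c: "[- c = a] (mod int N) \<longleftrightarrow> [c = - a] (mod int N)" for c
      using cong_minus_minus_iff[of "- c" a "int N"] by simp
    have "bij_betw (\<lambda>c. - int c) {c. c \<ge> 1 \<and> [int c = - a] (mod int N)} A2"
      by (rule bij_betw_byWitness[where f' = "\<lambda>c. nat (- c)"])
         (auto simp: A2_def c, metis c minus_minus)
    moreover have "((\<lambda>c. lattice_row k N b \<tau> (- int c)) has_sum ((-1) ^ k * (lipschitz_const k N * (?P * T2)))) {c. c \<ge> 1 \<and> [int c = - a] (mod int N)}"
      unfolding lattice_row_uminus by (rule has_sum_cmult_right[OF T2(1)])
    ultimately show ?thesis using has_sum_reindex_bij_betw[of "\<lambda>c. - int c" _ A2 "lattice_row k N b \<tau>"] by simp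
  qed
  have 3: "(lattice_row k N b \<tau> has_sum (?P * h)) A3"
  proof (cases "[a = 0] (mod int N)")
    case True
    then have "A3 = {0}" by (auto simp: A3_def cong_sym)
    moreover have "lattice_row k N b \<tau> 0 = ?P * h" using True by (simp add: lattice_row_def h_def H_value_def)
    ultimately show ?thesis by (intro has_sum_finiteI) auto
  next
    case False
    then have "A3 = {}" by (auto simp: A3_def cong_sym_eq)
    then show ?thesis using False by (simp add: h_def)
  qed
  have "(lattice_row k N b \<tau> has_sum (lipschitz_const k N * (?P * T1) + (-1) ^ k * (lipschitz_const k N * (?P * T2)) + ?P * h)) (A1 \<union> A2 \<union> A3)"
    by (intro has_sum_Un_disjoint 1 2 3) (auto simp: A1_def A2_def A3_def)
  also have "A1 \<union> A2 \<union> A3 = {c. [c = a] (mod int N)}" by (auto simp: A1_def A2_def A3_def)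
  also have "lipschitz_const k N * (?P * T1) + (-1) ^ k * (lipschitz_const k N * (?P * T2)) + ?P * h =
      ?P * (h + lipschitz_const k N * (T1 + (-1) ^ k * T2))" by (simp add: algebra_simps)
  finally have R: "(lattice_row k N b \<tau> has_sum (?P * (h + lipschitz_const k N * (T1 + (-1) ^ k * T2)))) {c. [c = a] (mod int N)}" .
  have q0: "qexp N \<tau> 0 = 1" by (simp add: qexp_def)
  have "(\<lambda>j. (if j = 0 then h else 0) + lipschitz_const k N * (div_coeff k N a b j * qexp N \<tau> j + (-1) ^ k * (div_coeff k N (- a) (- b) j * qexp N \<tau> j)))
      sums (h + lipschitz_const k N * (T1 + (-1) ^ k * T2))"
    by (intro sums_add sums_mult T1 T2 sums_single)
  moreover have "(\<lambda>j. (if j = 0 then h else 0) + lipschitz_const k N * (div_coeff k N a b j * qexp N \<tau> j + (-1) ^ k * (div_coeff k N (- a) (- b) j * qexp N \<tau> j)))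
     = (\<lambda>j. G_coeff k N (a, b) j * qexp N \<tau> j)"
    by (auto simp: G_coeff_def h_def q0 fun_eq_iff algebra_simps)
  ultimately have "(\<lambda>j. G_coeff k N (a, b) j * qexp N \<tau> j) sums (h + lipschitz_const k N * (T1 + (-1) ^ k * T2))" by simp
  with R show thesis using that by blast
qed

lemma res_class_Times: "res_class N (a, b) = {c. [c = a] (mod int N)} \<times> {d. [d = b] (mod int N)}"
  by (auto simp: res_class_def)

lemma hom_term_at_0: "k > 0 \<Longrightarrow> hom_term k 0 0 z = 1 / z ^ k"
  by (cases "z = 0") (simp_all add: hom_term_def)

lemma G_value_weight_ge_3:
  assumes k: "k \<ge> 3" and N: "N \<ge> 1" and \<tau>: "Im \<tau> > 0"
  shows "G_value k N (a, b) \<tau> = (\<Sum>\<^sub>\<infinity>c | [c = a] (mod int N). lattice_row k N b \<tau> c)"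
proof -
  have z: "0 \<in> half_plane k 2" using k by simp
  have k2: "k \<ge> 2" "k > 0" using k by auto
  have sm: "(\<lambda>p. hom_term k 0 0 (lattice_point \<tau> p)) summable_on res_class N (a, b)"
    by (rule abs_summable_summable[OF hom_term_summable[OF \<tau> k2(2)]]) (use k in simp)
  have "G_value k N (a, b) \<tau> = (\<Sum>\<^sub>\<infinity>p\<in>res_class N (a, b). hom_term k 0 0 (lattice_point \<tau> p))"
    unfolding G_value_def by (rule reg_term_series_eq_hom_term_series[OF \<tau> k2(1) N z])
  also have "\<dots> = (\<Sum>\<^sub>\<infinity>c | [c = a] (mod int N). \<Sum>\<^sub>\<infinity>d | [d = b] (mod int N). hom_term k 0 0 (lattice_point \<tau> (c, d)))"
    using sm unfolding res_class_Times by (rule infsum_Sigma_banach[symmetric])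
  finally show ?thesis by (simp add: lattice_row_def hom_term_at_0[OF k2(2)] lattice_point_def)
qed

lemma pi_cot_tendsto:
  fixes z :: "nat \<Rightarrow> complex"
  assumes "filterlim (\<lambda>n. Im (z n)) at_top sequentially"
  shows "(\<lambda>n. of_real pi * cot (of_real pi * z n)) \<longlonglongrightarrow> - (of_real pi * \<i>)"
proof -
  let ?q = "\<lambda>n. exp (2 * of_real pi * \<i> * z n)"
  have "(\<lambda>n. norm (?q n)) \<longlonglongrightarrow> 0"
  proof -
    have "filterlim (\<lambda>n. 2 * pi * Im (z n)) at_top sequentially"
      by (rule filterlim_tendsto_pos_mult_at_top[OF tendsto_const _ assms]) simp
    then have "filterlim (\<lambda>n. - (2 * pi * Im (z n))) at_bot sequentially"
      by (simp add: filterlim_uminus_at_bot)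
    then have "(\<lambda>n. exp (- (2 * pi * Im (z n)))) \<longlonglongrightarrow> 0"
      by (rule filterlim_compose[OF exp_at_bot])
    then show ?thesis by simp
  qed
  then have q: "?q \<longlonglongrightarrow> 0" by (rule tendsto_norm_zero_cancel)
  have "(\<lambda>n. - (of_real pi * \<i> * (1 + ?q n) / (1 - ?q n))) \<longlonglongrightarrow> - (of_real pi * \<i> * (1 + 0) / (1 - 0))"
    by (intro tendsto_intros q) simp
  moreover have "\<forall>\<^sub>F n in sequentially. - (of_real pi * \<i> * (1 + ?q n) / (1 - ?q n)) = of_real pi * cot (of_real pi * z n)"
  proof -
    have "\<forall>\<^sub>F n in sequentially. Im (z n) > 0" using assms by (simp add: filterlim_at_top_dense)
    then show ?thesis
    proof eventually_elim
      case (elim n)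
      then have "z n \<notin> \<int>" by (intro not_Ints_if_Im) simp
      from pi_cot_exp[OF this] show ?case by simp
    qed
  qed
  ultimately show ?thesis by (rule Lim_transform_eventually[THEN tendsto_eq_rhs]) simp
qed

lemma tendsto_inverse_shift: "(\<lambda>m. 1 / (z + of_int (int m))) \<longlonglongrightarrow> (0 :: complex)"
  "(\<lambda>m. 1 / (z + of_int (- int m))) \<longlonglongrightarrow> (0 :: complex)"
proof -
  have *: "filterlim (\<lambda>m. of_nat m + z) at_infinity sequentially" for z :: complex
    by (rule tendsto_add_filterlim_at_infinity'[OF tendsto_of_nat tendsto_const])
  have **: "(\<lambda>m. 1 / (z + of_nat m)) \<longlonglongrightarrow> 0" for z :: complex
    using tendsto_divide_0[OF tendsto_const *[of z], of 1] by (simp add: add.commute)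
  show "(\<lambda>m. 1 / (z + of_int (int m))) \<longlonglongrightarrow> 0" using **[of z] by simp
  have "(\<lambda>m. - (1 / (- z + of_nat m))) \<longlonglongrightarrow> - 0" by (intro tendsto_minus **)
  moreover have "- (1 / (- z + of_nat m)) = 1 / (z + of_int (- int m))" for m
  proof -
    have "z + of_int (- int m) = - (- z + of_nat m)" by simp
    then show ?thesis by (simp only: divide_minus_right)
  qed
  ultimately show "(\<lambda>m. 1 / (z + of_int (- int m))) \<longlonglongrightarrow> 0" by simp
qed

text \<open>
  Along a row the differences with the step \<open>N\<close> telescope to \<open>0\<close>. Those with the step \<open>N \<tau>\<close> compare
  two rows of a series that only converges conditionally, and yield two values of the cotangent. The
  representative \<open>b\<close> is reduced modulo \<open>N\<close> so that the row through the origin has \<open>b = 0\<close>, where the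
  partial fractions are available.
\<close>

lemma weight_2_row:
  assumes N: "N \<ge> 1" and \<tau>: "Im \<tau> > 0" and b: "0 \<le> b" "b < int N"
    and sm: "(\<lambda>d. reg_term 2 N \<tau> 0 (of_int c * \<tau> + of_int d)) summable_on {d. [d = b] (mod int N)}"
  defines "\<phi> \<equiv> \<lambda>c::int. of_real pi * cot (of_real pi * ((of_int c * \<tau> + of_int b) / of_nat N))"
  shows "(\<Sum>\<^sub>\<infinity>d | [d = b] (mod int N). reg_term 2 N \<tau> 0 (of_int c * \<tau> + of_int d)) =
    lattice_row 2 N b \<tau> c + (\<phi> (c + int N) - \<phi> c) / (of_nat N ^ 2 * (\<tau> - cnj \<tau>))"
proof -
  define w where "w = (of_int c * \<tau> + of_int b) / of_nat N"
  define K where "K = of_nat N ^ 2 * (\<tau> - cnj \<tau>)"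
  have N0: "complex_of_nat N \<noteq> 0" using N by simp
  have wN: "of_int c * \<tau> + of_int (b + int N * j) = of_nat N * (w + of_int j)" for j
    using N0 by (simp add: w_def field_simps)
  define r where "r j = 1 / (of_int c * \<tau> + of_int (b + int N * j)) ^ 2" for j
  define T where "T j = reg_term 2 N \<tau> 0 (of_int c * \<tau> + of_int (b + int N * j))" for j
  note re = bij_betw_res_class_int[OF N, of b]
  have int: "(of_int c' * \<tau> + of_int b) / of_nat N \<notin> \<int> \<or> (of_int c' * \<tau> + of_int b) / of_nat N = 0" for c' :: int
  proof (cases "c' = 0")
    case True
    show ?thesis
    proof (cases "b = 0")
      case False
      have "of_int b / complex_of_nat N \<notin> \<int>"
      proof
        assume "of_int b / complex_of_nat N \<in> \<int>"
        then obtain m where "of_int b / complex_of_nat N = of_int m" by (auto elim: Ints_cases)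
        then have "complex_of_int b = of_int (m * int N)" using N0 by (simp add: field_simps)
        then have "b = m * int N" by (simp only: of_int_eq_iff)
        then have "int N dvd b" by simp
        with b False show False using zdvd_imp_le by fastforce
      qed
      then show ?thesis using True by simp
    qed (use True in simp)
  next
    case False
    then have "Im ((of_int c' * \<tau> + of_int b) / of_nat N) \<noteq> 0"
      using \<tau> N by (simp add: Im_divide_of_nat)
    then show ?thesis using not_Ints_if_Im by blast
  qed
  have r: "(r has_sum lattice_row 2 N b \<tau> c) UNIV"
  proof -
    have "(\<lambda>j. inverse (of_nat N ^ 2) * (1 / (w + of_int j) ^ 2)) summable_on UNIV"
      by (intro summable_on_cmult_right abs_summable_summable[OF summable_on_int_shift_power]) simp
    also have "(\<lambda>j. inverse (of_nat N ^ 2) * (1 / (w + of_int j) ^ 2)) = r"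
      by (simp only: fun_eq_iff r_def wN power_mult_distrib divide_inverse inverse_mult_distrib mult_1 simp_thms)
    finally have "(r has_sum infsum r UNIV) UNIV" by (rule has_sum_infsum)
    then have "((\<lambda>d. 1 / (of_int c * \<tau> + of_int d) ^ 2) has_sum infsum r UNIV) {d. [d = b] (mod int N)}"
      unfolding r_def has_sum_reindex_bij_betw[OF re, of "\<lambda>d. 1 / (of_int c * \<tau> + of_int d) ^ 2"] .
    then have "lattice_row 2 N b \<tau> c = infsum r UNIV" unfolding lattice_row_def by (rule infsumI)
    with \<open>(r has_sum infsum r UNIV) UNIV\<close> show ?thesis by simp
  qed
  let ?S = "\<Sum>\<^sub>\<infinity>d | [d = b] (mod int N). reg_term 2 N \<tau> 0 (of_int c * \<tau> + of_int d)"
  have T: "(T has_sum ?S) UNIV"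
    unfolding T_def has_sum_reindex_bij_betw[OF re, of "\<lambda>d. reg_term 2 N \<tau> 0 (of_int c * \<tau> + of_int d)"]
    by (rule has_sum_infsum[OF sm])
  define g where "g u = (\<lambda>j::int. 1 / (u + of_int j))" for u :: complex
  have Tr: "T j - r j = ((g (w + \<tau>) j - g w j) - cnj \<tau> * (g w (j + 1) - g w j)) / K" for j
  proof -
    let ?z = "of_int c * \<tau> + of_int (b + int N * j)"
    have e: "?z = of_nat N * (w + of_int j)" by (rule wN)
    have e1: "?z + of_nat N * \<tau> = of_nat N * (w + \<tau> + of_int j)" unfolding e by (simp add: algebra_simps)
    have e2: "?z + of_nat N = of_nat N * (w + of_int (j + 1))" unfolding e by (simp add: algebra_simps)
    have h1: "hom_term 1 0 0 (of_nat N * u) = inverse (of_nat N) * (1 / u)" for u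
      by (simp add: hom_term_at_0 divide_inverse)
    have "T j - r j = ((hom_term 1 0 0 (?z + of_nat N * \<tau>) - hom_term 1 0 0 ?z)
      - cnj \<tau> * (hom_term 1 0 0 (?z + of_nat N) - hom_term 1 0 0 ?z)) / (of_nat N * (\<tau> - cnj \<tau>))"
      unfolding T_def r_def reg_term_def by (simp add: hom_term_at_0)
    also have "\<dots> = (inverse (of_nat N) * ((g (w + \<tau>) j - g w j) - cnj \<tau> * (g w (j + 1) - g w j))) / (of_nat N * (\<tau> - cnj \<tau>))"
      unfolding e1 e2 unfolding e h1 g_def by (simp only: algebra_simps)
    also have "\<dots> = ((g (w + \<tau>) j - g w j) - cnj \<tau> * (g w (j + 1) - g w j)) / K"
      unfolding K_def power2_eq_square by (simp only: divide_inverse inverse_mult_distrib mult_ac)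
    finally show ?thesis .
  qed
  \<comment> \<open>The three parts of \<open>T j - r j\<close> converge separately only along symmetric intervals.\<close>
  have L1: "(\<lambda>m. \<Sum>j\<in>{- int m..<int m}. T j - r j) \<longlonglongrightarrow> ?S - lattice_row 2 N b \<tau> c"
    by (rule has_sum_int_tendsto[OF has_sum_diff[OF T r]])
  have wt: "w + \<tau> = (of_int (c + int N) * \<tau> + of_int b) / of_nat N"
    using N0 by (simp add: w_def field_simps)
  have c1: "(\<lambda>m. \<Sum>j\<in>{- int m..<int m}. g (w + \<tau>) j) \<longlonglongrightarrow> \<phi> (c + int N)"
    unfolding g_def \<phi>_def wt[symmetric]
    by (rule cot_partial_fractions) (use int[of "c + int N"] wt in simp)
  have c2: "(\<lambda>m. \<Sum>j\<in>{- int m..<int m}. g w j) \<longlonglongrightarrow> \<phi> c"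
    unfolding g_def \<phi>_def w_def[symmetric]
    by (rule cot_partial_fractions) (use int[of c] w_def in simp)
  have c3: "(\<lambda>m. \<Sum>j\<in>{- int m..<int m}. g w (j + 1) - g w j) \<longlonglongrightarrow> 0 - 0"
    unfolding sum_int_telescope unfolding g_def by (intro tendsto_diff tendsto_inverse_shift)
  have K0: "K \<noteq> 0" using N0 \<tau> by (auto simp: K_def complex_eq_iff)
  have "(\<lambda>m. (((\<Sum>j\<in>{- int m..<int m}. g (w + \<tau>) j) - (\<Sum>j\<in>{- int m..<int m}. g w j)) -
       cnj \<tau> * (\<Sum>j\<in>{- int m..<int m}. g w (j + 1) - g w j)) / K) \<longlonglongrightarrow>
       ((\<phi> (c + int N) - \<phi> c) - cnj \<tau> * (0 - 0)) / K"
    by (intro tendsto_intros c1 c2 c3 K0)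
  also have "(\<lambda>m. (((\<Sum>j\<in>{- int m..<int m}. g (w + \<tau>) j) - (\<Sum>j\<in>{- int m..<int m}. g w j)) -
       cnj \<tau> * (\<Sum>j\<in>{- int m..<int m}. g w (j + 1) - g w j)) / K) =
      (\<lambda>m. \<Sum>j\<in>{- int m..<int m}. T j - r j)"
    unfolding Tr by (simp only: sum_divide_distrib[symmetric] sum_subtractf sum_distrib_left[symmetric])
  finally have "?S - lattice_row 2 N b \<tau> c = ((\<phi> (c + int N) - \<phi> c) - cnj \<tau> * (0 - 0)) / K"
    by (rule LIMSEQ_unique[OF L1])
  then show ?thesis unfolding K_def by (simp add: diff_eq_eq add.commute)
qed

text \<open>
  Summed over \<open>c\<close>, the cotangent terms telescope as well. What remains is the difference of the limits
  \<open>- \<pi> \<i>\<close> and \<open>\<pi> \<i>\<close> of \<open>\<pi> cot (\<pi> z)\<close> for \<open>Im z\<close> tending to \<open>\<infinity>\<close> and \<open>- \<infinity>\<close>, divided by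
  \<open>N\<^sup>2 (\<tau> - cnj \<tau>) = 2 \<i> N\<^sup>2 Im \<tau>\<close>.
\<close>

lemma G_value_weight_2:
  assumes N: "N \<ge> 1" and \<tau>: "Im \<tau> > 0" and b: "0 \<le> b" "b < int N"
  shows "G_value 2 N (a, b) \<tau> =
    (\<Sum>\<^sub>\<infinity>c | [c = a] (mod int N). lattice_row 2 N b \<tau> c) - of_real (pi / (real N ^ 2 * Im \<tau>))"
proof -
  let ?C = "{c. [c = a] (mod int N)}" and ?D = "{d. [d = b] (mod int N)}"
  let ?f = "\<lambda>c d. reg_term 2 N \<tau> 0 (of_int c * \<tau> + of_int d)"
  define \<phi> where "\<phi> c = of_real pi * cot (of_real pi * ((of_int c * \<tau> + of_int b) / of_nat N))" for c :: int
  define K where "K = of_nat N ^ 2 * (\<tau> - cnj \<tau>)"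
  have "(\<lambda>p. reg_term 2 N \<tau> 0 (lattice_point \<tau> p)) summable_on res_class N (a, b)"
    by (rule abs_summable_summable[OF reg_term_series(2)[OF \<tau> _ N]]) simp_all
  moreover have "(\<lambda>p. reg_term 2 N \<tau> 0 (lattice_point \<tau> p)) = (\<lambda>(c, d). ?f c d)"
    by (auto simp: lattice_point_def fun_eq_iff)
  ultimately have sm: "(\<lambda>(c, d). ?f c d) summable_on (?C \<times> ?D)" by (simp only: res_class_Times)
  have G: "G_value 2 N (a, b) \<tau> = (\<Sum>\<^sub>\<infinity>c\<in>?C. \<Sum>\<^sub>\<infinity>d\<in>?D. ?f c d)"
    unfolding G_value_def res_class_Times \<open>(\<lambda>p. reg_term 2 N \<tau> 0 (lattice_point \<tau> p)) = _\<close>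
    by (rule infsum_Sigma'_banach[OF sm, symmetric])
  have inner: "(\<Sum>\<^sub>\<infinity>d\<in>?D. ?f c d) = lattice_row 2 N b \<tau> c + (\<phi> (c + int N) - \<phi> c) / K" if "c \<in> ?C" for c
    unfolding \<phi>_def K_def by (rule weight_2_row[OF N \<tau> b summable_on_SigmaD1[OF sm that]])
  have "((\<lambda>c. \<Sum>\<^sub>\<infinity>d\<in>?D. ?f c d) has_sum G_value 2 N (a, b) \<tau>) ?C"
    unfolding G by (rule has_sum_infsum[OF summable_on_Sigma_banach[OF sm]])
  then have 1: "((\<lambda>c. lattice_row 2 N b \<tau> c + (\<phi> (c + int N) - \<phi> c) / K) has_sum G_value 2 N (a, b) \<tau>) ?C"
    by (rule has_sum_cong[THEN iffD1, OF inner, rotated])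
  let ?R = "\<Sum>\<^sub>\<infinity>c\<in>?C. lattice_row 2 N b \<tau> c"
  have "\<exists>S. (lattice_row 2 N b \<tau> has_sum S) ?C" using rows_sum[OF order_refl N \<tau>] by metis
  then have 2: "(lattice_row 2 N b \<tau> has_sum ?R) ?C" by (metis infsumI)
  have 3: "((\<lambda>c. (\<phi> (c + int N) - \<phi> c) / K) has_sum (G_value 2 N (a, b) \<tau> - ?R)) ?C"
    using has_sum_diff[OF 1 2] by simp
  define \<psi> where "\<psi> i = \<phi> (a + int N * i)" for i
  have "((\<lambda>i. (\<phi> (a + int N * i + int N) - \<phi> (a + int N * i)) / K) has_sum (G_value 2 N (a, b) \<tau> - ?R)) UNIV"
    using 3 has_sum_reindex_bij_betw[OF bij_betw_res_class_int[OF N, of a], of "\<lambda>c. (\<phi> (c + int N) - \<phi> c) / K"]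
    by simp
  moreover have "a + int N * i + int N = a + int N * (i + 1)" for i by (simp add: algebra_simps)
  ultimately have "((\<lambda>i. (\<psi> (i + 1) - \<psi> i) / K) has_sum (G_value 2 N (a, b) \<tau> - ?R)) UNIV"
    by (simp only: \<psi>_def)
  from has_sum_int_tendsto[OF this]
  \<comment> \<open>The sum over \<open>c = a + N i\<close> telescopes.\<close>
  have L: "(\<lambda>m. (\<psi> (int m) - \<psi> (- int m)) / K) \<longlonglongrightarrow> G_value 2 N (a, b) \<tau> - ?R"
    unfolding sum_divide_distrib[symmetric] sum_int_telescope .
  have lin: "filterlim (\<lambda>m. (x + real N * real m) * Im \<tau> / real N) at_top sequentially" for x
  proof -
    have "filterlim (\<lambda>m. x * Im \<tau> / real N + Im \<tau> * real m) at_top sequentially"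
      by (rule filterlim_tendsto_add_at_top[OF tendsto_const
            filterlim_tendsto_pos_mult_at_top[OF tendsto_const \<tau> filterlim_real_sequentially]])
    then show ?thesis using N by (simp add: algebra_simps add_divide_distrib)
  qed
  have p: "(\<lambda>m. \<psi> (int m)) \<longlonglongrightarrow> - (of_real pi * \<i>)"
    unfolding \<psi>_def \<phi>_def
    by (rule pi_cot_tendsto) (use lin[of "of_int a"] in \<open>simp add: Im_divide_of_nat\<close>)
  have "(\<lambda>m. of_real pi * cot (of_real pi * (- ((of_int (a + int N * (- int m)) * \<tau> + of_int b) / of_nat N)))) \<longlonglongrightarrow> - (of_real pi * \<i>)"
  proof (rule pi_cot_tendsto)
    have "Im (- ((of_int (a + int N * (- int m)) * \<tau> + of_int b) / of_nat N)) = (- of_int a + real N * real m) * Im \<tau> / real N" for m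
      by (simp add: Im_divide_of_nat algebra_simps diff_divide_distrib)
    then show "filterlim (\<lambda>m. Im (- ((of_int (a + int N * (- int m)) * \<tau> + of_int b) / of_nat N))) at_top sequentially"
      using lin[of "- of_int a"] by (simp only:)
  qed
  then have "(\<lambda>m. - \<psi> (- int m)) \<longlonglongrightarrow> - (of_real pi * \<i>)"
    unfolding \<psi>_def \<phi>_def by (simp only: mult_minus_right cot_minus)
  from tendsto_minus[OF this] have n: "(\<lambda>m. \<psi> (- int m)) \<longlonglongrightarrow> of_real pi * \<i>" by simp
  have K: "K = of_nat N ^ 2 * (2 * of_real (Im \<tau>) * \<i>)" unfolding K_def by (simp add: complex_diff_cnj)
  have K0: "K \<noteq> 0" using \<tau> N by (simp add: K)
  have "(\<lambda>m. (\<psi> (int m) - \<psi> (- int m)) / K) \<longlonglongrightarrow> (- (of_real pi * \<i>) - of_real pi * \<i>) / K"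
    by (intro tendsto_intros p n K0)
  from LIMSEQ_unique[OF L this]
  have "G_value 2 N (a, b) \<tau> - ?R = (- (of_real pi * \<i>) - of_real pi * \<i>) / K" .
  also have "\<dots> = - of_real (pi / (real N ^ 2 * Im \<tau>))"
    using \<tau> N by (simp add: K field_simps)
  finally show ?thesis by (simp add: algebra_simps)
qed

section \<open>Rationality of the Fourier coefficients\<close>

context complex_subfield
begin

lemma poly_mem:
  assumes "\<And>i. Polynomial.coeff p i \<in> K" "x \<in> K"
  shows "poly p x \<in> K"
  unfolding poly_altdef by (intro mem_intros assms)

lemma lipschitz_poly_coeff_mem: "Polynomial.coeff (lipschitz_poly n) i \<in> K"
proof (induction n arbitrary: i)
  case 0
  have "Polynomial.coeff (lipschitz_poly 0) i = (if i \<le> 1 then 1 / 2 else 0)"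
    by (auto simp: coeff_pCons split: nat.splits)
  moreover have "(if i \<le> 1 then 1 / 2 else 0) \<in> K" by (auto intro: mem_intros)
  ultimately show ?case by (simp only:)
next
  case (Suc n)
  let ?p = "lipschitz_poly n"
  have "Polynomial.coeff (lipschitz_poly (Suc n)) i =
     (case i of 0 \<Rightarrow> 0 | Suc j \<Rightarrow> of_nat (Suc j) * Polynomial.coeff ?p (Suc j)
        - (case j of 0 \<Rightarrow> 0 | Suc j' \<Rightarrow> of_nat (Suc j') * Polynomial.coeff ?p (Suc j'))
        + of_nat (Suc n) * Polynomial.coeff ?p j)"
    by (simp add: coeff_pCons coeff_pderiv split: nat.splits)
  also have "\<dots> \<in> K"
    by (auto split: nat.splits intro!: mem_intros Suc simp del: of_nat_Suc)
  finally show ?case .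
qed

lemma lipschitz_fun_mem: "q \<in> K \<Longrightarrow> lipschitz_fun n q \<in> K"
  unfolding lipschitz_fun_def by (intro mem_intros poly_mem lipschitz_poly_coeff_mem)

lemma lipschitz_const_mem: "lipschitz_const k N \<in> K"
proof -
  have "lipschitz_const k N = (-1) ^ k / (of_nat (fact (k - 1)) * of_nat N ^ k)" by (simp add: lipschitz_const_def)
  also have "\<dots> \<in> K" by (intro mem_intros)
  finally show ?thesis .
qed

lemma unity_root_mem:
  assumes "exp (2 * of_real pi * \<i> / of_nat N) \<in> K"
  shows "unity_root N b \<in> K"
proof -
  have n: "unity_root N (int n) = exp (2 * of_real pi * \<i> / of_nat N) ^ n" for n
  proof -
    have "2 * of_real pi * \<i> * (of_int (int n) / of_nat N) = of_nat n * (2 * of_real pi * \<i> / of_nat N)" by simp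
    then show ?thesis unfolding unity_root_def by (simp only: exp_of_nat_mult)
  qed
  have m: "unity_root N (- int n) = inverse (unity_root N (int n))" for n
    unfolding unity_root_def by (simp add: exp_minus)
  show ?thesis by (cases b rule: int_cases2) (simp_all only: m n, auto intro!: mem_intros assms)
qed

lemma div_coeff_mem:
  assumes "exp (2 * of_real pi * \<i> / of_nat N) \<in> K"
  shows "div_coeff k N a b j \<in> K"
  unfolding div_coeff_def by (intro mem_intros unity_root_mem assms)

end

text \<open>
  The Lipschitz formula at the noninteger \<open>b / N\<close>; this excludes level \<open>1\<close>.
\<close>

lemma H_value_lipschitz:
  assumes k: "k \<ge> 2" and N: "N \<ge> 2" and b: "coprime b (int N)"
  shows "H_value k N b / (2 * of_real pi * \<i>) ^ k = lipschitz_const k N * lipschitz_fun (k - 1) (unity_root N b)"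
proof -
  have N1: "N \<ge> 1" and N0: "complex_of_nat N \<noteq> 0" using N by auto
  have "(of_int 0 * 0 + of_int b) / of_nat N \<notin> (\<int> :: complex set)"
  proof
    assume "(of_int 0 * 0 + of_int b) / of_nat N \<in> (\<int> :: complex set)"
    then obtain m where "(of_int 0 * 0 + of_int b) / complex_of_nat N = of_int m" by (auto elim: Ints_cases)
    then have "complex_of_int b = of_int (m * int N)" using N0 by (simp add: field_simps)
    then have "b = m * int N" by (simp only: of_int_eq_iff)
    then have "int N dvd b" by simp
    then have "is_unit (int N)" using b by (metis coprime_common_divisor dvd_refl)
    then show False using N by simp
  qed
  from lattice_row_lipschitz[OF k N1 this]
  have "lattice_row k N b 0 0 = lipschitz_const k N * ((2 * of_real pi * \<i>) ^ k * lipschitz_fun (k - 1) (unity_root N b))"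
    by (simp add: unity_root_def)
  moreover have "lattice_row k N b 0 0 = H_value k N b" by (simp add: lattice_row_def H_value_def)
  ultimately show ?thesis by (simp only: times_divide_eq_left[symmetric]) simp
qed

text \<open>
  The sum over the even integers is \<open>2\<^sup>-\<^sup>k\<close> times the sum over all integers, and the odd integers form a
  residue class modulo \<open>2\<close>, to which the Lipschitz formula applies.
\<close>

lemma H_value_level_1:
  assumes k: "k \<ge> 2"
  shows "H_value k 1 b * (1 - 1 / 2 ^ k) = H_value k 2 1"
proof -
  let ?f = "\<lambda>d::int. 1 / complex_of_int d ^ k"
  have s: "?f summable_on A" for A
    by (rule summable_on_subset_banach[OF abs_summable_summable[OF summable_on_int_shift_power[OF k, of 0, simplified]]]) simp
  have 1: "H_value k 1 b = infsum ?f UNIV" by (simp add: H_value_def)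
  have o: "{d. [d = 1] (mod int 2)} = {d. odd d}" by (auto simp: cong_def even_iff_mod_2_eq_zero)
  have "UNIV = {d::int. odd d} \<union> {d. even d}" by auto
  then have "infsum ?f UNIV = infsum ?f {d. odd d} + infsum ?f {d. even d}"
    using infsum_Un_disjoint[OF s s, of "{d. odd d}" "{d. even d}"] by (simp add: disjoint_iff)
  moreover have "infsum ?f {d. even d} = (\<Sum>\<^sub>\<infinity>d. 1 / 2 ^ k * ?f d)"
    by (rule infsum_reindex_bij_witness[where i = "\<lambda>d. 2 * d" and j = "\<lambda>d. d div 2"])
       (auto elim!: evenE simp: power_mult_distrib)
  moreover have "\<dots> = 1 / 2 ^ k * infsum ?f UNIV" by (rule infsum_cmult_right')
  moreover have "infsum ?f {d. odd d} = H_value k 2 1" unfolding H_value_def o ..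
  ultimately show ?thesis unfolding 1 by (simp add: algebra_simps)
qed

lemma (in complex_subfield) H_value_mem:
  assumes k: "k \<ge> 2" and N: "N \<ge> 1" and b: "coprime b (int N)"
    and z: "exp (2 * of_real pi * \<i> / of_nat N) \<in> K"
  shows "H_value k N b / (2 * of_real pi * \<i>) ^ k \<in> K"
proof (cases "N = 1")
  case False
  then have "N \<ge> 2" using N by simp
  from H_value_lipschitz[OF k this b] show ?thesis
    using lipschitz_const_mem lipschitz_fun_mem unity_root_mem[OF z] mult_mem by simp
next
  case True
  have "exp (2 * of_real pi * \<i> / of_nat 2) \<in> K" using uminus_mem[OF one_mem] by simp
  then have h: "H_value k 2 1 / (2 * of_real pi * \<i>) ^ k \<in> K"
    unfolding H_value_lipschitz[OF k order_refl coprime_1_left]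
    using lipschitz_const_mem lipschitz_fun_mem unity_root_mem mult_mem by blast
  have "(2::complex) ^ k \<noteq> 1"
  proof
    assume "(2::complex) ^ k = 1"
    then have "norm ((2::complex) ^ k) = 1" by simp
    then have "(2::real) ^ k = 1" by (simp add: norm_power)
    then show False using one_less_power[of "2::real" k] k by simp
  qed
  then have "1 - 1 / (2::complex) ^ k \<noteq> 0" by simp
  then have "H_value k 1 b / (2 * of_real pi * \<i>) ^ k = H_value k 2 1 / (2 * of_real pi * \<i>) ^ k / (1 - 1 / 2 ^ k)"
    unfolding H_value_level_1[OF k, of b, symmetric] by simp
  also have "\<dots> \<in> K" by (intro divide_mem[OF h] mem_intros)
  finally show ?thesis unfolding True .
qed

lemma primitive_mod_coprime_snd:
  assumes "primitive_mod N l" "[fst l = 0] (mod int N)"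
  shows "coprime (snd l) (int N)"
proof -
  have "gcd (snd l) (int N) dvd int N" "gcd (snd l) (int N) dvd snd l" by auto
  moreover have "int N dvd fst l" using assms(2) by (simp add: cong_0_iff)
  ultimately have "gcd (snd l) (int N) dvd gcd (gcd (fst l) (snd l)) (int N)"
    by (intro gcd_greatest) (auto intro: dvd_trans)
  then have "gcd (snd l) (int N) dvd 1" by (metis assms(1) primitive_mod_def)
  then show ?thesis using is_unit_gcd by blast
qed

lemma (in complex_subfield) G_coeff_mem:
  assumes "k \<ge> 2" "N \<ge> 1" "primitive_mod N l" "exp (2 * of_real pi * \<i> / of_nat N) \<in> K"
  shows "G_coeff k N l j \<in> K"
proof -
  have "(if j = 0 \<and> [fst l = 0] (mod int N) then H_value k N (snd l) / (2 * of_real pi * \<i>) ^ k else 0) \<in> K"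
    using H_value_mem[OF assms(1,2) primitive_mod_coprime_snd[OF assms(3)] assms(4)] zero_mem by auto
  then show ?thesis unfolding G_coeff_def
    by (intro add_mem mult_mem lipschitz_const_mem div_coeff_mem power_mem uminus_mem one_mem assms(4))
qed

text \<open>
  The part of \<open>G_value\<close> that depends holomorphically on \<open>\<tau>\<close>.
\<close>

definition G_hol :: "nat \<Rightarrow> nat \<Rightarrow> int \<times> int \<Rightarrow> complex \<Rightarrow> complex" where
  "G_hol k N l \<tau> = (\<Sum>\<^sub>\<infinity>c | [c = fst l] (mod int N). lattice_row k N (snd l) \<tau> c)"

lemma cong_class_eq: "[a = b] (mod int N) \<Longrightarrow> {d. [d = a] (mod int N)} = {d. [d = b] (mod int N)}"
  using cong_trans cong_sym by blast

lemma G_hol_cong: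
  assumes "[fst l = fst l'] (mod int N)" "[snd l = snd l'] (mod int N)"
  shows "G_hol k N l \<tau> = G_hol k N l' \<tau>"
  unfolding G_hol_def lattice_row_def cong_class_eq[OF assms(1)] cong_class_eq[OF assms(2)] ..

lemma G_value_eq_G_hol:
  assumes k: "k \<ge> 2" and N: "N \<ge> 1" and \<tau>: "Im \<tau> > 0"
  shows "G_value k N l \<tau> = G_hol k N l \<tau> - (if k = 2 then of_real (pi / (real N ^ 2 * Im \<tau>)) else 0)"
proof -
  let ?l = "(fst l, snd l mod int N)"
  have c: "[snd l = snd l mod int N] (mod int N)" by (simp add: cong_def)
  have "res_class N l = res_class N ?l"
    using cong_class_eq[OF c] res_class_Times[of N "fst l" "snd l"] res_class_Times[of N "fst l" "snd l mod int N"]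
    by simp
  then have "G_value k N l \<tau> = G_value k N ?l \<tau>" by (simp only: G_value_def)
  also have "\<dots> = G_hol k N ?l \<tau> - (if k = 2 then of_real (pi / (real N ^ 2 * Im \<tau>)) else 0)"
  proof (cases "k = 2")
    case True
    show ?thesis using G_value_weight_2[OF N \<tau>, of "snd l mod int N" "fst l"] N True by (simp add: G_hol_def)
  next
    case False
    then show ?thesis using G_value_weight_ge_3[of k N \<tau> "fst l" "snd l mod int N"] k N \<tau> by (simp add: G_hol_def)
  qed
  also have "G_hol k N ?l \<tau> = G_hol k N l \<tau>" by (rule G_hol_cong) (simp_all add: cong_def)
  finally show ?thesis .
qed

lemma G_hol_sums:
  assumes k: "k \<ge> 2" and N: "N \<ge> 1" and \<tau>: "Im \<tau> > 0"
  shows "(\<lambda>j. G_coeff k N l j * qexp N \<tau> j) sums (G_hol k N l \<tau> / (2 * of_real pi * \<i>) ^ k)"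
proof -
  obtain S where S: "(lattice_row k N (snd l) \<tau> has_sum ((2 * of_real pi * \<i>) ^ k * S)) {c. [c = fst l] (mod int N)}"
    "(\<lambda>j. G_coeff k N (fst l, snd l) j * qexp N \<tau> j) sums S" using rows_sum[OF k N \<tau>] by blast
  have "G_hol k N l \<tau> = (2 * of_real pi * \<i>) ^ k * S" unfolding G_hol_def by (rule infsumI[OF S(1)])
  then show ?thesis using S(2) by simp
qed

lemma G_hol_uminus: "G_hol k N (scale_pair (-1) l) \<tau> = (-1) ^ k * G_hol k N l \<tau>"
proof -
  have "G_hol k N (scale_pair (-1) l) \<tau> = (\<Sum>\<^sub>\<infinity>c | [c = fst l] (mod int N). (-1) ^ k * lattice_row k N (snd l) \<tau> c)"
    unfolding G_hol_def scale_pair_def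
  proof (rule infsum_reindex_bij_witness[where i = uminus and j = uminus])
    fix c assume "c \<in> {c. [c = fst (- 1 * fst l, - 1 * snd l)] (mod int N)}"
    then show "- c \<in> {c. [c = fst l] (mod int N)}"
      using cong_minus_minus_iff[of c "- fst l" "int N"] by simp
    show "(-1) ^ k * lattice_row k N (snd l) \<tau> (- c) = lattice_row k N (snd (- 1 * fst l, - 1 * snd l)) \<tau> c"
      unfolding lattice_row_uminus by (simp add: mult.assoc[symmetric] power_mult_distrib[symmetric])
  next
    fix c assume "c \<in> {c. [c = fst l] (mod int N)}"
    then show "- c \<in> {c. [c = fst (- 1 * fst l, - 1 * snd l)] (mod int N)}" by (simp add: cong_minus_minus_iff)
  qed simp_all
  then show ?thesis unfolding G_hol_def by (simp only: infsum_cmult_right')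
qed

lemma H_value_cong: "[a = b] (mod int N) \<Longrightarrow> H_value k N a = H_value k N b"
  unfolding H_value_def by (simp only: cong_class_eq)

text \<open>
  Moebius inversion for \<open>d\<^sup>-\<^sup>k\<close> on the line \<open>c = 0\<close>: the coprime pairs \<open>(0, d)\<close> are \<open>(0, 1)\<close> and
  \<open>(0, - 1)\<close>.
\<close>

lemma H_value_moebius_relation:
  assumes k: "k \<ge> 2" and N: "N \<ge> 1" and t: "coprime t (int N)"
  shows "(\<Sum>r\<in>unit_residues N. moebius_series N r (of_nat k) * H_value k N (inv_mod N r * t)) =
    (if [t = 1] (mod int N) then 1 else 0) + (if [t = - 1] (mod int N) then (-1) ^ k else 0)"
proof -
  define u where "u p = (if fst p = 0 then 1 / complex_of_int (snd p) ^ k else 0)" for p :: "int \<times> int"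
  have k0: "k > 0" using k by simp
  have Hu: "(\<Sum>\<^sub>\<infinity>p\<in>res_class N (0, b). u p) = H_value k N b" for b
  proof -
    have "(\<Sum>\<^sub>\<infinity>p\<in>res_class N (0, b). u p) = (\<Sum>\<^sub>\<infinity>p\<in>{0} \<times> {d. [d = b] (mod int N)}. u p)"
      by (rule infsum_cong_neutral) (auto simp: res_class_def u_def cong_def)
    also have "\<dots> = H_value k N b" unfolding H_value_def
      by (rule infsum_reindex_bij_witness[where i = "\<lambda>d. (0, d)" and j = snd]) (auto simp: u_def)
    finally show ?thesis .
  qed
  have M: "(\<Sum>\<^sub>\<infinity>p\<in>{p \<in> res_class N (0, t). gcd (fst p) (snd p) = 1}. u p) =
    (\<Sum>r\<in>unit_residues N. moebius_series N r (of_nat k) * (\<Sum>\<^sub>\<infinity>p\<in>res_class N (scale_pair (inv_mod N r) (0, t)). u p))"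
  proof (rule moebius_inversion_lattice[OF N])
    show "gcd (gcd (fst (0, t)) (snd (0, t))) (int N) = 1" using t by (simp add: coprime_iff_gcd_eq_1)
    show "Re (of_nat k) > 1" using k by simp
    show "u (scale_pair (int n) p) = of_nat n powr - of_nat k * u p" if "n \<ge> 1" for n p
    proof -
      have "complex_of_nat n powr - of_nat k = inverse (of_nat n ^ k)"
        using that by (simp add: powr_minus powr_nat)
      then show ?thesis using that by (simp add: u_def scale_pair_def power_mult_distrib divide_inverse)
    qed
    show "u (0, 0) = 0" using k0 by (simp add: u_def)
    have "(\<lambda>d::int. norm (1 / (0 + complex_of_int d) ^ k)) summable_on UNIV"
      by (rule summable_on_int_shift_power[OF k])
    then have "((\<lambda>p. norm (u p)) \<circ> (\<lambda>d. (0, d))) summable_on UNIV" by (simp add: o_def u_def)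
    then have "(\<lambda>p. norm (u p)) summable_on range (\<lambda>d. (0, d))"
      by (subst summable_on_reindex) (auto simp: inj_on_def)
    then show "(\<lambda>p. norm (u p)) summable_on UNIV"
      by (rule summable_on_cong_neutral[THEN iffD1, rotated -1]) (auto simp: u_def)
  qed
  have "(\<Sum>\<^sub>\<infinity>p\<in>{p \<in> res_class N (0, t). gcd (fst p) (snd p) = 1}. u p) =
     (\<Sum>\<^sub>\<infinity>p\<in>{p. (p = (0, 1) \<and> [t = 1] (mod int N)) \<or> (p = (0, -1) \<and> [t = -1] (mod int N))}. u p)"
    by (rule infsum_cong_neutral) (auto simp: res_class_def u_def cong_sym_eq abs_if split: if_splits)
  also have "{p. (p = (0::int, 1::int) \<and> [t = 1] (mod int N)) \<or> (p = (0, -1) \<and> [t = -1] (mod int N))} =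
      (if [t = 1] (mod int N) then {(0, 1)} else {}) \<union> (if [t = -1] (mod int N) then {(0, -1)} else {})" by auto
  also have "(\<Sum>\<^sub>\<infinity>p\<in>\<dots>. u p) = (if [t = 1] (mod int N) then 1 else 0) + (if [t = - 1] (mod int N) then (-1) ^ k else 0)"
  proof -
    have "1 / (-1) ^ k = ((-1) ^ k :: complex)" by (cases "even k") auto
    then show ?thesis by (auto simp: u_def)
  qed
  finally show ?thesis unfolding M scale_pair_def by (simp add: Hu)
qed

lemma finite_unit_residues: "finite (unit_residues N)"
  by (rule finite_subset[of _ "{0..<int N}"]) (auto simp: unit_residues_def)

lemma unit_residue_mod: "N \<ge> 1 \<Longrightarrow> coprime r (int N) \<Longrightarrow> r mod int N \<in> unit_residues N"
  by (simp add: unit_residues_def)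

lemma cong_inverse_unique:
  assumes "[x * a = 1] (mod int N)" "[x * b = 1] (mod int N)"
  shows "[a = b] (mod int N)"
proof -
  have "[a * (x * b) = a * 1] (mod int N)" by (rule cong_mult[OF cong_refl assms(2)])
  moreover have "[(x * a) * b = 1 * b] (mod int N)" by (rule cong_mult[OF assms(1) cong_refl])
  moreover have "a * (x * b) = (x * a) * b" by simp
  ultimately show ?thesis by (metis cong_sym cong_trans mult_1 mult_1_right)
qed

lemma coprime_inv_mod:
  assumes "coprime r (int N)"
  shows "coprime (inv_mod N r) (int N)"
proof -
  have "[inv_mod N r * r = 1] (mod int N)" using inv_mod[OF assms] by (simp add: mult.commute)
  then show ?thesis using coprime_iff_invertible_int by blast
qed

lemma sum_unit_residues_mult:
  assumes N: "N \<ge> 1" and u: "coprime u (int N)"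
  shows "(\<Sum>t\<in>unit_residues N. F t) = (\<Sum>v\<in>unit_residues N. F ((u * v) mod int N))"
proof (rule sum.reindex_bij_witness[where j = "\<lambda>t. (inv_mod N u * t) mod int N" and i = "\<lambda>v. (u * v) mod int N"])
  have cu: "coprime (inv_mod N u) (int N)" by (rule coprime_inv_mod[OF u])
  have uu: "[u * inv_mod N u = 1] (mod int N)" by (rule inv_mod[OF u])
  fix t assume t: "t \<in> unit_residues N"
  then have tc: "coprime t (int N)" and tm: "t mod int N = t" by (auto simp: unit_residues_def)
  show "(inv_mod N u * t) mod int N \<in> unit_residues N"
    by (rule unit_residue_mod[OF N]) (use cu tc in simp)
  show "(u * t) mod int N \<in> unit_residues N"
    by (rule unit_residue_mod[OF N]) (use u tc in simp)
  have 1: "[(u * inv_mod N u) * t = 1 * t] (mod int N)" by (rule cong_mult[OF uu cong_refl])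
  have "(u * (inv_mod N u * t mod int N)) mod int N = ((u * inv_mod N u) * t) mod int N"
    by (simp add: mod_mult_right_eq mult.assoc)
  then show e: "(u * (inv_mod N u * t mod int N)) mod int N = t" using 1 tm by (simp add: cong_def)
  have "(inv_mod N u * (u * t mod int N)) mod int N = ((u * inv_mod N u) * t) mod int N"
    by (simp add: mod_mult_right_eq mult_ac)
  then show "(inv_mod N u * (u * t mod int N)) mod int N = t" using 1 tm by (simp add: cong_def)
  show "F ((u * (inv_mod N u * t mod int N)) mod int N) = F t" unfolding e ..
qed

text \<open>
  Read functions on the units modulo \<open>N\<close> as elements of the group ring. Then \<open>M H = \<delta>\<^sub>1 + \<epsilon> \<delta>\<^sub>-\<^sub>1\<close>, and
  multiplication by this element doubles every \<open>g\<close> of parity \<open>\<epsilon>\<close>. So \<open>2 D g = D (M H) g = (D H) M g = 0\<close>.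
  In other words, convolution with \<open>H\<close> is invertible on functions of parity \<open>\<epsilon>\<close>, its inverse being
  half of the convolution with \<open>M\<close>; in terms of characters this is the nonvanishing of \<open>L\<close>-values.
\<close>

lemma convolution_cancel:
  fixes M D H g :: "int \<Rightarrow> complex" and \<epsilon> :: complex
  assumes N: "N \<ge> 1" and \<epsilon>: "\<epsilon> * \<epsilon> = 1"
    and Hc: "\<And>a b. [a = b] (mod int N) \<Longrightarrow> H a = H b" and gc: "\<And>a b. [a = b] (mod int N) \<Longrightarrow> g a = g b"
    and par: "\<And>x. g (- x) = \<epsilon> * g x"
    and MH: "\<And>t. t \<in> unit_residues N \<Longrightarrow> (\<Sum>r\<in>unit_residues N. M r * H (inv_mod N r * t)) =
      (if [t = 1] (mod int N) then 1 else 0) + (if [t = - 1] (mod int N) then \<epsilon> else 0)"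
    and DH: "\<And>t. t \<in> unit_residues N \<Longrightarrow> (\<Sum>r\<in>unit_residues N. D r * H (inv_mod N r * t)) = 0"
  shows "(\<Sum>r\<in>unit_residues N. D r * g (inv_mod N r)) = 0"
proof -
  let ?U = "unit_residues N" and ?i = "inv_mod N"
  define \<delta> where "\<delta> t = (if [t = 1] (mod int N) then 1 else 0) + (if [t = - 1] (mod int N) then \<epsilon> else 0)" for t :: int
  have U: "coprime t (int N)" if "t \<in> ?U" for t using that by (simp add: unit_residues_def)
  have uniq: "(\<Sum>t\<in>?U. (if [t = a] (mod int N) then f t else 0)) = f (a mod int N)"
    if "coprime a (int N)" for a and f :: "int \<Rightarrow> complex"
  proof -
    have "(if [t = a] (mod int N) then f t else 0) = (if t = a mod int N then f t else 0)" if "t \<in> ?U" for t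
      using that by (auto simp: unit_residues_def cong_def)
    then have "(\<Sum>t\<in>?U. (if [t = a] (mod int N) then f t else 0)) = (\<Sum>t\<in>?U. (if t = a mod int N then f t else 0))"
      by (intro sum.cong) auto
    also have "\<dots> = f (a mod int N)"
      using unit_residue_mod[OF N that] finite_unit_residues by simp
    finally show ?thesis .
  qed
  \<comment> \<open>For \<open>N \<le> 2\<close> the units \<open>1\<close> and \<open>- 1\<close> coincide, and both terms of \<open>\<delta>\<close> fall on the same \<open>t\<close>.\<close>
  have two: "2 * g x = (\<Sum>t\<in>?U. \<delta> t * g (?i t * x))" for x
  proof -
    have "(\<Sum>t\<in>?U. \<delta> t * g (?i t * x)) =
      (\<Sum>t\<in>?U. (if [t = 1] (mod int N) then g (?i t * x) else 0)) + (\<Sum>t\<in>?U. (if [t = -1] (mod int N) then \<epsilon> * g (?i t * x) else 0))"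
      unfolding sum.distrib[symmetric] by (rule sum.cong) (auto simp: \<delta>_def algebra_simps)
    also have "\<dots> = g (?i (1 mod int N) * x) + \<epsilon> * g (?i (-1 mod int N) * x)"
      by (subst (1 2) uniq) auto
    also have "g (?i (1 mod int N) * x) = g x"
    proof (rule gc)
      have c: "coprime (1 mod int N) (int N)" using unit_residue_mod[OF N, of 1] U by auto
      have "[(1 mod int N) * 1 = 1] (mod int N)" by (simp add: cong_def)
      from cong_inverse_unique[OF inv_mod[OF c] this] have "[?i (1 mod int N) * x = 1 * x] (mod int N)"
        by (intro cong_mult cong_refl)
      then show "[?i (1 mod int N) * x = x] (mod int N)" by simp
    qed
    also have "g (?i (-1 mod int N) * x) = g (- x)"
    proof (rule gc)
      have c: "coprime (-1 mod int N) (int N)" using unit_residue_mod[OF N, of "-1"] U by auto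
      have "[(-1 mod int N) * -1 = -1 * -1] (mod int N)" by (intro cong_mult) (simp_all add: cong_def)
      then have "[(-1 mod int N) * -1 = 1] (mod int N)" by simp
      from cong_inverse_unique[OF inv_mod[OF c] this] have "[?i (-1 mod int N) * x = -1 * x] (mod int N)"
        by (intro cong_mult cong_refl)
      then show "[?i (-1 mod int N) * x = - x] (mod int N)" by simp
    qed
    also have "g x + \<epsilon> * g (- x) = 2 * g x" unfolding par using \<epsilon> by (simp add: mult.assoc[symmetric])
    finally show ?thesis ..
  qed
  \<comment> \<open>Commutativity of the convolution, by the substitution \<open>t = s r\<^sup>-\<^sup>1 v\<close>.\<close>
  have inner: "(\<Sum>t\<in>?U. H (?i s * t) * g (?i t * ?i r)) = (\<Sum>v\<in>?U. H (?i r * v) * g (?i v * ?i s))"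
    if s: "s \<in> ?U" and r: "r \<in> ?U" for s r
  proof -
    let ?u = "s * ?i r"
    have cu: "coprime ?u (int N)" using U[OF s] coprime_inv_mod[OF U[OF r]] by simp
    have ii: "[s * ?i s = 1] (mod int N)" "[r * ?i r = 1] (mod int N)" using inv_mod U s r by auto
    have "(\<Sum>t\<in>?U. H (?i s * t) * g (?i t * ?i r)) =
        (\<Sum>v\<in>?U. H (?i s * ((?u * v) mod int N)) * g (?i ((?u * v) mod int N) * ?i r))"
      by (rule sum_unit_residues_mult[OF N cu])
    also have "\<dots> = (\<Sum>v\<in>?U. H (?i r * v) * g (?i v * ?i s))"
    proof (rule sum.cong[OF refl])
      fix v assume v: "v \<in> ?U"
      define t where "t = (?u * v) mod int N"
      have tu: "[t = ?u * v] (mod int N)" by (simp add: t_def cong_def)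
      have tc: "coprime t (int N)"
      proof -
        have "coprime (?u * v) (int N)" using cu U[OF v] by simp
        from U[OF unit_residue_mod[OF N this]] show ?thesis by (simp only: t_def)
      qed
      have "[?i s * t = ?i s * (?u * v)] (mod int N)" by (rule cong_mult[OF cong_refl tu])
      moreover have "[(s * ?i s) * (?i r * v) = 1 * (?i r * v)] (mod int N)" by (rule cong_mult[OF ii(1) cong_refl])
      moreover have "?i s * (?u * v) = (s * ?i s) * (?i r * v)" by simp
      ultimately have h: "[?i s * t = ?i r * v] (mod int N)" by (metis cong_trans mult_1)
      have "[(s * v) * (?i t * ?i r) = 1] (mod int N)"
      proof -
        have "[t * ?i t = 1] (mod int N)" by (rule inv_mod[OF tc])
        moreover have "[t * ?i t = ?u * v * ?i t] (mod int N)" by (rule cong_mult[OF tu cong_refl])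
        ultimately have "[?u * v * ?i t = 1] (mod int N)" by (metis cong_sym cong_trans)
        moreover have "?u * v * ?i t = (s * v) * (?i t * ?i r)" by simp
        ultimately show ?thesis by simp
      qed
      moreover have "[(s * v) * (?i v * ?i s) = 1] (mod int N)"
      proof -
        have "[(s * ?i s) * (v * ?i v) = 1 * 1] (mod int N)" by (rule cong_mult[OF ii(1) inv_mod[OF U[OF v]]])
        moreover have "(s * ?i s) * (v * ?i v) = (s * v) * (?i v * ?i s)" by simp
        ultimately show ?thesis by simp
      qed
      ultimately have "[?i t * ?i r = ?i v * ?i s] (mod int N)" by (rule cong_inverse_unique)
      then show "H (?i s * ((?u * v) mod int N)) * g (?i ((?u * v) mod int N) * ?i r) = H (?i r * v) * g (?i v * ?i s)"
        unfolding t_def[symmetric] using Hc[OF h] gc by metis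
    qed
    finally show ?thesis .
  qed
  have "2 * (\<Sum>r\<in>?U. D r * g (?i r)) = (\<Sum>r\<in>?U. D r * (\<Sum>t\<in>?U. \<delta> t * g (?i t * ?i r)))"
    by (simp only: sum_distrib_left two[symmetric] mult.left_commute)
  also have "\<dots> = (\<Sum>r\<in>?U. D r * (\<Sum>t\<in>?U. (\<Sum>s\<in>?U. M s * H (?i s * t)) * g (?i t * ?i r)))"
    by (intro sum.cong refl arg_cong2[where f = times]) (simp add: MH \<delta>_def)
  also have "\<dots> = (\<Sum>r\<in>?U. \<Sum>t\<in>?U. \<Sum>s\<in>?U. D r * M s * (H (?i s * t) * g (?i t * ?i r)))"
    by (simp only: sum_distrib_left sum_distrib_right mult.assoc)
  also have "\<dots> = (\<Sum>r\<in>?U. \<Sum>s\<in>?U. \<Sum>t\<in>?U. D r * M s * (H (?i s * t) * g (?i t * ?i r)))"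
    by (intro sum.cong refl sum.swap)
  also have "\<dots> = (\<Sum>r\<in>?U. \<Sum>s\<in>?U. D r * M s * (\<Sum>v\<in>?U. H (?i r * v) * g (?i v * ?i s)))"
    by (intro sum.cong refl) (simp only: sum_distrib_left[symmetric] inner)
  also have "\<dots> = (\<Sum>s\<in>?U. \<Sum>r\<in>?U. D r * M s * (\<Sum>v\<in>?U. H (?i r * v) * g (?i v * ?i s)))"
    by (rule sum.swap)
  also have "\<dots> = (\<Sum>s\<in>?U. M s * (\<Sum>v\<in>?U. (\<Sum>r\<in>?U. D r * H (?i r * v)) * g (?i v * ?i s)))"
  proof (rule sum.cong[OF refl])
    fix s
    have "(\<Sum>r\<in>?U. D r * M s * (\<Sum>v\<in>?U. H (?i r * v) * g (?i v * ?i s))) =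
        (\<Sum>r\<in>?U. \<Sum>v\<in>?U. M s * (D r * H (?i r * v) * g (?i v * ?i s)))"
      by (simp only: sum_distrib_left mult_ac)
    also have "\<dots> = (\<Sum>v\<in>?U. \<Sum>r\<in>?U. M s * (D r * H (?i r * v) * g (?i v * ?i s)))" by (rule sum.swap)
    finally show "(\<Sum>r\<in>?U. D r * M s * (\<Sum>v\<in>?U. H (?i r * v) * g (?i v * ?i s))) =
       M s * (\<Sum>v\<in>?U. (\<Sum>r\<in>?U. D r * H (?i r * v)) * g (?i v * ?i s))"
      by (simp only: sum_distrib_left sum_distrib_right)
  qed
  also have "\<dots> = 0" by (intro sum.neutral ballI) (simp add: DH)
  finally show ?thesis by simp
qed

lemma scale_pair_scale_pair: "scale_pair a (scale_pair b l) = scale_pair (a * b) l"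
  by (simp add: scale_pair_def mult.assoc)

lemma primitive_mod_scale:
  assumes "primitive_mod N l" "coprime t (int N)"
  shows "primitive_mod N (scale_pair t l)"
proof -
  have "gcd (fst (scale_pair t l)) (snd (scale_pair t l)) = \<bar>t\<bar> * gcd (fst l) (snd l)"
    by (simp add: scale_pair_def gcd_mult_distrib_int)
  moreover have "coprime (\<bar>t\<bar> * gcd (fst l) (snd l)) (int N)"
    using assms unfolding primitive_mod_def coprime_iff_gcd_eq_1[symmetric] by simp
  ultimately show ?thesis unfolding primitive_mod_def coprime_iff_gcd_eq_1[symmetric] by simp
qed

text \<open>
  The relation between \<open>H_value\<close> and \<open>moebius_series\<close> is a linear system over \<open>K\<close> for the numbers
  \<open>(2 \<pi> \<i>)\<^sup>k M\<^sub>r\<close>. Let \<open>y\<close> be a solution in \<open>K\<close>. The difference of the two solutions annihilates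
  \<open>H_value\<close>, hence every function of the same parity, in particular the values of \<open>G_hol\<close>.
\<close>

lemma (in complex_subfield) rational_moebius_coefficients:
  assumes k: "k \<ge> 2" and N: "N \<ge> 1" and z: "exp (2 * of_real pi * \<i> / of_nat N) \<in> K"
  obtains y where "\<And>r. r \<in> unit_residues N \<Longrightarrow> y r \<in> K"
    "\<And>l \<tau>. (\<Sum>r\<in>unit_residues N. moebius_series N r (of_nat k) * G_hol k N (scale_pair (inv_mod N r) l) \<tau>) =
      (\<Sum>r\<in>unit_residues N. y r * (G_hol k N (scale_pair (inv_mod N r) l) \<tau> / (2 * of_real pi * \<i>) ^ k))"
proof -
  let ?U = "unit_residues N" and ?i = "inv_mod N" and ?P = "(2 * of_real pi * \<i>) ^ k :: complex"
  let ?M = "\<lambda>r. moebius_series N r (of_nat k)"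
  define \<delta> where "\<delta> t = (if [t = 1] (mod int N) then 1 else 0) + (if [t = - 1] (mod int N) then (-1) ^ k else 0 :: complex)" for t :: int
  have P0: "?P \<noteq> 0" by simp
  have U: "coprime t (int N)" if "t \<in> ?U" for t using that by (simp add: unit_residues_def)
  have rel: "(\<Sum>r\<in>?U. ?M r * H_value k N (?i r * t)) = \<delta> t" if "t \<in> ?U" for t
    unfolding \<delta>_def by (rule H_value_moebius_relation[OF k N U[OF that]])
  have "\<exists>y. (\<forall>r\<in>?U. y r \<in> K) \<and> (\<forall>t\<in>?U. (\<Sum>r\<in>?U. (H_value k N (?i r * t) / ?P) * y r) = \<delta> t)"
  proof (rule linear_system_solvable[OF finite_unit_residues, where x = "\<lambda>r. ?P * ?M r"])
    show "H_value k N (?i r * t) / ?P \<in> K" if "t \<in> ?U" "r \<in> ?U" for t r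
      by (rule H_value_mem[OF k N _ z]) (use that U coprime_inv_mod in simp)
    show "\<delta> t \<in> K" for t unfolding \<delta>_def by (auto intro!: mem_intros)
    show "(\<Sum>r\<in>?U. (H_value k N (?i r * t) / ?P) * (?P * ?M r)) = \<delta> t" if "t \<in> ?U" for t
      unfolding rel[OF that, symmetric] by (rule sum.cong) simp_all
  qed
  then obtain y where y: "\<And>r. r \<in> ?U \<Longrightarrow> y r \<in> K"
    "\<And>t. t \<in> ?U \<Longrightarrow> (\<Sum>r\<in>?U. (H_value k N (?i r * t) / ?P) * y r) = \<delta> t" by blast
  have "(\<Sum>r\<in>?U. ?M r * G_hol k N (scale_pair (?i r) l) \<tau>) = (\<Sum>r\<in>?U. y r * (G_hol k N (scale_pair (?i r) l) \<tau> / ?P))" for l \<tau>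
  proof -
    have "(\<Sum>r\<in>?U. (?M r - y r / ?P) * G_hol k N (scale_pair (?i r) l) \<tau>) = 0"
    proof (rule convolution_cancel[OF N, where g = "\<lambda>t. G_hol k N (scale_pair t l) \<tau>" and H = "H_value k N"
          and M = ?M and \<epsilon> = "(-1) ^ k"])
      show "(-1) ^ k * (-1) ^ k = (1 :: complex)" by (simp add: power_mult_distrib[symmetric])
      show "H_value k N a = H_value k N b" if "[a = b] (mod int N)" for a b by (rule H_value_cong[OF that])
      show "G_hol k N (scale_pair a l) \<tau> = G_hol k N (scale_pair b l) \<tau>" if "[a = b] (mod int N)" for a b
        by (rule G_hol_cong) (auto simp: scale_pair_def intro: cong_mult[OF that cong_refl])
      show "G_hol k N (scale_pair (- x) l) \<tau> = (-1) ^ k * G_hol k N (scale_pair x l) \<tau>" for x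
        using G_hol_uminus[of k N "scale_pair x l" \<tau>] by (simp add: scale_pair_scale_pair)
      show "(\<Sum>r\<in>?U. ?M r * H_value k N (?i r * t)) =
          (if [t = 1] (mod int N) then 1 else 0) + (if [t = - 1] (mod int N) then (-1) ^ k else 0)" if "t \<in> ?U" for t
        using rel[OF that] by (simp only: \<delta>_def)
      show "(\<Sum>r\<in>?U. (?M r - y r / ?P) * H_value k N (?i r * t)) = 0" if "t \<in> ?U" for t
      proof -
        have "(\<Sum>r\<in>?U. (?M r - y r / ?P) * H_value k N (?i r * t)) =
           (\<Sum>r\<in>?U. ?M r * H_value k N (?i r * t)) - (\<Sum>r\<in>?U. (H_value k N (?i r * t) / ?P) * y r)"
          unfolding sum_subtractf[symmetric] by (rule sum.cong) (simp_all add: algebra_simps)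
        then show ?thesis using rel[OF that] y(2)[OF that] by simp
      qed
    qed
    moreover have "(\<Sum>r\<in>?U. (?M r - y r / ?P) * G_hol k N (scale_pair (?i r) l) \<tau>) =
        (\<Sum>r\<in>?U. ?M r * G_hol k N (scale_pair (?i r) l) \<tau>) - (\<Sum>r\<in>?U. y r * (G_hol k N (scale_pair (?i r) l) \<tau> / ?P))"
      unfolding sum_subtractf[symmetric] by (rule sum.cong) (simp_all add: algebra_simps)
    ultimately show ?thesis by simp
  qed
  with y(1) show thesis using that by blast
qed

text \<open>
  The correction \<open>\<pi> / (N\<^sup>2 Im \<tau>)\<close> in weight \<open>2\<close> is the same for all residue classes, and so is its sum
  against the coefficients \<open>M\<^sub>r\<close>; therefore \<open>C\<close> can be chosen before \<open>l\<close>.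
\<close>

lemma (in complex_subfield) Eis_expansion:
  assumes k: "k \<ge> 2" and N: "N \<ge> 1" and z: "exp (2 * of_real pi * \<i> / of_nat N) \<in> K"
  obtains C where "\<And>l. primitive_mod N l \<Longrightarrow> \<exists>e. (\<forall>j. e j \<in> K) \<and> (\<forall>\<tau>. Im \<tau> > 0 \<longrightarrow>
     (\<lambda>j. e j * qexp N \<tau> j) sums (Eis k N l \<tau> + (if k = 2 then C / of_real (Im \<tau>) else 0)))"
proof -
  let ?U = "unit_residues N" and ?i = "inv_mod N" and ?P = "(2 * of_real pi * \<i>) ^ k :: complex"
  let ?M = "\<lambda>r. moebius_series N r (of_nat k)"
  obtain y where y: "\<And>r. r \<in> ?U \<Longrightarrow> y r \<in> K"
    "\<And>l \<tau>. (\<Sum>r\<in>?U. ?M r * G_hol k N (scale_pair (?i r) l) \<tau>) =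
      (\<Sum>r\<in>?U. y r * (G_hol k N (scale_pair (?i r) l) \<tau> / ?P))"
    using rational_moebius_coefficients[OF k N z] by blast
  define C where "C = eps_level N * (\<Sum>r\<in>?U. ?M r) * of_real (pi / real N ^ 2)"
  have eps: "eps_level N \<in> K" by (auto simp: eps_level_def intro!: mem_intros)
  show thesis
  proof (rule that[of C])
    fix l assume l: "primitive_mod N l"
    define e where "e j = eps_level N * (\<Sum>r\<in>?U. y r * G_coeff k N (scale_pair (?i r) l) j)" for j
    have "e j \<in> K" for j
      unfolding e_def
      by (intro mult_mem sum_mem eps y(1) G_coeff_mem[OF k N _ z] primitive_mod_scale[OF l] coprime_inv_mod)
         (auto simp: unit_residues_def)
    moreover have "(\<lambda>j. e j * qexp N \<tau> j) sums (Eis k N l \<tau> + (if k = 2 then C / of_real (Im \<tau>) else 0))"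
      if \<tau>: "Im \<tau> > 0" for \<tau>
    proof -
      let ?c = "if k = 2 then of_real (pi / (real N ^ 2 * Im \<tau>)) else 0 :: complex"
      have "(\<lambda>j. eps_level N * (\<Sum>r\<in>?U. y r * (G_coeff k N (scale_pair (?i r) l) j * qexp N \<tau> j))) sums
          (eps_level N * (\<Sum>r\<in>?U. y r * (G_hol k N (scale_pair (?i r) l) \<tau> / ?P)))"
        by (intro sums_mult sums_sum G_hol_sums k N \<tau>)
      moreover have "(\<lambda>j. eps_level N * (\<Sum>r\<in>?U. y r * (G_coeff k N (scale_pair (?i r) l) j * qexp N \<tau> j))) = (\<lambda>j. e j * qexp N \<tau> j)"
        by (simp add: e_def sum_distrib_right sum_distrib_left mult_ac)
      moreover have "eps_level N * (\<Sum>r\<in>?U. y r * (G_hol k N (scale_pair (?i r) l) \<tau> / ?P)) =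
          Eis k N l \<tau> + (if k = 2 then C / of_real (Im \<tau>) else 0)"
      proof -
        have "Eis k N l \<tau> = eps_level N * (\<Sum>r\<in>?U. ?M r * (G_hol k N (scale_pair (?i r) l) \<tau> - ?c))"
          by (simp only: Eis_eq_moebius_sum[OF \<tau> k N l] G_value_eq_G_hol[OF k N \<tau>])
        also have "\<dots> = eps_level N * ((\<Sum>r\<in>?U. ?M r * G_hol k N (scale_pair (?i r) l) \<tau>) - (\<Sum>r\<in>?U. ?M r) * ?c)"
          by (simp only: right_diff_distrib sum_subtractf sum_distrib_right)
        also have "\<dots> = eps_level N * (\<Sum>r\<in>?U. y r * (G_hol k N (scale_pair (?i r) l) \<tau> / ?P)) - eps_level N * (\<Sum>r\<in>?U. ?M r) * ?c"
          unfolding y(2) by (simp only: right_diff_distrib mult.assoc)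
        also have "eps_level N * (\<Sum>r\<in>?U. ?M r) * ?c = (if k = 2 then C / of_real (Im \<tau>) else 0)"
          by (simp add: C_def)
        finally show ?thesis by simp
      qed
      ultimately show ?thesis by simp
    qed
    ultimately show "\<exists>e. (\<forall>j. e j \<in> K) \<and> (\<forall>\<tau>. Im \<tau> > 0 \<longrightarrow>
       (\<lambda>j. e j * qexp N \<tau> j) sums (Eis k N l \<tau> + (if k = 2 then C / of_real (Im \<tau>) else 0)))"
      by (intro exI[of _ e]) auto
  qed
qed

section \<open>Linear combinations of Eisenstein series\<close>

lemma DirProd_nat_pow:
  "l [^]\<^bsub>G \<times>\<times> H\<^esub> (n::nat) = (fst l [^]\<^bsub>G\<^esub> n, snd l [^]\<^bsub>H\<^esub> n)"
  by (induction n) (auto simp: DirProd_def nat_pow_def case_prod_unfold)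

text \<open>
  If \<open>g\<close> divides both coordinates and \<open>N = g m\<close>, then \<open>m\<close> annihilates the class, so the order divides
  \<open>m\<close>.
\<close>

lemma Lambda_primitive:
  assumes N: "N \<ge> 1" and l: "l \<in> Lambda N"
  shows "primitive_mod N l"
proof -
  let ?Z = "integer_mod_group N"
  let ?Q = "?Z \<times>\<times> ?Z"
  interpret Q: group ?Q by (intro DirProd_group group_integer_mod_group)
  have lQ: "l \<in> carrier ?Q" and ord: "Q.ord l = N" using l by (auto simp: Lambda_def Let_def)
  have lc: "fst l \<in> carrier ?Z" "snd l \<in> carrier ?Z" using lQ by (auto simp: DirProd_def)
  define g where "g = nat (gcd (gcd (fst l) (snd l)) (int N))"
  have g: "int g = gcd (gcd (fst l) (snd l)) (int N)" by (simp add: g_def)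
  have g0: "g > 0" using g N by (metis gcd_eq_0_iff gr0I of_nat_0 of_nat_eq_0_iff not_one_le_zero)
  have gN: "g dvd N" using g by (metis gcd_dvd2 int_dvd_int_iff)
  then obtain m where m: "N = g * m" by (elim dvdE)
  have gl: "int g dvd fst l" "int g dvd snd l" unfolding g by (meson dvd_trans gcd_dvd1 gcd_dvd2)+
  have z: "int m * a mod int N = 0" if "int g dvd a" for a
    using that unfolding m by (auto elim!: dvdE simp: mult_ac)
  have "l [^]\<^bsub>?Q\<^esub> m = \<one>\<^bsub>?Q\<^esub>"
    unfolding DirProd_nat_pow by (simp add: z[OF gl(1)] z[OF gl(2)])
  then have "N dvd m" using Q.pow_eq_id[OF lQ] ord by simp
  then have "g = 1" using m N by (metis dvd_imp_mod_0 mod_mult_self1_is_0 mult_eq_self_implies_10 nat_dvd_not_less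
      dvd_antisym dvd_triv_right mult.commute mult_cancel_right1 not_one_le_zero)
  then show ?thesis unfolding primitive_mod_def g[symmetric] by simp
qed

lemma finite_Lambda: "N \<ge> 1 \<Longrightarrow> finite (Lambda N)"
  by (rule finite_subset[of _ "{0..<int N} \<times> {0..<int N}"])
     (auto simp: Lambda_def Let_def DirProd_def carrier_integer_mod_group)

lemma qexp_series_holomorphic:
  assumes N: "N \<ge> 1" and s: "\<And>\<tau>. Im \<tau> > 0 \<Longrightarrow> (\<lambda>j. e j * qexp N \<tau> j) sums h \<tau>"
  shows "h holomorphic_on {\<tau>. Im \<tau> > 0}"
proof -
  let ?q = "\<lambda>\<tau>. exp (2 * of_real pi * \<i> * \<tau> / of_nat N)"
  have N0: "complex_of_nat N \<noteq> 0" using N by simp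
  have pw: "qexp N \<tau> j = ?q \<tau> ^ j" for \<tau> j
  proof -
    have "2 * of_real pi * \<i> * of_nat j * \<tau> / of_nat N = of_nat j * (2 * of_real pi * \<i> * \<tau> / of_nat N)" by simp
    then show ?thesis unfolding qexp_def by (simp only: exp_of_nat_mult)
  qed
  have nq: "norm (?q \<tau>) < 1" if "Im \<tau> > 0" for \<tau>
    using that N by (simp add: divide_neg_pos)
  define F where "F q = (\<Sum>j. e j * q ^ j)" for q
  have "(\<lambda>j. e j * (q - 0) ^ j) sums F q" if q: "q \<in> ball 0 1" for q
  proof (cases "q = 0")
    case True
    have "summable (\<lambda>j. e j * 0 ^ j)" by (rule summable_finite[of "{0}"]) auto
    then show ?thesis unfolding F_def using True by (auto intro: summable_sums)
  next
    case False
    \<comment> \<open>Every \<open>q \<noteq> 0\<close> in the unit disc comes from a point of the upper half plane, so the power series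
    converges in the whole disc.\<close>
    define \<tau> where "\<tau> = of_nat N * Ln q / (2 * of_real pi * \<i>)"
    have "2 * of_real pi * \<i> * \<tau> / of_nat N = Ln q" using N0 by (simp add: \<tau>_def)
    then have q\<tau>: "?q \<tau> = q" using False by simp
    have "Im \<tau> > 0"
    proof (rule ccontr)
      assume "\<not> ?thesis"
      then have "1 \<le> norm (?q \<tau>)" using N by (simp add: divide_nonpos_pos mult_nonneg_nonpos not_less)
      then show False using q q\<tau> by simp
    qed
    from sums_summable[OF s[OF this]] have "summable (\<lambda>j. e j * q ^ j)" unfolding pw q\<tau> .
    then show ?thesis unfolding F_def by (simp add: summable_sums)
  qed
  then have F: "F holomorphic_on ball 0 1" by (rule power_series_holomorphic)
  have "(\<lambda>\<tau>. F (?q \<tau>)) holomorphic_on {\<tau>. Im \<tau> > 0}"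
  proof (rule holomorphic_on_compose_gen[OF _ F, unfolded o_def])
    show "?q holomorphic_on {\<tau>. Im \<tau> > 0}" by (intro holomorphic_intros) (use N0 in auto)
    show "?q ` {\<tau>. Im \<tau> > 0} \<subseteq> ball 0 1" using nq by auto
  qed
  moreover have "F (?q \<tau>) = h \<tau>" if "Im \<tau> > 0" for \<tau>
    using s[OF that] unfolding F_def pw by (simp add: sums_iff)
  ultimately show ?thesis by (auto intro: holomorphic_transform)
qed

text \<open>
  A complex derivative at \<open>\<i>\<close> would vanish in the horizontal direction and equal \<open>- A\<close> in the vertical one.
\<close>

lemma inverse_Im_not_holomorphic:
  assumes "(\<lambda>\<tau>. A / of_real (Im \<tau>)) holomorphic_on {\<tau>. Im \<tau> > 0}"
  shows "A = 0"
proof -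
  let ?f = "\<lambda>\<tau>. A / of_real (Im \<tau>)"
  have o: "open {\<tau>::complex. Im \<tau> > 0}" by (rule open_halfspace_Im_gt)
  have "?f field_differentiable (at \<i>)"
    by (rule holomorphic_on_imp_differentiable_at[OF assms o]) simp
  then obtain D where D: "(?f has_field_derivative D) (at \<i>)" by (auto simp: field_differentiable_def)
  have 1: "((\<lambda>t::real. \<i> + of_real t) has_vector_derivative 1) (at 0)"
    "((\<lambda>t::real. \<i> + of_real t * \<i>) has_vector_derivative \<i>) (at 0)"
    by (auto intro!: derivative_eq_intros simp: has_vector_derivative_def scaleR_conv_of_real fun_eq_iff)
  have "((\<lambda>t::real. ?f (\<i> + of_real t)) has_vector_derivative 1 * D) (at 0)"
    using field_vector_diff_chain_at[OF 1(1), of ?f D] D by (simp add: o_def)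
  moreover have "((\<lambda>t::real. ?f (\<i> + of_real t)) has_vector_derivative 0) (at 0)" by simp
  ultimately have D0: "D = 0" by (metis vector_derivative_unique_at mult_1)
  have "((\<lambda>t::real. ?f (\<i> + of_real t * \<i>)) has_vector_derivative \<i> * D) (at 0)"
    using field_vector_diff_chain_at[OF 1(2), of ?f D] D by (simp add: o_def)
  moreover have "((\<lambda>t::real. ?f (\<i> + of_real t * \<i>)) has_vector_derivative - A) (at 0)"
  proof -
    have "((\<lambda>t::real. 1 / (1 + t)) has_real_derivative - 1) (at 0)"
      by (auto intro!: derivative_eq_intros)
    then have "((\<lambda>t::real. complex_of_real (1 / (1 + t))) has_vector_derivative of_real (- 1)) (at 0)"
      by (intro bounded_linear.has_vector_derivative[OF bounded_linear_of_real])
         (simp add: has_real_derivative_iff_has_vector_derivative)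
    from has_vector_derivative_mult_right[OF this, of A] show ?thesis by simp
  qed
  ultimately have "- A = \<i> * D" by (metis vector_derivative_unique_at)
  then show ?thesis using D0 by simp
qed

text \<open>
  In weight \<open>2\<close> the multiple of \<open>1 / Im \<tau>\<close> is \<open>C\<close> times the sum of the coefficients. It disappears if
  the combination is holomorphic, as for the first claim, or if the coefficients add up to \<open>0\<close>, as for
  the spectral basis.
\<close>

lemma (in complex_subfield) Eis_combination_expansion:
  assumes k: "k \<ge> 2" and N: "N \<ge> 1" and z: "exp (2 * of_real pi * \<i> / of_nat N) \<in> K"
    and L: "finite L" "\<And>l. l \<in> L \<Longrightarrow> primitive_mod N l" "\<And>l. l \<in> L \<Longrightarrow> a l \<in> K"
    and f: "\<And>\<tau>. Im \<tau> > 0 \<Longrightarrow> f \<tau> = (\<Sum>l\<in>L. a l * Eis k N l \<tau>)"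
    and hol: "k = 2 \<Longrightarrow> f holomorphic_on {\<tau>. Im \<tau> > 0} \<or> (\<Sum>l\<in>L. a l) = 0"
  shows "has_Fourier_expansion_over K N f"
proof -
  obtain C where "\<And>l. primitive_mod N l \<Longrightarrow> \<exists>e. (\<forall>j. e j \<in> K) \<and> (\<forall>\<tau>. Im \<tau> > 0 \<longrightarrow>
     (\<lambda>j. e j * qexp N \<tau> j) sums (Eis k N l \<tau> + (if k = 2 then C / of_real (Im \<tau>) else 0)))"
    using Eis_expansion[OF k N z] by blast
  then have "\<forall>l\<in>L. \<exists>e. (\<forall>j. e j \<in> K) \<and> (\<forall>\<tau>. Im \<tau> > 0 \<longrightarrow>
     (\<lambda>j. e j * qexp N \<tau> j) sums (Eis k N l \<tau> + (if k = 2 then C / of_real (Im \<tau>) else 0)))"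
    using L(2) by simp
  then obtain e where e: "\<And>l j. l \<in> L \<Longrightarrow> e l j \<in> K"
    "\<And>l \<tau>. l \<in> L \<Longrightarrow> Im \<tau> > 0 \<Longrightarrow>
     (\<lambda>j. e l j * qexp N \<tau> j) sums (Eis k N l \<tau> + (if k = 2 then C / of_real (Im \<tau>) else 0))"
    using bchoice[of L] by metis
  define A where "A = (if k = 2 then (\<Sum>l\<in>L. a l) * C else 0)"
  define c where "c j = (\<Sum>l\<in>L. a l * e l j)" for j
  have cK: "c j \<in> K" for j unfolding c_def by (intro sum_mem mult_mem L(3) e(1))
  have s: "(\<lambda>j. c j * qexp N \<tau> j) sums (f \<tau> + A / of_real (Im \<tau>))" if \<tau>: "Im \<tau> > 0" for \<tau>
  proof -
    have "(\<lambda>j. \<Sum>l\<in>L. a l * (e l j * qexp N \<tau> j)) sums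
      (\<Sum>l\<in>L. a l * (Eis k N l \<tau> + (if k = 2 then C / of_real (Im \<tau>) else 0)))"
      by (intro sums_sum sums_mult e(2) \<tau>)
    moreover have "(\<lambda>j. \<Sum>l\<in>L. a l * (e l j * qexp N \<tau> j)) = (\<lambda>j. c j * qexp N \<tau> j)"
      by (simp add: c_def sum_distrib_right mult.assoc)
    moreover have "(\<Sum>l\<in>L. a l * (Eis k N l \<tau> + (if k = 2 then C / of_real (Im \<tau>) else 0))) = f \<tau> + A / of_real (Im \<tau>)"
      unfolding f[OF \<tau>] A_def by (simp add: distrib_left sum.distrib sum_distrib_right sum_divide_distrib)
    ultimately show ?thesis by simp
  qed
  have "A = 0"
  proof (cases "k = 2 \<and> (\<Sum>l\<in>L. a l) \<noteq> 0")
    case True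
    then have "f holomorphic_on {\<tau>. Im \<tau> > 0}" using hol by blast
    moreover have "(\<lambda>\<tau>. f \<tau> + A / of_real (Im \<tau>)) holomorphic_on {\<tau>. Im \<tau> > 0}"
      by (rule qexp_series_holomorphic[OF N s])
    ultimately have "(\<lambda>\<tau>. (f \<tau> + A / of_real (Im \<tau>)) - f \<tau>) holomorphic_on {\<tau>. Im \<tau> > 0}"
      by (rule holomorphic_on_diff[rotated])
    then show ?thesis by (intro inverse_Im_not_holomorphic) simp
  qed (auto simp: A_def)
  then show ?thesis
    unfolding has_Fourier_expansion_over_def upper_half_plane_def
    using cK s by (intro exI[of _ c]) (simp add: qexp_def)
qed

lemma Eis_space_expansion:
  assumes k: "k \<ge> 2" and N: "N \<ge> 1" and K: "subfield K complex_ring" "cyclotomic_field N \<subseteq> K"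
    and f: "f \<in> Eis_space k N G K"
  shows "has_Fourier_expansion_over K N f"
proof -
  interpret complex_subfield K by (rule complex_subfield_of_subfield[OF K(1)])
  have z: "exp (2 * of_real pi * \<i> / of_nat N) \<in> K" using root_of_unity_in_cyclotomic K(2) by blast
  have "f \<in> Eis_star_level k N K" using f by (simp add: Eis_space_def Eis_star_def)
  then obtain a where a: "\<And>l. l \<in> Lambda N \<Longrightarrow> a l \<in> K"
    "\<And>\<tau>. \<tau> \<in> upper_half_plane \<Longrightarrow> f \<tau> = (\<Sum>l\<in>Lambda N. a l * Eis k N l \<tau>)"
    unfolding Eis_star_level_def by blast
  have h: "f holomorphic_on {\<tau>. Im \<tau> > 0}" using f by (simp add: Eis_space_def upper_half_plane_def)
  show ?thesis
    by (rule Eis_combination_expansion[OF k N z finite_Lambda[OF N] Lambda_primitive[OF N] a(1)])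
       (use a(2) h in \<open>auto simp: upper_half_plane_def\<close>)
qed

section \<open>Bottom rows of matrices and cusps\<close>

definition mat22 :: "int \<Rightarrow> int \<Rightarrow> int \<Rightarrow> int \<Rightarrow> int^2^2" where
  "mat22 a b c d = vector [vector [a, b], vector [c, d]]"

lemma mat22_entries [simp]:
  "mat22 a b c d $ 1 $ 1 = a" "mat22 a b c d $ 1 $ 2 = b" "mat22 a b c d $ 2 $ 1 = c" "mat22 a b c d $ 2 $ 2 = d"
  by (simp_all add: mat22_def)

lemma mat2_eq_iff: "(A :: int^2^2) = B \<longleftrightarrow>
    A $ 1 $ 1 = B $ 1 $ 1 \<and> A $ 1 $ 2 = B $ 1 $ 2 \<and> A $ 2 $ 1 = B $ 2 $ 1 \<and> A $ 2 $ 2 = B $ 2 $ 2"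
  by (auto simp: vec_eq_iff forall_2)

lemma mult_entry: "((A :: int^2^2) ** B) $ i $ j = A $ i $ 1 * B $ 1 $ j + A $ i $ 2 * B $ 2 $ j"
  by (simp add: matrix_matrix_mult_def sum_2)

lemma mat_1_entries [simp]:
  "(mat 1 :: int^2^2) $ 1 $ 1 = 1" "(mat 1 :: int^2^2) $ 1 $ 2 = 0"
  "(mat 1 :: int^2^2) $ 2 $ 1 = 0" "(mat 1 :: int^2^2) $ 2 $ 2 = 1"
  by (simp_all add: mat_def)

text \<open>
  The inverse on \<open>SL2Z\<close>, but total and given by entries, so that identities between products with
  inverses are polynomial identities.
\<close>

definition adj :: "int^2^2 \<Rightarrow> int^2^2" where
  "adj A = mat22 (A $ 2 $ 2) (- (A $ 1 $ 2)) (- (A $ 2 $ 1)) (A $ 1 $ 1)"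

lemma adj_entries [simp]:
  "adj A $ 1 $ 1 = A $ 2 $ 2" "adj A $ 1 $ 2 = - (A $ 1 $ 2)" "adj A $ 2 $ 1 = - (A $ 2 $ 1)" "adj A $ 2 $ 2 = A $ 1 $ 1"
  by (simp_all add: adj_def)

lemma adj_mult: "adj (A ** B) = adj B ** adj A"
  by (simp add: mat2_eq_iff mult_entry)

lemma adj_adj: "adj (adj A) = A"
  by (simp add: mat2_eq_iff)

lemma SL2Z_mem: "A \<in> carrier SL2Z \<longleftrightarrow> A $ 1 $ 1 * A $ 2 $ 2 - A $ 1 $ 2 * A $ 2 $ 1 = 1"
  by (simp add: SL2Z_def det_2)

lemma SL2Z_simps [simp]: "A \<otimes>\<^bsub>SL2Z\<^esub> B = A ** B" "\<one>\<^bsub>SL2Z\<^esub> = mat 1"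
  by (simp_all add: SL2Z_def)

lemma SL2Z_mult_closed: "A \<in> carrier SL2Z \<Longrightarrow> B \<in> carrier SL2Z \<Longrightarrow> A ** B \<in> carrier SL2Z"
  by (simp add: SL2Z_def det_mul)

lemma adj_closed: "A \<in> carrier SL2Z \<Longrightarrow> adj A \<in> carrier SL2Z"
  by (simp add: SL2Z_mem mult.commute)

lemma adj_left: "A \<in> carrier SL2Z \<Longrightarrow> adj A ** A = mat 1"
  by (simp add: SL2Z_mem mat2_eq_iff mult_entry algebra_simps)

lemma adj_right: "A \<in> carrier SL2Z \<Longrightarrow> A ** adj A = mat 1"
  by (simp add: SL2Z_mem mat2_eq_iff mult_entry algebra_simps)

lemma group_SL2Z: "group SL2Z"
proof (rule groupI)
  show "\<one>\<^bsub>SL2Z\<^esub> \<in> carrier SL2Z" by (simp add: SL2Z_mem)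
  show "\<exists>B\<in>carrier SL2Z. B \<otimes>\<^bsub>SL2Z\<^esub> A = \<one>\<^bsub>SL2Z\<^esub>" if "A \<in> carrier SL2Z" for A
    using adj_left[OF that] adj_closed[OF that] by auto
qed (simp_all add: SL2Z_mult_closed matrix_mul_assoc)

lemma inv_SL2Z: "A \<in> carrier SL2Z \<Longrightarrow> inv\<^bsub>SL2Z\<^esub> A = adj A"
  by (rule group.inv_equality[OF group_SL2Z]) (simp_all add: adj_left adj_closed)

lemma SL2Z_subgroupD:
  assumes "subgroup G SL2Z"
  shows "A \<in> G \<Longrightarrow> A \<in> carrier SL2Z" "A \<in> G \<Longrightarrow> B \<in> G \<Longrightarrow> A ** B \<in> G" "A \<in> G \<Longrightarrow> adj A \<in> G" "mat 1 \<in> G"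
  using subgroup.mem_carrier[OF assms] subgroup.m_closed[OF assms, of A B] subgroup.m_inv_closed[OF assms, of A]
    subgroup.one_closed[OF assms] by (auto simp: inv_SL2Z)

definition bot_row :: "int^2^2 \<Rightarrow> int \<times> int" where "bot_row A = (A $ 2 $ 1, A $ 2 $ 2)"

definition left_col :: "int^2^2 \<Rightarrow> int \<times> int" where "left_col A = (A $ 1 $ 1, A $ 2 $ 1)"

definition row_act :: "int \<times> int \<Rightarrow> int^2^2 \<Rightarrow> int \<times> int" where
  "row_act v A = (fst v * A $ 1 $ 1 + snd v * A $ 2 $ 1, fst v * A $ 1 $ 2 + snd v * A $ 2 $ 2)"

definition col_act :: "int^2^2 \<Rightarrow> int \<times> int \<Rightarrow> int \<times> int" where
  "col_act A v = (A $ 1 $ 1 * fst v + A $ 1 $ 2 * snd v, A $ 2 $ 1 * fst v + A $ 2 $ 2 * snd v)"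

abbreviation coprime_pair :: "int \<times> int \<Rightarrow> bool" where "coprime_pair v \<equiv> gcd (fst v) (snd v) = 1"

lemma bot_row_mult: "bot_row (A ** B) = row_act (bot_row A) B"
  by (simp add: bot_row_def row_act_def mult_entry)

lemma coprime_if_det:
  fixes a b c d :: int
  assumes "a * d - b * c = 1"
  shows "gcd c d = 1" "gcd a c = 1"
proof -
  have "gcd c d dvd a * d - b * c" "gcd a c dvd a * d - b * c" by (auto intro: dvd_diff)
  then show "gcd c d = 1" "gcd a c = 1" unfolding assms by simp_all
qed

lemma coprime_pair_bot_row: "A \<in> carrier SL2Z \<Longrightarrow> coprime_pair (bot_row A)"
  and coprime_pair_left_col: "A \<in> carrier SL2Z \<Longrightarrow> coprime_pair (left_col A)"
  unfolding SL2Z_mem bot_row_def left_col_def fst_conv snd_conv by (rule coprime_if_det; simp)+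

lemma coprime_pair_minus [simp]: "coprime_pair (scale_pair (-1) v) \<longleftrightarrow> coprime_pair v"
  by (simp add: scale_pair_def)

lemma coprime_pair_nonzero: "coprime_pair v \<Longrightarrow> v \<noteq> (0, 0)"
  by auto

lemma exists_bot_row:
  assumes "coprime_pair v"
  obtains A where "A \<in> carrier SL2Z" "bot_row A = v"
proof -
  obtain u w where "u * fst v + w * snd v = 1" using bezout_int[of "fst v" "snd v"] assms by auto
  then have "mat22 w (- u) (fst v) (snd v) \<in> carrier SL2Z" by (simp add: SL2Z_mem algebra_simps)
  then show thesis by (rule that) (simp add: bot_row_def)
qed

text \<open>
  A primitive vector is determined up to sign by its line.
\<close>

lemma coprime_pair_parallel:
  assumes v: "coprime_pair v" and w: "coprime_pair w" and eq: "fst v * snd w = fst w * snd v"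
  shows "w = v \<or> w = scale_pair (-1) v"
proof -
  obtain p q where pq: "p * fst v + q * snd v = 1" using bezout_int[of "fst v" "snd v"] v by auto
  define t where "t = p * fst w + q * snd w"
  have "t * fst v = (p * fst v) * fst w + q * (fst v * snd w)" by (simp add: t_def algebra_simps)
  also have "\<dots> = (p * fst v + q * snd v) * fst w" unfolding eq by (simp add: algebra_simps)
  finally have 1: "fst w = t * fst v" using pq by simp
  have "t * snd v = p * (fst w * snd v) + (q * snd v) * snd w" by (simp add: t_def algebra_simps)
  also have "\<dots> = (p * fst v + q * snd v) * snd w" unfolding eq[symmetric] by (simp add: algebra_simps)
  finally have 2: "snd w = t * snd v" using pq by simp
  have "t dvd gcd (fst w) (snd w)" using 1 2 by simp
  then have "\<bar>t\<bar> = 1" using w by simp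
  then have "t = 1 \<or> t = -1" by linarith
  then show ?thesis using 1 2 by (auto simp: scale_pair_def prod_eq_iff)
qed

lemma principal_congruence_mem: "A \<in> principal_congruence N \<longleftrightarrow> A \<in> carrier SL2Z \<and>
    [A $ 1 $ 1 = 1] (mod int N) \<and> [A $ 1 $ 2 = 0] (mod int N) \<and> [A $ 2 $ 1 = 0] (mod int N) \<and> [A $ 2 $ 2 = 1] (mod int N)"
  by (auto simp: principal_congruence_def forall_2)

lemma cong_mult_entry:
  assumes "\<And>i j. [A $ i $ j = A' $ i $ j] (mod int N)" "\<And>i j. [B $ i $ j = B' $ i $ j] (mod int N)"
  shows "[((A :: int^2^2) ** B) $ i $ j = (A' ** B') $ i $ j] (mod int N)"
  unfolding mult_entry by (intro cong_add cong_mult assms)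

lemma principal_congruence_subgroup: "subgroup (principal_congruence N) SL2Z"
proof (rule group.subgroupI[OF group_SL2Z])
  show "principal_congruence N \<subseteq> carrier SL2Z" by (auto simp: principal_congruence_def)
  have "mat 1 \<in> principal_congruence N" by (simp add: principal_congruence_mem SL2Z_mem)
  then show "principal_congruence N \<noteq> {}" by blast
  fix A assume A: "A \<in> principal_congruence N"
  then show "inv\<^bsub>SL2Z\<^esub> A \<in> principal_congruence N"
    using cong_minus_minus_iff[of "A $ 1 $ 2" 0 "int N"] cong_minus_minus_iff[of "A $ 2 $ 1" 0 "int N"]
    by (simp add: principal_congruence_mem inv_SL2Z adj_closed)
  fix B assume B: "B \<in> principal_congruence N"
  have "[(A ** B) $ i $ j = (mat 1 ** mat 1) $ i $ j] (mod int N)" for i j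
    by (rule cong_mult_entry) (use A B in \<open>auto simp: principal_congruence_def\<close>)
  then show "A \<otimes>\<^bsub>SL2Z\<^esub> B \<in> principal_congruence N"
    using A B by (auto simp: principal_congruence_def SL2Z_mult_closed)
qed

lemma principal_congruence_conj:
  assumes M: "M \<in> principal_congruence N" and A: "A \<in> carrier SL2Z"
  shows "adj A ** M ** A \<in> principal_congruence N"
proof -
  have "[(adj A ** M ** A) $ i $ j = (adj A ** mat 1 ** A) $ i $ j] (mod int N)" for i j
    by (intro cong_mult_entry cong_refl) (use M in \<open>auto simp: principal_congruence_def\<close>)
  then show ?thesis
    using M A adj_left[OF A] by (auto simp: principal_congruence_def SL2Z_mult_closed adj_closed)
qed

text \<open>
  Complete both rows to matrices \<open>A\<close> and \<open>B\<close>. Modulo \<open>N\<close>, the product \<open>R = B A\<^sup>-\<^sup>1\<close> is a translation.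
  Multiplication by the opposite translation \<open>T\<close> changes no bottom row and makes \<open>T R\<close> an element of
  \<open>\<Gamma>(N)\<close>. By normality \<open>A\<^sup>-\<^sup>1 (T R) A\<close> is one as well, and it maps the bottom row of \<open>A\<close> to that of
  \<open>T B\<close>, which is the bottom row of \<open>B\<close>.
\<close>

lemma principal_congruence_transitive:
  assumes v: "coprime_pair v" and v': "coprime_pair v'"
    and c: "[fst v' = fst v] (mod int N)" "[snd v' = snd v] (mod int N)"
  obtains \<gamma> where "\<gamma> \<in> principal_congruence N" "v' = row_act v \<gamma>"
proof -
  obtain A where A: "A \<in> carrier SL2Z" "bot_row A = v" using exists_bot_row[OF v] .
  obtain B where B: "B \<in> carrier SL2Z" "bot_row B = v'" using exists_bot_row[OF v'] .
  define R where "R = B ** adj A"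
  have R: "R \<in> carrier SL2Z" unfolding R_def by (intro SL2Z_mult_closed B adj_closed A)
  have dA: "A $ 1 $ 1 * A $ 2 $ 2 - A $ 1 $ 2 * A $ 2 $ 1 = 1" using A by (simp add: SL2Z_mem)
  have b: "[B $ 2 $ 1 = A $ 2 $ 1] (mod int N)" "[B $ 2 $ 2 = A $ 2 $ 2] (mod int N)"
    using A(2) B(2) c by (auto simp: bot_row_def)
  have R2: "R $ 2 $ 1 = B $ 2 $ 1 * A $ 2 $ 2 - B $ 2 $ 2 * A $ 2 $ 1"
    "R $ 2 $ 2 = B $ 2 $ 2 * A $ 1 $ 1 - B $ 2 $ 1 * A $ 1 $ 2"
    by (simp_all add: R_def mult_entry)
  have R21: "[R $ 2 $ 1 = A $ 2 $ 1 * A $ 2 $ 2 - A $ 2 $ 2 * A $ 2 $ 1] (mod int N)"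
    unfolding R2 by (intro cong_diff cong_mult b cong_refl)
  then have R21: "[R $ 2 $ 1 = 0] (mod int N)" by (simp add: mult.commute)
  have "[R $ 2 $ 2 = A $ 2 $ 2 * A $ 1 $ 1 - A $ 2 $ 1 * A $ 1 $ 2] (mod int N)"
    unfolding R2 by (intro cong_diff cong_mult b cong_refl)
  then have R22: "[R $ 2 $ 2 = 1] (mod int N)" using dA by (simp add: mult.commute)
  have "[R $ 1 $ 1 * R $ 2 $ 2 - R $ 1 $ 2 * R $ 2 $ 1 = R $ 1 $ 1 * 1 - R $ 1 $ 2 * 0] (mod int N)"
    by (intro cong_diff cong_mult cong_refl R21 R22)
  then have R11: "[R $ 1 $ 1 = 1] (mod int N)" using R by (simp add: SL2Z_mem cong_sym)
  \<comment> \<open>Removes the upper right entry of \<open>R\<close> modulo \<open>N\<close>.\<close>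
  define T where "T = mat22 1 (- (R $ 1 $ 2)) 0 1"
  have T: "T \<in> carrier SL2Z" by (simp add: T_def SL2Z_mem)
  have TR: "T ** R \<in> principal_congruence N"
  proof -
    have "[R $ 1 $ 1 - R $ 1 $ 2 * R $ 2 $ 1 = 1 - R $ 1 $ 2 * 0] (mod int N)"
      by (intro cong_diff cong_mult cong_refl R11 R21)
    moreover have "[R $ 1 $ 2 - R $ 1 $ 2 * R $ 2 $ 2 = R $ 1 $ 2 - R $ 1 $ 2 * 1] (mod int N)"
      by (intro cong_diff cong_mult cong_refl R22)
    ultimately show ?thesis
      using R21 R22 SL2Z_mult_closed[OF T R]
      by (simp add: principal_congruence_mem mult_entry) (simp add: T_def)
  qed
  have RA: "R ** A = B"
    unfolding R_def matrix_mul_assoc[symmetric] adj_left[OF A(1)] by simp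
  show thesis
  proof (rule that[OF principal_congruence_conj[OF TR A(1)]])
    have "A ** (adj A ** (T ** R) ** A) = (A ** adj A) ** T ** (R ** A)" by (simp add: matrix_mul_assoc)
    then have "A ** (adj A ** (T ** R) ** A) = T ** B" using RA adj_right[OF A(1)] by simp
    then have "row_act v (adj A ** (T ** R) ** A) = bot_row (T ** B)"
      using A(2) bot_row_mult[of A "adj A ** (T ** R) ** A"] by simp
    also have "bot_row (T ** B) = v'" using B(2) by (auto simp: bot_row_def mult_entry T_def)
    finally show "v' = row_act v (adj A ** (T ** R) ** A)" ..
  qed
qed

text \<open>
  The point of the projective line with the given homogeneous coordinates.
\<close>

definition pt :: "int \<times> int \<Rightarrow> proj_rat" where
  "pt v = (if snd v = 0 then Infty else Fin (of_int (fst v) / of_int (snd v)))"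

lemma pt_col: "pt (left_col A) = proj_act A Infty"
  by (simp add: pt_def left_col_def)

lemma proj_act_pt:
  assumes A: "A \<in> carrier SL2Z" and v: "v \<noteq> (0, 0)"
  shows "proj_act A (pt v) = pt (col_act A v)"
proof (cases "snd v = 0")
  case True
  then have "fst v \<noteq> 0" using v by (auto simp: prod_eq_iff)
  then show ?thesis using True by (simp add: pt_def col_act_def)
next
  case False
  let ?r = "of_int (fst v) / of_int (snd v) :: rat"
  have e: "of_int (A $ i $ 1) * ?r + of_int (A $ i $ 2) = of_int (A $ i $ 1 * fst v + A $ i $ 2 * snd v) / of_int (snd v)" for i
    using False by (simp add: add_divide_distrib)
  have s: "(of_int (snd v) :: rat) \<noteq> 0" using False by simp
  have q: "Y / of_int (snd v) = 0 \<longleftrightarrow> Y = 0" "(Y / of_int (snd v)) / (Z / of_int (snd v)) = Y / Z" for Y Z :: rat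
    using s by simp_all
  show ?thesis
    unfolding pt_def col_act_def if_not_P[OF False] proj_act.simps e q of_int_eq_0_iff fst_conv snd_conv by (rule refl)
qed

lemma pt_eq_iff:
  assumes "v \<noteq> (0, 0)" "w \<noteq> (0, 0)"
  shows "pt v = pt w \<longleftrightarrow> fst v * snd w = fst w * snd v"
proof (cases "snd v = 0 \<or> snd w = 0")
  case True
  then show ?thesis using assms by (auto simp: pt_def prod_eq_iff)
next
  case False
  then have "pt v = pt w \<longleftrightarrow> (of_int (fst v) * of_int (snd w) :: rat) = of_int (fst w) * of_int (snd v)"
    by (simp add: pt_def frac_eq_eq)
  also have "\<dots> \<longleftrightarrow> fst v * snd w = fst w * snd v" by (simp only: of_int_mult[symmetric] of_int_eq_iff)
  finally show ?thesis .
qed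

lemma pt_surj:
  obtains v where "coprime_pair v" "y = pt v"
proof (cases y)
  case Infty
  then show thesis using that[of "(1, 0)"] by (simp add: pt_def)
next
  case (Fin r)
  obtain a b where ab: "quotient_of r = (a, b)" by force
  have "r = of_int a / of_int b" "b > 0" "coprime a b"
    using quotient_of_div[OF ab] quotient_of_denom_pos[OF ab] quotient_of_coprime[OF ab] by auto
  then show thesis using that[of "(a, b)"] Fin by (simp add: pt_def coprime_iff_gcd_eq_1)
qed

lemma proj_act_mult:
  assumes A: "A \<in> carrier SL2Z" and B: "B \<in> carrier SL2Z"
  shows "proj_act (A ** B) y = proj_act A (proj_act B y)"
proof -
  obtain v where v: "coprime_pair v" "y = pt v" using pt_surj .
  have cc: "col_act A (col_act B v) = col_act (A ** B) v"
    by (simp add: col_act_def mult_entry algebra_simps)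
  have nz: "col_act B v \<noteq> (0, 0)"
  proof
    assume "col_act B v = (0, 0)"
    then have z: "B $ 1 $ 1 * fst v + B $ 1 $ 2 * snd v = 0" "B $ 2 $ 1 * fst v + B $ 2 $ 2 * snd v = 0"
      by (simp_all add: col_act_def)
    have d: "B $ 1 $ 1 * B $ 2 $ 2 - B $ 1 $ 2 * B $ 2 $ 1 = 1" using B by (simp add: SL2Z_mem)
    have "(B $ 1 $ 1 * B $ 2 $ 2 - B $ 1 $ 2 * B $ 2 $ 1) * fst v =
        B $ 2 $ 2 * (B $ 1 $ 1 * fst v + B $ 1 $ 2 * snd v) - B $ 1 $ 2 * (B $ 2 $ 1 * fst v + B $ 2 $ 2 * snd v)"
      "(B $ 1 $ 1 * B $ 2 $ 2 - B $ 1 $ 2 * B $ 2 $ 1) * snd v =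
        B $ 1 $ 1 * (B $ 2 $ 1 * fst v + B $ 2 $ 2 * snd v) - B $ 2 $ 1 * (B $ 1 $ 1 * fst v + B $ 1 $ 2 * snd v)"
      by (simp_all add: algebra_simps)
    then have "fst v = 0" "snd v = 0" unfolding d z by simp_all
    then show False using v(1) by simp
  qed
  show ?thesis unfolding v(2)
    using proj_act_pt[OF SL2Z_mult_closed[OF A B] coprime_pair_nonzero[OF v(1)]] proj_act_pt[OF B coprime_pair_nonzero[OF v(1)]]
      proj_act_pt[OF A nz] cc by simp
qed

lemma proj_act_mat_1 [simp]: "proj_act (mat 1) y = y"
  by (cases y) simp_all

text \<open>
  The point \<open>- d / c\<close> at which \<open>c \<tau> + d\<close> vanishes.
\<close>

definition pole :: "int \<times> int \<Rightarrow> proj_rat" where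
  "pole v = pt (snd v, - fst v)"

lemma pole_bot_row: "pole (bot_row A) = proj_act (adj A) Infty"
  by (simp add: pole_def bot_row_def pt_def)

lemma pole_minus: "coprime_pair v \<Longrightarrow> pole (scale_pair (-1) v) = pole v"
  unfolding pole_def by (subst pt_eq_iff) (auto simp: scale_pair_def)

lemma cusp_orbit_eq: "cusp_orbit G x = (\<lambda>B. proj_act B x) ` G"
  by (auto simp: orbit_def)

lemma cusp_stab_eq: "cusp_stab G x = {B \<in> G. proj_act B x = x}"
  by (auto simp: stabilizer_def)

lemma cusp_orbit_member_eq:
  assumes G: "subgroup G SL2Z" and y: "y \<in> cusp_orbit G x"
  shows "cusp_orbit G y = cusp_orbit G x"
proof -
  note g = SL2Z_subgroupD[OF G]
  obtain B where B: "B \<in> G" "y = proj_act B x" using y by (auto simp: cusp_orbit_eq)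
  have "proj_act C y = proj_act (C ** B) x" if "C \<in> G" for C
    unfolding B(2) using proj_act_mult g(1) that B(1) by simp
  moreover have "proj_act C x = proj_act (C ** adj B) y" if "C \<in> G" for C
  proof -
    have "proj_act (C ** adj B) y = proj_act C (proj_act (adj B) (proj_act B x))"
      unfolding B(2) by (rule proj_act_mult) (use g that B(1) in blast)+
    also have "proj_act (adj B) (proj_act B x) = proj_act (adj B ** B) x"
      by (rule proj_act_mult[symmetric]) (use g B(1) in blast)+
    finally show ?thesis using adj_left g(1)[OF B(1)] by simp
  qed
  ultimately show ?thesis unfolding cusp_orbit_eq using g(2,3) B(1) by (auto simp: image_iff)
qed

text \<open>
  The pairs \<open>(c, d)\<close> for which \<open>c \<tau> + d\<close> is an automorphy factor in the spectral series with scaling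
  matrix \<open>S\<close>.
\<close>

definition scaled_rows :: "(int^2^2) set \<Rightarrow> int^2^2 \<Rightarrow> (int \<times> int) set" where
  "scaled_rows G S = (\<lambda>B. bot_row (adj S ** B)) ` G"

text \<open>
  Unlike the rows themselves, their closure under sign depends only on the cusp.
\<close>

definition signed_rows :: "(int^2^2) set \<Rightarrow> int^2^2 \<Rightarrow> (int \<times> int) set" where
  "signed_rows G S = scaled_rows G S \<union> scale_pair (-1) ` scaled_rows G S"

lemma scale_pair_minus_minus [simp]: "scale_pair (-1) (scale_pair (-1) v) = v"
  by (simp add: scale_pair_def)

lemma scaled_rows_coprime:
  assumes "subgroup G SL2Z" "S \<in> carrier SL2Z" "v \<in> scaled_rows G S"
  shows "coprime_pair v"
  using assms SL2Z_subgroupD(1)[OF assms(1)] by (auto simp: scaled_rows_def intro!: coprime_pair_bot_row SL2Z_mult_closed adj_closed)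

lemma signed_rows_coprime:
  assumes "subgroup G SL2Z" "S \<in> carrier SL2Z" "v \<in> signed_rows G S"
  shows "coprime_pair v"
  using scaled_rows_coprime[OF assms(1,2)] assms(3) by (auto simp: signed_rows_def)

lemma signed_rows_minus: "v \<in> signed_rows G S \<Longrightarrow> scale_pair (-1) v \<in> signed_rows G S"
  unfolding signed_rows_def by force

text \<open>
  The rows are stable under \<open>G\<close> acting from the right, hence under \<open>\<Gamma>(N)\<close>, whose orbits on coprime
  pairs are the congruence classes.
\<close>

lemma scaled_rows_cong:
  assumes G: "subgroup G SL2Z" and S: "S \<in> carrier SL2Z" and N: "principal_congruence N \<subseteq> G"
    and v: "v \<in> scaled_rows G S" and v': "coprime_pair v'" "[fst v' = fst v] (mod int N)" "[snd v' = snd v] (mod int N)"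
  shows "v' \<in> scaled_rows G S"
proof -
  obtain \<gamma> where \<gamma>: "\<gamma> \<in> principal_congruence N" "v' = row_act v \<gamma>"
    using principal_congruence_transitive[OF scaled_rows_coprime[OF G S v] v'] .
  obtain B where B: "B \<in> G" "v = bot_row (adj S ** B)" using v by (auto simp: scaled_rows_def)
  have "v' = bot_row (adj S ** (B ** \<gamma>))"
    unfolding \<gamma>(2) B(2) bot_row_mult[symmetric] by (simp add: matrix_mul_assoc)
  then show ?thesis using SL2Z_subgroupD(2)[OF G B(1), of \<gamma>] \<gamma>(1) N by (auto simp: scaled_rows_def)
qed

lemma signed_rows_cong:
  assumes G: "subgroup G SL2Z" and S: "S \<in> carrier SL2Z" and N: "principal_congruence N \<subseteq> G"
    and v: "v \<in> signed_rows G S" and v': "coprime_pair v'" "[fst v' = fst v] (mod int N)" "[snd v' = snd v] (mod int N)"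
  shows "v' \<in> signed_rows G S"
proof (cases "v \<in> scaled_rows G S")
  case True
  then show ?thesis using scaled_rows_cong[OF G S N _ v'] by (simp add: signed_rows_def)
next
  case False
  then obtain u where u: "u \<in> scaled_rows G S" "v = scale_pair (-1) u" using v by (auto simp: signed_rows_def)
  have "scale_pair (-1) v' \<in> scaled_rows G S"
  proof (rule scaled_rows_cong[OF G S N u(1)])
    show "coprime_pair (scale_pair (-1) v')" using v'(1) by simp
    show "[fst (scale_pair (-1) v') = fst u] (mod int N)" "[snd (scale_pair (-1) v') = snd u] (mod int N)"
      using v'(2,3) u(2) cong_minus_minus_iff[of "fst v'" "- fst u" "int N"] cong_minus_minus_iff[of "snd v'" "- snd u" "int N"]
      by (simp_all add: scale_pair_def)
  qed
  then have "scale_pair (-1) (scale_pair (-1) v') \<in> signed_rows G S" unfolding signed_rows_def by blast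
  then show ?thesis by simp
qed

text \<open>
  The row \<open>(c, d)\<close> of \<open>S\<^sup>-\<^sup>1 B\<close> vanishes at \<open>B\<^sup>-\<^sup>1 S \<infinity> = B\<^sup>-\<^sup>1 x\<close>, and conversely a point of the orbit
  determines the coprime pair up to sign. This translates between cusps and rows.
\<close>

lemma pole_in_orbit_iff:
  assumes G: "subgroup G SL2Z" and S: "S \<in> carrier SL2Z" "proj_act S Infty = x" and v: "coprime_pair v"
  shows "pole v \<in> cusp_orbit G x \<longleftrightarrow> v \<in> signed_rows G S"
proof
  note g = SL2Z_subgroupD[OF G]
  have up: "pole u \<in> cusp_orbit G x" if u: "u \<in> scaled_rows G S" for u
  proof -
    obtain B where B: "B \<in> G" "u = bot_row (adj S ** B)" using u by (auto simp: scaled_rows_def)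
    have "pole u = proj_act (adj B ** S) Infty"
      unfolding B(2) pole_bot_row adj_mult adj_adj ..
    also have "\<dots> = proj_act (adj B) x"
      unfolding S(2)[symmetric] by (rule proj_act_mult[OF g(1)[OF g(3)[OF B(1)]] S(1)])
    finally show ?thesis using g(3)[OF B(1)] by (auto simp: cusp_orbit_eq)
  qed
  assume "v \<in> signed_rows G S"
  then show "pole v \<in> cusp_orbit G x"
    unfolding signed_rows_def
  proof
    assume "v \<in> scaled_rows G S" then show ?thesis by (rule up)
  next
    assume "v \<in> scale_pair (-1) ` scaled_rows G S"
    then obtain u where u: "u \<in> scaled_rows G S" "v = scale_pair (-1) u" by blast
    then show ?thesis using up[OF u(1)] pole_minus[OF scaled_rows_coprime[OF G S(1) u(1)]] by simp
  qed
next
  note g = SL2Z_subgroupD[OF G]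
  assume "pole v \<in> cusp_orbit G x"
  then obtain B where B: "B \<in> G" "pole v = proj_act B x" by (auto simp: cusp_orbit_eq)
  have BS: "B ** S \<in> carrier SL2Z" by (rule SL2Z_mult_closed[OF g(1)[OF B(1)] S(1)])
  have "pole v = pt (left_col (B ** S))"
    unfolding pt_col B(2) S(2)[symmetric] by (rule proj_act_mult[symmetric, OF g(1)[OF B(1)] S(1)])
  then have eq: "pt (left_col (B ** S)) = pt (snd v, - fst v)" by (simp add: pole_def)
  let ?w = "(snd v, - fst v)"
  have w: "coprime_pair ?w" using v by (simp add: gcd.commute)
  have "fst (left_col (B ** S)) * snd ?w = fst ?w * snd (left_col (B ** S))"
    using pt_eq_iff[OF coprime_pair_nonzero[OF coprime_pair_left_col[OF BS]] coprime_pair_nonzero[OF w]] eq by blast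
  from coprime_pair_parallel[OF coprime_pair_left_col[OF BS] w this]
  have "?w = left_col (B ** S) \<or> ?w = scale_pair (-1) (left_col (B ** S))" .
  then have "v = bot_row (adj (B ** S)) \<or> v = scale_pair (-1) (bot_row (adj (B ** S)))"
    by (auto simp: left_col_def bot_row_def scale_pair_def prod_eq_iff)
  moreover have "bot_row (adj (B ** S)) \<in> scaled_rows G S"
    unfolding adj_mult scaled_rows_def using g(3)[OF B(1)] by blast
  ultimately show "v \<in> signed_rows G S" unfolding signed_rows_def by blast
qed

lemma cusp_stab_iff:
  assumes G: "subgroup G SL2Z" and S: "S \<in> carrier SL2Z" "proj_act S Infty = x" and B: "B \<in> G"
  shows "B \<in> cusp_stab G x \<longleftrightarrow> (adj S ** B ** S) $ 2 $ 1 = 0"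
proof -
  have Bc: "B \<in> carrier SL2Z" by (rule SL2Z_subgroupD(1)[OF G B])
  have BS: "B ** S \<in> carrier SL2Z" by (rule SL2Z_mult_closed[OF Bc S(1)])
  have "proj_act B x = pt (left_col (B ** S))"
    unfolding pt_col S(2)[symmetric] by (rule proj_act_mult[symmetric, OF Bc S(1)])
  moreover have "x = pt (left_col S)" unfolding pt_col S(2) ..
  ultimately have "proj_act B x = x \<longleftrightarrow> fst (left_col (B ** S)) * snd (left_col S) = fst (left_col S) * snd (left_col (B ** S))"
    using pt_eq_iff[OF coprime_pair_nonzero[OF coprime_pair_left_col[OF BS]] coprime_pair_nonzero[OF coprime_pair_left_col[OF S(1)]]] by simp
  also have "\<dots> \<longleftrightarrow> (adj S ** (B ** S)) $ 2 $ 1 = 0"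
    unfolding mult_entry[of "adj S"] by (auto simp: left_col_def mult.commute)
  also have "adj S ** (B ** S) = adj S ** B ** S" by (simp add: matrix_mul_assoc)
  finally show ?thesis using B by (simp add: cusp_stab_eq)
qed

lemma lower_zero_SL2Z:
  assumes "M \<in> carrier SL2Z" "M $ 2 $ 1 = 0"
  shows "M $ 2 $ 2 = 1 \<and> M $ 1 $ 1 = 1 \<or> M $ 2 $ 2 = -1 \<and> M $ 1 $ 1 = -1"
proof -
  have "M $ 1 $ 1 * M $ 2 $ 2 = 1" using assms by (simp add: SL2Z_mem)
  then show ?thesis by (auto simp: zmult_eq_1_iff)
qed

text \<open>
  Conjugated by \<open>S\<close>, the stabilizer of \<open>x\<close> consists of matrices \<open>\<plusminus> T\<^sup>n\<close>, and
  multiplying by these from the left changes a bottom row at most by its sign.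
\<close>

lemma same_coset_iff:
  assumes G: "subgroup G SL2Z" and S: "S \<in> carrier SL2Z" "proj_act S Infty = x"
    and B: "B \<in> G" and B': "B' \<in> G"
  shows "(\<exists>h\<in>cusp_stab G x. B' = h ** B) \<longleftrightarrow>
    bot_row (adj S ** B') = bot_row (adj S ** B) \<or> bot_row (adj S ** B') = scale_pair (-1) (bot_row (adj S ** B))"
proof
  note g = SL2Z_subgroupD[OF G]
  assume "\<exists>h\<in>cusp_stab G x. B' = h ** B"
  then obtain h where h: "h \<in> cusp_stab G x" "B' = h ** B" by blast
  then have hG: "h \<in> G" by (simp add: cusp_stab_eq)
  define M where "M = adj S ** h ** S"
  have M: "M \<in> carrier SL2Z" unfolding M_def
    by (intro SL2Z_mult_closed adj_closed S(1) g(1)[OF hG])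
  have M21: "M $ 2 $ 1 = 0" using h(1) cusp_stab_iff[OF G S hG] by (simp add: M_def)
  have "adj S ** B' = adj S ** h ** (S ** adj S) ** B"
    unfolding h(2) adj_right[OF S(1)] by (simp add: matrix_mul_assoc)
  also have "\<dots> = M ** (adj S ** B)" by (simp add: M_def matrix_mul_assoc)
  finally have e: "adj S ** B' = M ** (adj S ** B)" .
  show "bot_row (adj S ** B') = bot_row (adj S ** B) \<or> bot_row (adj S ** B') = scale_pair (-1) (bot_row (adj S ** B))"
    using lower_zero_SL2Z[OF M M21] unfolding e bot_row_def mult_entry[of M] M21 scale_pair_def by auto
next
  note g = SL2Z_subgroupD[OF G]
  assume r: "bot_row (adj S ** B') = bot_row (adj S ** B) \<or> bot_row (adj S ** B') = scale_pair (-1) (bot_row (adj S ** B))"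
  define h where "h = B' ** adj B"
  have hG: "h \<in> G" unfolding h_def by (intro g(2) g(3) B B')
  have "adj S ** h ** S = (adj S ** B') ** adj (adj S ** B)"
    by (simp add: h_def adj_mult adj_adj matrix_mul_assoc)
  moreover have "(C ** adj D) $ 2 $ 1 = 0" if "bot_row C = bot_row D \<or> bot_row C = scale_pair (-1) (bot_row D)" for C D
    using that by (auto simp: bot_row_def scale_pair_def mult_entry)
  ultimately have "(adj S ** h ** S) $ 2 $ 1 = 0" using r by simp
  then have "h \<in> cusp_stab G x" using cusp_stab_iff[OF G S hG] by simp
  moreover have "B' = h ** B"
    unfolding h_def matrix_mul_assoc[symmetric] adj_left[OF g(1)[OF B]] by simp
  ultimately show "\<exists>h\<in>cusp_stab G x. B' = h ** B" by blast
qed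

section \<open>Spectral series as sums of Eisenstein series\<close>

lemma lattice_point_nonzero:
  assumes "Im \<tau> > 0" "coprime_pair v"
  shows "lattice_point \<tau> v \<noteq> 0"
proof
  assume z: "lattice_point \<tau> v = 0"
  then have "Im (lattice_point \<tau> v) = 0" by simp
  then have "fst v = 0" using assms(1) by (simp add: lattice_point_def)
  moreover from this z have "snd v = 0" by (simp add: lattice_point_def)
  ultimately show False using assms(2) by simp
qed

text \<open>
  By \<open>Im (A \<tau>) = Im \<tau> / |c \<tau> + d|\<^sup>2\<close>. The powers may be split because all bases are positive reals.
\<close>

lemma spectral_summand:
  assumes \<tau>: "Im \<tau> > 0" and A: "A \<in> carrier SL2Z"
  shows "of_real (Im (moebius A \<tau>)) powr s / autom_factor A \<tau> ^ k =
    of_real (Im \<tau>) powr s * hom_term k 0 s (lattice_point \<tau> (bot_row A))"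
proof -
  define z where "z = lattice_point \<tau> (bot_row A)"
  have z: "autom_factor A \<tau> = z" by (simp add: z_def lattice_point_def bot_row_def autom_factor_def)
  have z0: "z \<noteq> 0" unfolding z_def by (rule lattice_point_nonzero[OF \<tau> coprime_pair_bot_row[OF A]])
  have d: "real_of_int (A $ 1 $ 1) * of_int (A $ 2 $ 2) - of_int (A $ 1 $ 2) * of_int (A $ 2 $ 1) = 1"
    using A unfolding SL2Z_mem by (metis of_int_1 of_int_diff of_int_mult)
  have "Im (moebius A \<tau>) = (real_of_int (A $ 1 $ 1) * of_int (A $ 2 $ 2) - of_int (A $ 1 $ 2) * of_int (A $ 2 $ 1)) * Im \<tau> / (cmod z)\<^sup>2"
    unfolding moebius_def z Im_divide cmod_power2
    by (simp add: z_def lattice_point_def bot_row_def algebra_simps)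
  then have m: "Im (moebius A \<tau>) = Im \<tau> / (cmod z)\<^sup>2" unfolding d by simp
  have "ln (Im \<tau> / (cmod z)\<^sup>2) = ln (Im \<tau>) - 2 * ln (cmod z)"
    using \<tau> z0 by (simp add: ln_div ln_realpow)
  then have "complex_of_real (Im (moebius A \<tau>)) powr s = exp (s * of_real (ln (Im \<tau>) - 2 * ln (cmod z)))"
    using \<tau> z0 unfolding m by (simp add: powr_def Ln_of_real del: of_real_divide of_real_diff)
  also have "\<dots> = exp (s * of_real (ln (Im \<tau>))) * exp (- 2 * s * of_real (ln (cmod z)))"
    by (simp add: exp_add[symmetric] algebra_simps)
  also have "exp (s * of_real (ln (Im \<tau>))) = of_real (Im \<tau>) powr s"
    using \<tau> by (simp add: powr_def Ln_of_real)
  finally show ?thesis unfolding z hom_term_exp[OF z0] z_def[symmetric] by simp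
qed

lemma hom_term_minus: "hom_term k 0 s (lattice_point \<tau> (scale_pair (-1) v)) = (-1) ^ k * hom_term k 0 s (lattice_point \<tau> v)"
proof -
  have e: "lattice_point \<tau> (scale_pair (-1) v) = (-1) * lattice_point \<tau> v" by (simp add: lattice_point_scale)
  have "inverse ((-1) ^ k :: complex) = (-1) ^ k" by (metis inverse_minus_eq inverse_1 power_inverse)
  then show ?thesis unfolding e hom_term_def power_mult_distrib
    by (simp add: norm_mult divide_inverse)
qed

definition coset_row :: "int^2^2 \<Rightarrow> (int^2^2) set \<Rightarrow> int \<times> int" where
  "coset_row S R = bot_row (adj S ** (SOME B. B \<in> R))"

lemma cusp_stab_closed:
  assumes G: "subgroup G SL2Z"
  shows "mat 1 \<in> cusp_stab G x" "h \<in> cusp_stab G x \<Longrightarrow> h' \<in> cusp_stab G x \<Longrightarrow> h ** h' \<in> cusp_stab G x"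
    "h \<in> cusp_stab G x \<Longrightarrow> adj h \<in> cusp_stab G x"
proof -
  note g = SL2Z_subgroupD[OF G]
  show "mat 1 \<in> cusp_stab G x" using g(4) by (simp add: cusp_stab_eq)
  show "h ** h' \<in> cusp_stab G x" if "h \<in> cusp_stab G x" "h' \<in> cusp_stab G x" for h h'
    using that g(1,2) proj_act_mult[of h h' x] by (simp add: cusp_stab_eq)
  show "adj h \<in> cusp_stab G x" if h: "h \<in> cusp_stab G x" for h
  proof -
    have hG: "h \<in> G" and hx: "proj_act h x = x" using h by (auto simp: cusp_stab_eq)
    have "proj_act (adj h) x = proj_act (adj h ** h) x"
      using proj_act_mult[OF g(1)[OF g(3)[OF hG]] g(1)[OF hG], of x] hx by simp
    then show ?thesis using g(3)[OF hG] adj_left[OF g(1)[OF hG]] by (simp add: cusp_stab_eq)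
  qed
qed

lemma rcosets_cusp_stab:
  "rcosets\<^bsub>restrict_SL2Z G\<^esub> (cusp_stab G x) = (\<lambda>B. (\<lambda>h. h ** B) ` cusp_stab G x) ` G"
  by (auto simp: RCOSETS_def r_coset_def)

lemma coset_eq_of_member:
  assumes G: "subgroup G SL2Z" and R: "R \<in> rcosets\<^bsub>restrict_SL2Z G\<^esub> (cusp_stab G x)" and B: "B \<in> R"
  shows "B \<in> G" "R = (\<lambda>h. h ** B) ` cusp_stab G x"
proof -
  note g = SL2Z_subgroupD[OF G] and c = cusp_stab_closed[OF G, where x = x]
  let ?H = "cusp_stab G x"
  obtain A where A: "A \<in> G" "R = (\<lambda>h. h ** A) ` ?H" using R unfolding rcosets_cusp_stab by blast
  obtain h0 where h0: "h0 \<in> ?H" "B = h0 ** A" using B A(2) by blast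
  have h0G: "h0 \<in> G" using h0(1) by (simp add: cusp_stab_eq)
  show "B \<in> G" unfolding h0(2) by (rule g(2)[OF h0G A(1)])
  have "h ** A \<in> (\<lambda>h. h ** B) ` ?H" if h: "h \<in> ?H" for h
  proof (rule image_eqI)
    show "h ** A = (h ** adj h0) ** B"
      unfolding h0(2) using adj_left[OF g(1)[OF h0G]] by (metis matrix_mul_assoc matrix_mul_rid)
    show "h ** adj h0 \<in> ?H" by (rule c(2)[OF h c(3)[OF h0(1)]])
  qed
  moreover have "h ** B \<in> (\<lambda>h. h ** A) ` ?H" if h: "h \<in> ?H" for h
  proof (rule image_eqI)
    show "h ** B = (h ** h0) ** A" unfolding h0(2) by (simp add: matrix_mul_assoc)
    show "h ** h0 \<in> ?H" by (rule c(2)[OF h h0(1)])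
  qed
  ultimately show "R = (\<lambda>h. h ** B) ` ?H" unfolding A(2) by blast
qed

lemma coset_rep:
  assumes G: "subgroup G SL2Z" and R: "R \<in> rcosets\<^bsub>restrict_SL2Z G\<^esub> (cusp_stab G x)"
  shows "(SOME B. B \<in> R) \<in> R" "(SOME B. B \<in> R) \<in> G"
proof -
  have "R \<noteq> {}" using R cusp_stab_closed(1)[OF G, of x] unfolding rcosets_cusp_stab by blast
  then show 1: "(SOME B. B \<in> R) \<in> R" by (simp add: some_in_eq)
  show "(SOME B. B \<in> R) \<in> G" by (rule coset_eq_of_member(1)[OF G R 1])
qed

context
  fixes G :: "(int^2^2) set" and S :: "int^2^2" and x :: proj_rat
  assumes G: "subgroup G SL2Z" and S: "S \<in> carrier SL2Z" "proj_act S Infty = x"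
begin

lemma coset_row_mem:
  assumes R: "R \<in> rcosets\<^bsub>restrict_SL2Z G\<^esub> (cusp_stab G x)"
  shows "coset_row S R \<in> scaled_rows G S"
  unfolding coset_row_def scaled_rows_def using coset_rep(2)[OF G R] by blast

lemma coset_row_inj:
  assumes R: "R \<in> rcosets\<^bsub>restrict_SL2Z G\<^esub> (cusp_stab G x)" and R': "R' \<in> rcosets\<^bsub>restrict_SL2Z G\<^esub> (cusp_stab G x)"
    and e: "coset_row S R' = coset_row S R \<or> coset_row S R' = scale_pair (-1) (coset_row S R)"
  shows "R' = R"
proof -
  note r = coset_rep[OF G R] and r' = coset_rep[OF G R']
  obtain h where "h \<in> cusp_stab G x" "(SOME B. B \<in> R') = h ** (SOME B. B \<in> R)"
    using same_coset_iff[OF G S r(2) r'(2)] e unfolding coset_row_def by blast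
  then have "(SOME B. B \<in> R') \<in> R" using coset_eq_of_member(2)[OF G R r(1)] by blast
  from coset_eq_of_member(2)[OF G R this] coset_eq_of_member(2)[OF G R' r'(1)] show ?thesis by simp
qed

lemma coset_row_surj:
  assumes v: "v \<in> scaled_rows G S"
  obtains R where "R \<in> rcosets\<^bsub>restrict_SL2Z G\<^esub> (cusp_stab G x)"
    "v = coset_row S R \<or> v = scale_pair (-1) (coset_row S R)"
proof -
  obtain B where B: "B \<in> G" "v = bot_row (adj S ** B)" using v by (auto simp: scaled_rows_def)
  define R where "R = (\<lambda>h. h ** B) ` cusp_stab G x"
  have R: "R \<in> rcosets\<^bsub>restrict_SL2Z G\<^esub> (cusp_stab G x)" unfolding rcosets_cusp_stab R_def using B(1) by blast
  obtain h where h: "h \<in> cusp_stab G x" "(SOME B. B \<in> R) = h ** B" using coset_rep(1)[OF G R] by (auto simp: R_def)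
  then have "coset_row S R = v \<or> coset_row S R = scale_pair (-1) v"
    using same_coset_iff[OF G S B(1) coset_rep(2)[OF G R]] unfolding coset_row_def B(2) by blast
  then show thesis using that[OF R] by force
qed

lemma spectral_series_eq_coset_sum:
  assumes \<tau>: "Im \<tau> > 0"
  shows "spectral_series k G S x \<tau> s = of_real (Im \<tau>) powr s *
    (\<Sum>\<^sub>\<infinity>R\<in>rcosets\<^bsub>restrict_SL2Z G\<^esub> (cusp_stab G x). hom_term k 0 s (lattice_point \<tau> (coset_row S R)))"
proof -
  have "spectral_series k G S x \<tau> s = (\<Sum>\<^sub>\<infinity>R\<in>rcosets\<^bsub>restrict_SL2Z G\<^esub> (cusp_stab G x).
      of_real (Im \<tau>) powr s * hom_term k 0 s (lattice_point \<tau> (coset_row S R)))"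
    unfolding spectral_series_def
  proof (rule infsum_cong)
    fix R assume R: "R \<in> rcosets\<^bsub>restrict_SL2Z G\<^esub> (cusp_stab G x)"
    have "adj S ** (SOME B. B \<in> R) \<in> carrier SL2Z"
      by (intro SL2Z_mult_closed adj_closed S(1) SL2Z_subgroupD(1)[OF G] coset_rep(2)[OF G R])
    from spectral_summand[OF \<tau> this, of s k]
    show "(let A = inv\<^bsub>SL2Z\<^esub> S \<otimes>\<^bsub>SL2Z\<^esub> (SOME B. B \<in> R)
        in of_real (Im (moebius A \<tau>)) powr s / autom_factor A \<tau> ^ k) =
        of_real (Im \<tau>) powr s * hom_term k 0 s (lattice_point \<tau> (coset_row S R))"
      by (simp add: Let_def inv_SL2Z[OF S(1)] coset_row_def)
  qed
  also have "\<dots> = of_real (Im \<tau>) powr s *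
    (\<Sum>\<^sub>\<infinity>R\<in>rcosets\<^bsub>restrict_SL2Z G\<^esub> (cusp_stab G x). hom_term k 0 s (lattice_point \<tau> (coset_row S R)))"
    by (rule infsum_cmult_right')
  finally show ?thesis .
qed

text \<open>
  Each coset owns a pair of opposite rows, with equal summands in even weight.
\<close>

lemma coset_sum_even:
  assumes k: "even k" and sm: "(\<lambda>v. hom_term k 0 s (lattice_point \<tau> v)) summable_on UNIV"
  shows "(\<Sum>\<^sub>\<infinity>v\<in>signed_rows G S. hom_term k 0 s (lattice_point \<tau> v)) =
    2 * (\<Sum>\<^sub>\<infinity>R\<in>rcosets\<^bsub>restrict_SL2Z G\<^esub> (cusp_stab G x). hom_term k 0 s (lattice_point \<tau> (coset_row S R)))"
proof -
  let ?C = "rcosets\<^bsub>restrict_SL2Z G\<^esub> (cusp_stab G x)" and ?T = "\<lambda>v. hom_term k 0 s (lattice_point \<tau> v)"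
  let ?m = "\<lambda>R. scale_pair (-1) (coset_row S R)"
  have sub: "?T summable_on A" for A by (rule summable_on_subset_banach[OF sm]) simp
  have inj: "inj_on (coset_row S) ?C" "inj_on ?m ?C"
    using coset_row_inj by (auto simp: inj_on_def) (metis scale_pair_minus_minus)+
  have U: "signed_rows G S = coset_row S ` ?C \<union> ?m ` ?C"
  proof
    show "coset_row S ` ?C \<union> ?m ` ?C \<subseteq> signed_rows G S"
      using coset_row_mem unfolding signed_rows_def by blast
    have "v \<in> coset_row S ` ?C \<union> ?m ` ?C \<and> scale_pair (-1) v \<in> coset_row S ` ?C \<union> ?m ` ?C"
      if v: "v \<in> scaled_rows G S" for v
    proof -
      obtain R where R: "R \<in> ?C" "v = coset_row S R \<or> v = ?m R" using coset_row_surj[OF v] .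
      from R(2) show ?thesis using R(1) by (elim disjE) simp_all
    qed
    then show "signed_rows G S \<subseteq> coset_row S ` ?C \<union> ?m ` ?C" unfolding signed_rows_def by blast
  qed
  have disj: "coset_row S ` ?C \<inter> ?m ` ?C = {}"
  proof -
    have False if R: "R \<in> ?C" "R' \<in> ?C" and e: "coset_row S R = ?m R'" for R R'
    proof -
      have "R = R'" using coset_row_inj[OF R(2) R(1)] e by blast
      then have "coset_row S R = scale_pair (-1) (coset_row S R)" using e by simp
      then have "fst (coset_row S R) = 0" "snd (coset_row S R) = 0" by (simp_all add: scale_pair_def prod_eq_iff)
      then show False using scaled_rows_coprime[OF G S(1) coset_row_mem[OF R(1)]] by simp
    qed
    then show ?thesis by blast
  qed
  have "infsum ?T (signed_rows G S) = infsum ?T (coset_row S ` ?C) + infsum ?T (?m ` ?C)"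
    unfolding U by (rule infsum_Un_disjoint[OF sub sub disj])
  also have "infsum ?T (coset_row S ` ?C) = (\<Sum>\<^sub>\<infinity>R\<in>?C. ?T (coset_row S R))"
    by (subst infsum_reindex[OF inj(1)]) (simp add: o_def)
  also have "infsum ?T (?m ` ?C) = (\<Sum>\<^sub>\<infinity>R\<in>?C. ?T (coset_row S R))"
    by (subst infsum_reindex[OF inj(2)]) (simp add: o_def hom_term_minus k)
  finally show ?thesis by simp
qed

text \<open>
  If no two rows are opposite, then each coset owns one row.
\<close>

lemma coset_sum_disjoint:
  assumes disj: "scaled_rows G S \<inter> scale_pair (-1) ` scaled_rows G S = {}"
  shows "(\<Sum>\<^sub>\<infinity>v\<in>scaled_rows G S. hom_term k 0 s (lattice_point \<tau> v)) =
    (\<Sum>\<^sub>\<infinity>R\<in>rcosets\<^bsub>restrict_SL2Z G\<^esub> (cusp_stab G x). hom_term k 0 s (lattice_point \<tau> (coset_row S R)))"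
proof -
  let ?C = "rcosets\<^bsub>restrict_SL2Z G\<^esub> (cusp_stab G x)"
  have inj: "inj_on (coset_row S) ?C" using coset_row_inj by (auto simp: inj_on_def)
  have "v \<in> coset_row S ` ?C" if v: "v \<in> scaled_rows G S" for v
  proof -
    obtain R where R: "R \<in> ?C" "v = coset_row S R \<or> v = scale_pair (-1) (coset_row S R)" using coset_row_surj[OF v] .
    have "v \<noteq> scale_pair (-1) (coset_row S R)" using disj v coset_row_mem[OF R(1)] by blast
    then show ?thesis using R by blast
  qed
  then have "scaled_rows G S = coset_row S ` ?C" using coset_row_mem by blast
  then show ?thesis by (simp add: infsum_reindex[OF inj] o_def)
qed

end

text \<open>
  The reductions of \<open>P\<close> modulo \<open>N\<close>, represented by lifts with coordinates in \<open>{0..<N}\<close>.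
\<close>

definition residues_of :: "nat \<Rightarrow> (int \<times> int) set \<Rightarrow> (int \<times> int) set" where
  "residues_of N P = {l \<in> {0..<int N} \<times> {0..<int N}. \<exists>v\<in>P. v \<in> res_class N l}"

lemma finite_residues_of: "finite (residues_of N P)"
  by (rule finite_subset[of _ "{0..<int N} \<times> {0..<int N}"]) (auto simp: residues_of_def)

lemma res_class_cong_iff: "v \<in> res_class N l \<longleftrightarrow> [fst v = fst l] (mod int N) \<and> [snd v = snd l] (mod int N)"
  by (auto simp: res_class_def case_prod_unfold)

lemma residues_of_primitive:
  assumes "\<And>v. v \<in> P \<Longrightarrow> coprime_pair v" "l \<in> residues_of N P"
  shows "primitive_mod N l"
proof -
  obtain v where v: "v \<in> P" "[fst v = fst l] (mod int N)" "[snd v = snd l] (mod int N)"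
    using assms(2) by (auto simp: residues_of_def res_class_cong_iff)
  define g where "g = gcd (gcd (fst l) (snd l)) (int N)"
  have g: "g dvd fst l" "g dvd snd l" "g dvd int N" unfolding g_def by (meson dvd_trans gcd_dvd1 gcd_dvd2)+
  have "g dvd fst v" "g dvd snd v"
    using g v(2,3) by (metis cong_dvd_iff cong_dvd_modulus)+
  then have "g dvd gcd (fst v) (snd v)" by simp
  then have "is_unit g" using assms(1)[OF v(1)] by simp
  then show ?thesis unfolding primitive_mod_def g_def[symmetric] by (simp add: g_def)
qed

text \<open>
  A set of coprime pairs that is closed under congruence modulo \<open>N\<close> is the disjoint union of the full
  sets of coprime pairs in its residue classes.
\<close>

lemma sum_over_residues:
  assumes N: "N \<ge> 1" and cp: "\<And>v. v \<in> P \<Longrightarrow> coprime_pair v"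
    and cl: "\<And>v v'. v \<in> P \<Longrightarrow> coprime_pair v' \<Longrightarrow> [fst v' = fst v] (mod int N) \<Longrightarrow> [snd v' = snd v] (mod int N) \<Longrightarrow> v' \<in> P"
    and sm: "(f :: int \<times> int \<Rightarrow> complex) summable_on UNIV"
  shows "infsum f P = (\<Sum>l\<in>residues_of N P. \<Sum>\<^sub>\<infinity>p\<in>{p \<in> res_class N l. gcd (fst p) (snd p) = 1}. f p)"
proof -
  let ?B = "\<lambda>l. {p \<in> res_class N l. gcd (fst p) (snd p) = 1}"
  have U: "(\<Union>l\<in>residues_of N P. ?B l) = P"
  proof
    show "(\<Union>l\<in>residues_of N P. ?B l) \<subseteq> P"
    proof
      fix p assume "p \<in> (\<Union>l\<in>residues_of N P. ?B l)"
      then obtain l v where l: "p \<in> ?B l" "v \<in> P" "v \<in> res_class N l" by (auto simp: residues_of_def)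
      show "p \<in> P"
      proof (rule cl[OF l(2)])
        show "coprime_pair p" using l(1) by simp
        have a: "[fst p = fst l] (mod int N)" "[snd p = snd l] (mod int N)" "[fst v = fst l] (mod int N)" "[snd v = snd l] (mod int N)"
          using l by (auto simp: res_class_cong_iff)
        show "[fst p = fst v] (mod int N)" by (rule cong_trans[OF a(1) cong_sym[OF a(3)]])
        show "[snd p = snd v] (mod int N)" by (rule cong_trans[OF a(2) cong_sym[OF a(4)]])
      qed
    qed
    show "P \<subseteq> (\<Union>l\<in>residues_of N P. ?B l)"
    proof
      fix v assume v: "v \<in> P"
      let ?l = "(fst v mod int N, snd v mod int N)"
      have "v \<in> res_class N ?l" by (simp add: res_class_cong_iff cong_def)
      moreover from this have "?l \<in> residues_of N P" using v N by (auto simp: residues_of_def)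
      ultimately show "v \<in> (\<Union>l\<in>residues_of N P. ?B l)"
        using cp[OF v] by (intro UN_I[of ?l]) simp_all
    qed
  qed
  have "(f has_sum (\<Sum>l\<in>residues_of N P. infsum f (?B l))) (\<Union>l\<in>residues_of N P. ?B l)"
  proof (rule sum_has_sum[OF finite_residues_of])
    show "(f has_sum infsum f (?B l)) (?B l)" for l
      by (rule has_sum_infsum, rule summable_on_subset_banach[OF sm]) simp
    fix l l' assume l: "l \<in> residues_of N P" "l' \<in> residues_of N P" "l \<noteq> l'"
    have "l = l'" if p: "p \<in> res_class N l" "p \<in> res_class N l'" for p
    proof -
      have a: "[fst p = fst l] (mod int N)" "[snd p = snd l] (mod int N)" "[fst p = fst l'] (mod int N)" "[snd p = snd l'] (mod int N)"
        using p by (auto simp: res_class_cong_iff)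
      have "[fst l = fst l'] (mod int N)" by (rule cong_trans[OF cong_sym[OF a(1)] a(3)])
      moreover have "[snd l = snd l'] (mod int N)" by (rule cong_trans[OF cong_sym[OF a(2)] a(4)])
      ultimately show ?thesis using l(1,2) by (auto simp: residues_of_def cong_def prod_eq_iff)
    qed
    then show "?B l \<inter> ?B l' = {}" using l(3) by blast
  qed
  then show ?thesis unfolding U by (rule infsumI)
qed

lemma sum_rows_Eis_series:
  assumes N: "N \<ge> 1" and \<tau>: "Im \<tau> > 0" and k: "k \<ge> 2" and s: "s \<in> half_plane k 2"
    and cp: "\<And>v. v \<in> P \<Longrightarrow> coprime_pair v"
    and cl: "\<And>v v'. v \<in> P \<Longrightarrow> coprime_pair v' \<Longrightarrow> [fst v' = fst v] (mod int N) \<Longrightarrow> [snd v' = snd v] (mod int N) \<Longrightarrow> v' \<in> P"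
  shows "of_real (Im \<tau>) powr s * (\<Sum>\<^sub>\<infinity>v\<in>P. hom_term k 0 s (lattice_point \<tau> v)) =
    (\<Sum>l\<in>residues_of N P. 1 / eps_level N * Eis_series k N l \<tau> s)"
proof -
  have sm: "(\<lambda>v. hom_term k 0 s (lattice_point \<tau> v)) summable_on UNIV"
    by (rule abs_summable_summable[OF hom_term_summable[OF \<tau>]]) (use s k in auto)
  have eps: "eps_level N \<noteq> 0" by (simp add: eps_level_def)
  have "(\<Sum>\<^sub>\<infinity>v\<in>P. hom_term k 0 s (lattice_point \<tau> v)) =
    (\<Sum>l\<in>residues_of N P. \<Sum>\<^sub>\<infinity>p\<in>{p \<in> res_class N l. gcd (fst p) (snd p) = 1}. hom_term k 0 s (lattice_point \<tau> p))"
    by (rule sum_over_residues[OF N cp cl sm])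
  then show ?thesis using eps by (simp only: Eis_series_eq sum_distrib_left) simp
qed

lemma spectral_Eis_even:
  assumes G: "subgroup G SL2Z" "principal_congruence N \<subseteq> G" and S: "S \<in> carrier SL2Z" "proj_act S Infty = x"
    and N: "N \<ge> 1" and k: "k \<ge> 2" "even k" and \<tau>: "Im \<tau> > 0"
  shows "spectral_Eis k G S x \<tau> = (\<Sum>l\<in>residues_of N (signed_rows G S). 1 / (2 * eps_level N) * Eis k N l \<tau>)"
  unfolding spectral_Eis_def
proof (rule continued_value_Eis_combination[OF \<tau> k(1) N])
  note cp = signed_rows_coprime[OF G(1) S(1)]
  show "primitive_mod N l" if "l \<in> residues_of N (signed_rows G S)" for l
    by (rule residues_of_primitive[OF cp that])
  fix s assume s: "s \<in> half_plane k 2"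
  have sm: "(\<lambda>v. hom_term k 0 s (lattice_point \<tau> v)) summable_on UNIV"
    by (rule abs_summable_summable[OF hom_term_summable[OF \<tau>]]) (use s k in auto)
  have "spectral_series k G S x \<tau> s = of_real (Im \<tau>) powr s *
    (\<Sum>\<^sub>\<infinity>R\<in>rcosets\<^bsub>restrict_SL2Z G\<^esub> (cusp_stab G x). hom_term k 0 s (lattice_point \<tau> (coset_row S R)))"
    by (rule spectral_series_eq_coset_sum[OF G(1) S \<tau>])
  also have "\<dots> = 1 / 2 * (of_real (Im \<tau>) powr s * (\<Sum>\<^sub>\<infinity>v\<in>signed_rows G S. hom_term k 0 s (lattice_point \<tau> v)))"
    unfolding coset_sum_even[OF G(1) S k(2) sm] by simp
  also have "\<dots> = 1 / 2 * (\<Sum>l\<in>residues_of N (signed_rows G S). 1 / eps_level N * Eis_series k N l \<tau> s)"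
    by (subst sum_rows_Eis_series[OF N \<tau> k(1) s cp signed_rows_cong[OF G(1) S(1) G(2)]]) simp_all
  also have "\<dots> = (\<Sum>l\<in>residues_of N (signed_rows G S). 1 / (2 * eps_level N) * Eis_series k N l \<tau> s)"
    unfolding sum_distrib_left by (rule sum.cong) simp_all
  finally show "spectral_series k G S x \<tau> s = (\<Sum>l\<in>residues_of N (signed_rows G S). 1 / (2 * eps_level N) * Eis_series k N l \<tau> s)" .
qed

lemma spectral_Eis_disjoint:
  assumes G: "subgroup G SL2Z" "principal_congruence N \<subseteq> G" and S: "S \<in> carrier SL2Z" "proj_act S Infty = x"
    and N: "N \<ge> 1" and k: "k \<ge> 2" and \<tau>: "Im \<tau> > 0"
    and disj: "scaled_rows G S \<inter> scale_pair (-1) ` scaled_rows G S = {}"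
  shows "spectral_Eis k G S x \<tau> = (\<Sum>l\<in>residues_of N (scaled_rows G S). 1 / eps_level N * Eis k N l \<tau>)"
  unfolding spectral_Eis_def
proof (rule continued_value_Eis_combination[OF \<tau> k N])
  note cp = scaled_rows_coprime[OF G(1) S(1)]
  show "primitive_mod N l" if "l \<in> residues_of N (scaled_rows G S)" for l
    by (rule residues_of_primitive[OF cp that])
  fix s assume s: "s \<in> half_plane k 2"
  have "spectral_series k G S x \<tau> s = of_real (Im \<tau>) powr s * (\<Sum>\<^sub>\<infinity>v\<in>scaled_rows G S. hom_term k 0 s (lattice_point \<tau> v))"
    unfolding spectral_series_eq_coset_sum[OF G(1) S \<tau>] coset_sum_disjoint[OF G(1) S disj] ..
  also have "\<dots> = (\<Sum>l\<in>residues_of N (scaled_rows G S). 1 / eps_level N * Eis_series k N l \<tau> s)"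
    by (rule sum_rows_Eis_series[OF N \<tau> k s cp scaled_rows_cong[OF G(1) S(1) G(2)]])
  finally show "spectral_series k G S x \<tau> s = (\<Sum>l\<in>residues_of N (scaled_rows G S). 1 / eps_level N * Eis_series k N l \<tau> s)" .
qed

section \<open>Counting cusps over a cusp\<close>

lemma cusps_eq: "cusps G = range (cusp_orbit G)"
  by (auto simp: cusps_def orbits_def)

lemma self_in_cusp_orbit: "subgroup G SL2Z \<Longrightarrow> y \<in> cusp_orbit G y"
  using SL2Z_subgroupD(4)[of G] unfolding cusp_orbit_eq by force

lemma row_act_principal_congruence:
  assumes "\<gamma> \<in> principal_congruence N"
  shows "[fst (row_act v \<gamma>) = fst v] (mod int N)" "[snd (row_act v \<gamma>) = snd v] (mod int N)"
proof -
  have c: "[\<gamma> $ 1 $ 1 = 1] (mod int N)" "[\<gamma> $ 1 $ 2 = 0] (mod int N)" "[\<gamma> $ 2 $ 1 = 0] (mod int N)" "[\<gamma> $ 2 $ 2 = 1] (mod int N)"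
    using assms by (auto simp: principal_congruence_mem)
  have "[fst v * \<gamma> $ 1 $ 1 + snd v * \<gamma> $ 2 $ 1 = fst v * 1 + snd v * 0] (mod int N)"
    by (intro cong_add cong_mult cong_refl c)
  then show "[fst (row_act v \<gamma>) = fst v] (mod int N)" by (simp add: row_act_def)
  have "[fst v * \<gamma> $ 1 $ 2 + snd v * \<gamma> $ 2 $ 2 = fst v * 0 + snd v * 1] (mod int N)"
    by (intro cong_add cong_mult cong_refl c)
  then show "[snd (row_act v \<gamma>) = snd v] (mod int N)" by (simp add: row_act_def)
qed

definition cong_pair :: "nat \<Rightarrow> int \<times> int \<Rightarrow> int \<times> int \<Rightarrow> bool" where
  "cong_pair N v w \<longleftrightarrow> [fst v = fst w] (mod int N) \<and> [snd v = snd w] (mod int N)"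

lemma cong_pair_sym: "cong_pair N v w \<Longrightarrow> cong_pair N w v"
  by (simp add: cong_pair_def cong_sym)

lemma cong_pair_minus: "cong_pair N v w \<Longrightarrow> cong_pair N (scale_pair (-1) v) (scale_pair (-1) w)"
  by (simp add: cong_pair_def scale_pair_def cong_minus_minus_iff)

text \<open>
  The classical description of the cusps of \<open>\<Gamma>(N)\<close> as coprime pairs modulo \<open>N\<close> up to sign, obtained
  from the correspondence of rows and orbits for the group \<open>\<Gamma>(N)\<close> itself.
\<close>

lemma principal_congruence_cusp_eq:
  assumes v: "coprime_pair v" and w: "coprime_pair w"
  shows "cusp_orbit (principal_congruence N) (pole v) = cusp_orbit (principal_congruence N) (pole w) \<longleftrightarrow>
    cong_pair N w v \<or> cong_pair N w (scale_pair (-1) v)"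
proof -
  let ?\<Gamma> = "principal_congruence N"
  note G = principal_congruence_subgroup[of N]
  obtain A where A: "A \<in> carrier SL2Z" "bot_row A = v" using exists_bot_row[OF v] .
  have S: "adj A \<in> carrier SL2Z" "proj_act (adj A) Infty = pole v"
    using A adj_closed pole_bot_row by auto
  have rows: "u \<in> scaled_rows ?\<Gamma> (adj A) \<longleftrightarrow> coprime_pair u \<and> cong_pair N u v" for u
  proof
    assume u: "u \<in> scaled_rows ?\<Gamma> (adj A)"
    then obtain \<gamma> where "\<gamma> \<in> ?\<Gamma>" "u = row_act v \<gamma>"
      by (auto simp: scaled_rows_def adj_adj bot_row_mult A(2))
    then show "coprime_pair u \<and> cong_pair N u v"
      using scaled_rows_coprime[OF G S(1) u] row_act_principal_congruence by (simp add: cong_pair_def)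
  next
    assume u: "coprime_pair u \<and> cong_pair N u v"
    then obtain \<gamma> where "\<gamma> \<in> ?\<Gamma>" "u = row_act v \<gamma>"
      using principal_congruence_transitive[OF v, of u N] by (auto simp: cong_pair_def)
    then show "u \<in> scaled_rows ?\<Gamma> (adj A)"
      by (auto simp: scaled_rows_def adj_adj bot_row_mult A(2))
  qed
  have "cusp_orbit ?\<Gamma> (pole v) = cusp_orbit ?\<Gamma> (pole w) \<longleftrightarrow> pole w \<in> cusp_orbit ?\<Gamma> (pole v)"
    using cusp_orbit_member_eq[OF G, of "pole w" "pole v"] self_in_cusp_orbit[OF G, of "pole w"] by auto
  also have "\<dots> \<longleftrightarrow> w \<in> signed_rows ?\<Gamma> (adj A)"
    by (rule pole_in_orbit_iff[OF G S w])
  also have "\<dots> \<longleftrightarrow> cong_pair N w v \<or> cong_pair N w (scale_pair (-1) v)"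
  proof
    assume "w \<in> signed_rows ?\<Gamma> (adj A)"
    then consider "w \<in> scaled_rows ?\<Gamma> (adj A)" | u where "u \<in> scaled_rows ?\<Gamma> (adj A)" "w = scale_pair (-1) u"
      unfolding signed_rows_def by blast
    then show "cong_pair N w v \<or> cong_pair N w (scale_pair (-1) v)"
    proof cases
      case 1 then show ?thesis using rows by blast
    next
      case 2 then show ?thesis using rows cong_pair_minus[of N u v] by blast
    qed
  next
    assume "cong_pair N w v \<or> cong_pair N w (scale_pair (-1) v)"
    then show "w \<in> signed_rows ?\<Gamma> (adj A)"
    proof
      assume "cong_pair N w v" then show ?thesis using rows w by (simp add: signed_rows_def)
    next
      assume "cong_pair N w (scale_pair (-1) v)"
      from cong_pair_minus[OF this] have "scale_pair (-1) w \<in> scaled_rows ?\<Gamma> (adj A)" using rows w by simp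
      then have "scale_pair (-1) (scale_pair (-1) w) \<in> signed_rows ?\<Gamma> (adj A)" unfolding signed_rows_def by blast
      then show ?thesis by simp
    qed
  qed
  finally show ?thesis .
qed

definition mod_pair :: "nat \<Rightarrow> int \<times> int \<Rightarrow> int \<times> int" where
  "mod_pair N v = (fst v mod int N, snd v mod int N)"

lemma mod_pair_eq_iff: "mod_pair N v = mod_pair N w \<longleftrightarrow> cong_pair N v w"
  by (auto simp: mod_pair_def cong_pair_def cong_def)

lemma residues_of_eq:
  assumes "N \<ge> 1"
  shows "residues_of N P = mod_pair N ` P"
proof -
  have "l = mod_pair N v" if "l \<in> {0..<int N} \<times> {0..<int N}" "v \<in> res_class N l" for l v
    using that by (auto simp: res_class_cong_iff cong_def mod_pair_def prod_eq_iff)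
  moreover have "mod_pair N v \<in> {0..<int N} \<times> {0..<int N}" "v \<in> res_class N (mod_pair N v)" for v
    using assms by (auto simp: res_class_cong_iff cong_def mod_pair_def)
  ultimately show ?thesis unfolding residues_of_def by blast
qed

text \<open>
  Both \<open>2 c\<close> and \<open>2 d\<close> are divisible by \<open>N\<close> only if \<open>N\<close> divides \<open>2\<close>.
\<close>

lemma self_opposite_iff:
  assumes v: "coprime_pair v" and N: "N \<ge> 1"
  shows "cong_pair N v (scale_pair (-1) v) \<longleftrightarrow> N \<le> 2"
proof -
  have "cong_pair N v (scale_pair (-1) v) \<longleftrightarrow> int N dvd 2 * fst v \<and> int N dvd 2 * snd v"
    by (simp add: cong_pair_def scale_pair_def cong_iff_dvd_diff)
  also have "\<dots> \<longleftrightarrow> int N dvd gcd (2 * fst v) (2 * snd v)" by simp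
  also have "gcd (2 * fst v) (2 * snd v) = 2" using v gcd_mult_distrib_int[of 2 "fst v" "snd v"] by simp
  also have "int N dvd 2 \<longleftrightarrow> N \<le> 2"
  proof
    assume "int N dvd 2" then show "N \<le> 2" using zdvd_imp_le by fastforce
  next
    assume "N \<le> 2" then have "N = 1 \<or> N = 2" using N by auto
    then show "int N dvd 2" by auto
  qed
  finally show ?thesis .
qed

text \<open>
  Residue classes of signed rows map onto the cusps of \<open>\<Gamma>(N)\<close> in the orbit of \<open>x\<close>, with fibres
  consisting of a class and its negative.
\<close>

lemma card_residues_eq_cusps:
  assumes G: "subgroup G SL2Z" "principal_congruence N \<subseteq> G" and S: "S \<in> carrier SL2Z" "proj_act S Infty = x"
    and N: "N \<ge> 1"
  shows "card (residues_of N (signed_rows G S)) = (if N \<le> 2 then 1 else 2) * card (cusps_inside G N x)"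
proof -
  let ?\<Gamma> = "principal_congruence N" and ?P = "signed_rows G S"
  note cp = signed_rows_coprime[OF G(1) S(1)]
  define L where "L = residues_of N ?P"
  have L: "L = mod_pair N ` ?P" unfolding L_def by (rule residues_of_eq[OF N])
  have fL: "finite L" unfolding L_def by (rule finite_residues_of)
  \<comment> \<open>A residue class has a cusp only through a coprime pair in it, so the map to cusps goes through lifts.\<close>
  define lift where "lift l = (SOME v. v \<in> ?P \<and> mod_pair N v = l)" for l
  have lift: "lift l \<in> ?P" "mod_pair N (lift l) = l" if "l \<in> L" for l
    using someI_ex[of "\<lambda>v. v \<in> ?P \<and> mod_pair N v = l"] that unfolding L lift_def by blast+
  define \<Phi> where "\<Phi> l = cusp_orbit ?\<Gamma> (pole (lift l))" for l
  have eq: "\<Phi> l = \<Phi> l' \<longleftrightarrow> l' = l \<or> l' = mod_pair N (scale_pair (-1) (lift l))" if "l \<in> L" "l' \<in> L" for l l'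
    unfolding \<Phi>_def principal_congruence_cusp_eq[OF cp[OF lift(1)[OF that(1)]] cp[OF lift(1)[OF that(2)]]]
      mod_pair_eq_iff[symmetric] lift(2)[OF that(1)] lift(2)[OF that(2)] ..
  have img: "\<Phi> ` L = cusps_inside G N x"
  proof
    show "\<Phi> ` L \<subseteq> cusps_inside G N x"
    proof
      fix Y assume "Y \<in> \<Phi> ` L"
      then obtain l where l: "l \<in> L" "Y = \<Phi> l" by blast
      have "pole (lift l) \<in> cusp_orbit G x"
        using pole_in_orbit_iff[OF G(1) S cp[OF lift(1)[OF l(1)]]] lift(1)[OF l(1)] by simp
      then have "cusp_orbit G (pole (lift l)) = cusp_orbit G x" by (rule cusp_orbit_member_eq[OF G(1)])
      then have "Y \<subseteq> cusp_orbit G x" unfolding l(2) \<Phi>_def using G(2) unfolding cusp_orbit_eq by blast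
      then show "Y \<in> cusps_inside G N x" unfolding cusps_inside_def cusps_eq l(2) \<Phi>_def by blast
    qed
    show "cusps_inside G N x \<subseteq> \<Phi> ` L"
    proof
      fix Y assume "Y \<in> cusps_inside G N x"
      then obtain y where y: "Y = cusp_orbit ?\<Gamma> y" "Y \<subseteq> cusp_orbit G x" by (auto simp: cusps_inside_def cusps_eq)
      obtain u where u: "coprime_pair u" "y = pt u" using pt_surj .
      define w where "w = (- snd u, fst u)"
      have w: "coprime_pair w" "y = pole w" using u by (simp_all add: w_def pole_def gcd.commute)
      have "y \<in> cusp_orbit G x" using y self_in_cusp_orbit[OF principal_congruence_subgroup] by blast
      then have wP: "w \<in> ?P" using pole_in_orbit_iff[OF G(1) S w(1)] w(2) by simp
      then have l: "mod_pair N w \<in> L" unfolding L by blast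
      have "\<Phi> (mod_pair N w) = Y"
        unfolding \<Phi>_def y(1) w(2) principal_congruence_cusp_eq[OF cp[OF lift(1)[OF l]] w(1)]
        using lift(2)[OF l] by (simp add: mod_pair_eq_iff cong_pair_sym)
      then show "Y \<in> \<Phi> ` L" using l by blast
    qed
  qed
  have fib: "card {l' \<in> L. \<Phi> l' = Y} = (if N \<le> 2 then 1 else 2)" if Y: "Y \<in> \<Phi> ` L" for Y
  proof -
    obtain l where l: "l \<in> L" "Y = \<Phi> l" using Y by blast
    let ?n = "mod_pair N (scale_pair (-1) (lift l))"
    have n: "?n \<in> L" unfolding L using signed_rows_minus[OF lift(1)[OF l(1)]] by blast
    have "\<Phi> l' = Y \<longleftrightarrow> l' = l \<or> l' = ?n" if "l' \<in> L" for l'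
      unfolding l(2) eq[OF l(1) that, symmetric] by blast
    then have "{l' \<in> L. \<Phi> l' = Y} = {l, ?n}" using l(1) n by blast
    moreover have "l = ?n \<longleftrightarrow> N \<le> 2"
    proof -
      have "l = ?n \<longleftrightarrow> mod_pair N (lift l) = ?n" using lift(2)[OF l(1)] by simp
      also have "\<dots> \<longleftrightarrow> N \<le> 2"
        unfolding mod_pair_eq_iff by (rule self_opposite_iff[OF cp[OF lift(1)[OF l(1)]] N])
      finally show ?thesis .
    qed
    ultimately show ?thesis by (auto simp: card_insert_if)
  qed
  have "card L = (\<Sum>Y\<in>\<Phi> ` L. card {l' \<in> L. \<Phi> l' = Y})"
    using sum.image_gen[OF fL, of "\<lambda>_. 1::nat" \<Phi>] by simp
  also have "\<dots> = (\<Sum>Y\<in>\<Phi> ` L. if N \<le> 2 then 1 else 2)" by (rule sum.cong[OF refl fib])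
  also have "\<dots> = (if N \<le> 2 then 1 else 2) * card (cusps_inside G N x)" unfolding img by simp
  finally show ?thesis unfolding L_def .
qed

section \<open>Regular cusps\<close>

text \<open>
  The matrix \<open>e T\<^sup>n\<close>, for \<open>e = \<plusminus> 1\<close>.
\<close>

definition signed_translation :: "int \<Rightarrow> int \<Rightarrow> int^2^2" where
  "signed_translation e n = mat22 e (e * n) 0 e"

lemma signed_translation_mult: "signed_translation e n ** signed_translation e' n' = signed_translation (e * e') (n + n')"
  by (simp add: signed_translation_def mat2_eq_iff mult_entry algebra_simps)

lemma adj_signed_translation: "adj (signed_translation e n) = signed_translation e (- n)"
  by (simp add: signed_translation_def mat2_eq_iff)

lemma signed_translation_one: "signed_translation 1 0 = mat 1"
  by (simp add: signed_translation_def mat2_eq_iff)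

lemma signed_translation_minus_one: "signed_translation (-1) 0 = - mat 1"
  by (simp add: signed_translation_def mat2_eq_iff)

lemma signed_translation_closed: "e = 1 \<or> e = -1 \<Longrightarrow> signed_translation e n \<in> carrier SL2Z"
  by (auto simp: signed_translation_def SL2Z_mem)

lemma T_mat_pow: "T_mat [^]\<^bsub>SL2Z\<^esub> (n::nat) = signed_translation 1 (int n)"
proof (induction n)
  case 0 then show ?case by (simp add: nat_pow_def signed_translation_one)
next
  case (Suc n)
  have T: "T_mat = signed_translation 1 1" by (simp add: T_mat_def signed_translation_def mat2_eq_iff)
  have "T_mat [^]\<^bsub>SL2Z\<^esub> Suc n = T_mat [^]\<^bsub>SL2Z\<^esub> n ** T_mat" by (simp add: nat_pow_def)
  also have "\<dots> = signed_translation 1 (int (Suc n))" unfolding Suc unfolding T signed_translation_mult by (simp add: add.commute)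
  finally show ?case .
qed

text \<open>
  The power \<open>e\<^sup>q\<close> for \<open>e = \<plusminus> 1\<close> and an arbitrary integer \<open>q\<close>.
\<close>

definition sgn_pow :: "int \<Rightarrow> int \<Rightarrow> int" where
  "sgn_pow e q = (if even q then 1 else e)"

lemma signed_translation_nat_pow: "signed_translation (-1) h [^]\<^bsub>SL2Z\<^esub> (n::nat) = signed_translation (sgn_pow (-1) (int n)) (int n * h)"
proof (induction n)
  case 0 then show ?case by (simp add: nat_pow_def signed_translation_one sgn_pow_def)
next
  case (Suc n)
  then show ?case by (simp add: nat_pow_def signed_translation_mult sgn_pow_def algebra_simps)
qed

lemma signed_translation_int_pow: "signed_translation (-1) h [^]\<^bsub>SL2Z\<^esub> (q::int) = signed_translation (sgn_pow (-1) q) (q * h)"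
proof (cases "q < 0")
  case False
  then show ?thesis by (simp add: int_pow_def2 signed_translation_nat_pow)
next
  case True
  have c: "signed_translation (sgn_pow (-1) (- q)) (- q * h) \<in> carrier SL2Z"
    by (rule signed_translation_closed) (simp add: sgn_pow_def)
  have "signed_translation (-1) h [^]\<^bsub>SL2Z\<^esub> q = inv\<^bsub>SL2Z\<^esub> (signed_translation (sgn_pow (-1) (- q)) (- q * h))"
    using True by (simp add: int_pow_def2 signed_translation_nat_pow)
  also have "\<dots> = signed_translation (sgn_pow (-1) q) (q * h)"
    unfolding inv_SL2Z[OF c] adj_signed_translation by (simp add: sgn_pow_def)
  finally show ?thesis .
qed

text \<open>
  Since \<open>- 1\<close> is not in \<open>H\<close>, each translation length occurs with one sign only. So \<open>H\<close> is generated by an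
  element \<open>e T\<^sup>h\<close> with the least positive length, by division with remainder; and \<open>e = 1\<close> is impossible,
  because then all signs would be positive.
\<close>

lemma signed_translation_group_cyclic:
  assumes one: "signed_translation 1 0 \<in> H" and mult: "\<And>A B. A \<in> H \<Longrightarrow> B \<in> H \<Longrightarrow> A ** B \<in> H"
    and adj: "\<And>A. A \<in> H \<Longrightarrow> adj A \<in> H"
    and form: "\<And>A. A \<in> H \<Longrightarrow> \<exists>e n. (e = 1 \<or> e = -1) \<and> A = signed_translation e n"
    and m1: "signed_translation (-1) 0 \<notin> H" and n0: "signed_translation (-1) n0 \<in> H"
  obtains h where "h \<ge> (1::nat)" "H = range (\<lambda>q. signed_translation (sgn_pow (-1) q) (q * int h))"
proof -
  define D where "D n \<longleftrightarrow> n \<ge> (1::nat) \<and> (\<exists>e. (e = 1 \<or> e = -1) \<and> signed_translation e (int n) \<in> H)" for n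
  have "n0 \<noteq> 0" using m1 n0 by metis
  moreover have "signed_translation (-1) (- n0) \<in> H" using adj[OF n0] by (simp add: adj_signed_translation)
  ultimately have "D (nat \<bar>n0\<bar>)"
    using n0 unfolding D_def by (cases "n0 \<ge> 0") (auto intro!: exI[of _ "-1"])
  define h where "h = (LEAST n. D n)"
  have Dh: "D h" unfolding h_def by (rule LeastI) fact
  have least: "h \<le> n" if "D n" for n unfolding h_def by (rule Least_le[of D n, OF that])
  have h1: "h \<ge> 1" using Dh by (simp add: D_def)
  obtain e where e: "e = 1 \<or> e = -1" "signed_translation e (int h) \<in> H" using Dh unfolding D_def by blast
  have pwn: "signed_translation (sgn_pow e (int n)) (int n * int h) \<in> H" for n
  proof (induction n)
    case 0 then show ?case using one by (simp add: sgn_pow_def)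
  next
    case (Suc n)
    have "sgn_pow e (int n) * e = sgn_pow e (int (Suc n))" using e(1) by (auto simp: sgn_pow_def)
    moreover have "int n * int h + int h = int (Suc n) * int h" by (simp add: algebra_simps)
    ultimately show ?case using mult[OF Suc e(2)] by (simp only: signed_translation_mult)
  qed
  have pw: "signed_translation (sgn_pow e q) (q * int h) \<in> H" for q
  proof (cases "q \<ge> 0")
    case True
    then show ?thesis using pwn[of "nat q"] by simp
  next
    case False
    then have "int (nat (- q)) = - q" by simp
    then have "signed_translation (sgn_pow e (- q)) (- q * int h) \<in> H" using pwn[of "nat (- q)"] by simp
    from adj[OF this] show ?thesis by (simp add: adj_signed_translation sgn_pow_def)
  qed
  have sq: "sgn_pow e q = 1 \<or> sgn_pow e q = -1" for q using e(1) by (auto simp: sgn_pow_def)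
  have divides: "signed_translation (f * sgn_pow e (n div int h)) 0 \<in> H \<and> n = (n div int h) * int h"
    if f: "f = 1 \<or> f = -1" "signed_translation f n \<in> H" for f n
  proof -
    let ?q = "n div int h"
    have "signed_translation f n ** adj (signed_translation (sgn_pow e ?q) (?q * int h)) \<in> H" by (rule mult[OF f(2) adj[OF pw]])
    then have r: "signed_translation (f * sgn_pow e ?q) (n mod int h) \<in> H"
      by (simp add: adj_signed_translation signed_translation_mult minus_div_mult_eq_mod)
    have "n mod int h = 0"
    proof (rule ccontr)
      assume "n mod int h \<noteq> 0"
      then have p: "n mod int h > 0" "n mod int h < int h" using h1 pos_mod_sign[of "int h" n] pos_mod_bound[of "int h" n] by linarith+
      have "f * sgn_pow e ?q = 1 \<or> f * sgn_pow e ?q = -1" using f(1) sq[of ?q] by auto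
      then have "D (nat (n mod int h))" using r p unfolding D_def by (intro conjI exI[of _ "f * sgn_pow e ?q"]) auto
      from least[OF this] p show False by linarith
    qed
    then show ?thesis using r by (simp add: dvd_div_mult_self mod_0_imp_dvd)
  qed
  have em: "e = -1"
  proof (rule ccontr)
    assume "e \<noteq> -1"
    then have "e = 1" using e by simp
    then show False using divides[of "-1" n0] n0 m1 by (simp add: sgn_pow_def)
  qed
  have "H = range (\<lambda>q. signed_translation (sgn_pow (-1) q) (q * int h))"
  proof
    show "range (\<lambda>q. signed_translation (sgn_pow (-1) q) (q * int h)) \<subseteq> H" using pw em by auto
    show "H \<subseteq> range (\<lambda>q. signed_translation (sgn_pow (-1) q) (q * int h))"
    proof
      fix A assume A: "A \<in> H"
      obtain f n where f: "f = 1 \<or> f = -1" "A = signed_translation f n" using form[OF A] by blast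
      let ?q = "n div int h"
      have d: "signed_translation (f * sgn_pow e ?q) 0 \<in> H" "n = ?q * int h" using divides[OF f(1)] A f(2) by auto
      have "f * sgn_pow e ?q \<noteq> -1" using d(1) m1 by metis
      then have "f = sgn_pow e ?q" using f(1) sq[of ?q] by auto
      then have "A = signed_translation (sgn_pow (-1) ?q) (?q * int h)" using f(2) d(2) em by simp
      then show "A \<in> range (\<lambda>q. signed_translation (sgn_pow (-1) q) (q * int h))" by blast
    qed
  qed
  with h1 show thesis by (rule that)
qed

text \<open>
  Two opposite rows belong to the same coset, and the element of the stabilizer that connects them is
  conjugate to some \<open>- T\<^sup>n\<close>. Then the conjugated stabilizer is generated by some \<open>- T\<^sup>h\<close>, that is, the cusp is
  irregular.
\<close>

lemma regular_cusp_rows_disjoint: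
  assumes G: "subgroup G SL2Z" and S: "S \<in> carrier SL2Z" "proj_act S Infty = x"
    and m1: "- mat 1 \<notin> G" and reg: "\<not> irregular_cusp G x"
  shows "scaled_rows G S \<inter> scale_pair (-1) ` scaled_rows G S = {}"
proof (rule ccontr)
  note g = SL2Z_subgroupD[OF G]
  assume "\<not> ?thesis"
  then obtain v where v: "v \<in> scaled_rows G S" "v \<in> scale_pair (-1) ` scaled_rows G S" by blast
  obtain B' where B': "B' \<in> G" "v = bot_row (adj S ** B')" using v(1) unfolding scaled_rows_def by blast
  obtain B where B: "B \<in> G" "v = scale_pair (-1) (bot_row (adj S ** B))" using v(2) unfolding scaled_rows_def by blast
  have B: "B \<in> G" "B' \<in> G" "bot_row (adj S ** B') = scale_pair (-1) (bot_row (adj S ** B))"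
    using B B' by simp_all
  let ?c = "\<lambda>h. adj S ** h ** S"
  define H where "H = ?c ` cusp_stab G x"
  have cG: "h \<in> G" if "h \<in> cusp_stab G x" for h using that by (simp add: cusp_stab_eq)
  have one: "signed_translation 1 0 \<in> H"
    unfolding H_def by (rule image_eqI[OF _ cusp_stab_closed(1)[OF G]]) (simp add: signed_translation_one adj_left[OF S(1)])
  have mult: "A ** A' \<in> H" if "A \<in> H" "A' \<in> H" for A A'
  proof -
    obtain h h' where h: "h \<in> cusp_stab G x" "h' \<in> cusp_stab G x" "A = ?c h" "A' = ?c h'" using \<open>A \<in> H\<close> \<open>A' \<in> H\<close> by (auto simp: H_def)
    have "A ** A' = adj S ** h ** (S ** adj S) ** h' ** S" unfolding h by (simp add: matrix_mul_assoc)
    also have "\<dots> = ?c (h ** h')" unfolding adj_right[OF S(1)] by (simp add: matrix_mul_assoc)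
    finally show ?thesis unfolding H_def using cusp_stab_closed(2)[OF G h(1,2)] by blast
  qed
  have adjH: "adj A \<in> H" if "A \<in> H" for A
  proof -
    obtain h where h: "h \<in> cusp_stab G x" "A = ?c h" using \<open>A \<in> H\<close> by (auto simp: H_def)
    have "adj A = ?c (adj h)" unfolding h(2) adj_mult adj_adj by (simp add: matrix_mul_assoc)
    then show ?thesis unfolding H_def using cusp_stab_closed(3)[OF G h(1)] by blast
  qed
  have form: "\<exists>e n. (e = 1 \<or> e = -1) \<and> A = signed_translation e n" if "A \<in> H" for A
  proof -
    obtain h where h: "h \<in> cusp_stab G x" "A = ?c h" using \<open>A \<in> H\<close> by (auto simp: H_def)
    have A: "A \<in> carrier SL2Z" unfolding h(2) by (intro SL2Z_mult_closed adj_closed S(1) g(1)[OF cG[OF h(1)]])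
    have A21: "A $ 2 $ 1 = 0" using cusp_stab_iff[OF G S cG[OF h(1)]] h by simp
    have "A = signed_translation (A $ 2 $ 2) (A $ 2 $ 2 * A $ 1 $ 2)"
      using lower_zero_SL2Z[OF A A21] A21 by (auto simp: signed_translation_def mat2_eq_iff)
    then show ?thesis using lower_zero_SL2Z[OF A A21] by blast
  qed
  have m1H: "signed_translation (-1) 0 \<notin> H"
  proof
    assume "signed_translation (-1) 0 \<in> H"
    then obtain h where h: "h \<in> cusp_stab G x" "signed_translation (-1) 0 = ?c h" by (auto simp: H_def)
    have "S ** signed_translation (-1) 0 ** adj S = (S ** adj S) ** h ** (S ** adj S)"
      unfolding h(2) by (simp add: matrix_mul_assoc)
    then have "S ** signed_translation (-1) 0 ** adj S = h" unfolding adj_right[OF S(1)] by simp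
    moreover have "S ** signed_translation (-1) 0 ** adj S = - mat 1"
    proof -
      have "S ** signed_translation (-1) 0 = signed_translation (-1) 0 ** S" by (simp add: signed_translation_def mat2_eq_iff mult_entry)
      then have "S ** signed_translation (-1) 0 ** adj S = signed_translation (-1) 0 ** (S ** adj S)" by (simp add: matrix_mul_assoc)
      then show ?thesis unfolding adj_right[OF S(1)] by (simp add: signed_translation_minus_one)
    qed
    ultimately show False using m1 cG[OF h(1)] by simp
  qed
  obtain h where h: "h \<in> cusp_stab G x" "B' = h ** B"
    using same_coset_iff[OF G S B(1,2)] B(3) by blast
  have "?c h \<in> H" unfolding H_def using h(1) by blast
  then obtain e n where en: "e = 1 \<or> e = -1" "?c h = signed_translation e n" using form by blast
  have "e = -1"
  proof (rule ccontr)
    assume "e \<noteq> -1"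
    then have "?c h = signed_translation 1 n" using en by simp
    moreover have "adj S ** B' = ?c h ** (adj S ** B)"
    proof -
      have "adj S ** B' = adj S ** h ** (S ** adj S) ** B"
        unfolding h(2) adj_right[OF S(1)] by (simp add: matrix_mul_assoc)
      then show ?thesis by (simp add: matrix_mul_assoc)
    qed
    ultimately have "bot_row (adj S ** B') = bot_row (adj S ** B)"
      unfolding bot_row_def by (simp add: mult_entry[of "signed_translation 1 n"]) (simp add: signed_translation_def)
    then have "fst (bot_row (adj S ** B)) = 0" "snd (bot_row (adj S ** B)) = 0"
      using B(3) by (simp_all add: scale_pair_def prod_eq_iff)
    moreover have "coprime_pair (bot_row (adj S ** B))"
      by (intro coprime_pair_bot_row SL2Z_mult_closed adj_closed S(1) g(1)[OF B(1)])
    ultimately show False by simp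
  qed
  then have n0: "signed_translation (-1) n \<in> H" using \<open>?c h \<in> H\<close> en(2) by simp
  obtain w where w: "w \<ge> (1::nat)" "H = range (\<lambda>q. signed_translation (sgn_pow (-1) q) (q * int w))"
    using signed_translation_group_cyclic[OF one mult adjH form m1H n0] .
  have gen: "generate SL2Z {- (T_mat [^]\<^bsub>SL2Z\<^esub> w)} = H"
  proof -
    have e: "- (T_mat [^]\<^bsub>SL2Z\<^esub> w) = signed_translation (-1) (int w)"
      unfolding T_mat_pow by (simp add: signed_translation_def mat2_eq_iff)
    show ?thesis unfolding e w(2)
      using group.generate_pow[OF group_SL2Z signed_translation_closed, of "-1" "int w"] by (auto simp: signed_translation_int_pow)
  qed
  have "(\<lambda>B. inv\<^bsub>SL2Z\<^esub> S \<otimes>\<^bsub>SL2Z\<^esub> B \<otimes>\<^bsub>SL2Z\<^esub> S) ` cusp_stab G x = generate SL2Z {- (T_mat [^]\<^bsub>SL2Z\<^esub> w)}"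
    unfolding gen H_def by (simp add: inv_SL2Z[OF S(1)])
  then have "irregular_cusp G x" unfolding irregular_cusp_def using S w(1) by blast
  with reg show False ..
qed

section \<open>The two claims\<close>

text \<open>
  In weight \<open>2\<close> all coefficients of \<open>E\<^bsub>2,x\<^esub>\<close> are equal, so their sum is proportional to the number of
  residue classes of rows and hence to the number of cusps of \<open>\<Gamma>(N)\<close> over \<open>x\<close>. The factor in the
  definition of the spectral basis is chosen to make the difference of these sums vanish.
\<close>

lemma spectral_basis_expansion:
  assumes k: "k \<ge> 2" and N: "N \<ge> 1" and G: "subgroup G SL2Z" "principal_congruence N \<subseteq> G"
    and choice: "spectral_choice G C S x0" and f: "f \<in> spectral_basis k N G C S x0"
  shows "has_Fourier_expansion_over (cyclotomic_field N) N f"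
proof -
  interpret complex_subfield "cyclotomic_field N" by (rule complex_subfield_cyclotomic)
  note z = root_of_unity_in_cyclotomic[of N]
  have S: "S x \<in> carrier SL2Z" "proj_act (S x) Infty = x" if "x \<in> C" for x
    using choice that by (auto simp: spectral_choice_def)
  have x0: "x0 \<in> C" using choice by (simp add: spectral_choice_def)
  have eps: "eps_level N \<in> cyclotomic_field N" "eps_level N \<noteq> 0"
    by (auto simp: eps_level_def intro!: mem_intros)
  consider "even k" "k \<ge> 4" | "odd k" | "k = 2" using k by force
  then show ?thesis
  proof cases
    case 1
    then obtain x where x: "x \<in> C" "f = spectral_Eis k G (S x) x" using f by (auto simp: spectral_basis_def)
    show ?thesis
    proof (rule Eis_combination_expansion[OF k N z finite_residues_of])
      show "f \<tau> = (\<Sum>l\<in>residues_of N (signed_rows G (S x)). 1 / (2 * eps_level N) * Eis k N l \<tau>)" if "Im \<tau> > 0" for \<tau>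
        unfolding x(2) by (rule spectral_Eis_even[OF G S[OF x(1)] N k 1(1) that])
      show "primitive_mod N l" if "l \<in> residues_of N (signed_rows G (S x))" for l
        by (rule residues_of_primitive[OF signed_rows_coprime[OF G(1) S(1)[OF x(1)]] that])
      show "1 / (2 * eps_level N) \<in> cyclotomic_field N" by (intro mem_intros eps)
    qed (use 1 in simp)
  next
    case 2
    have "- mat 1 \<notin> G" using f 2 by (auto simp: spectral_basis_def split: if_splits)
    then obtain x where x: "x \<in> C" "\<not> irregular_cusp G x" "f = spectral_Eis k G (S x) x"
      using f 2 by (auto simp: spectral_basis_def)
    note disj = regular_cusp_rows_disjoint[OF G(1) S[OF x(1)] \<open>- mat 1 \<notin> G\<close> x(2)]
    show ?thesis
    proof (rule Eis_combination_expansion[OF k N z finite_residues_of])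
      show "f \<tau> = (\<Sum>l\<in>residues_of N (scaled_rows G (S x)). 1 / eps_level N * Eis k N l \<tau>)" if "Im \<tau> > 0" for \<tau>
        unfolding x(3) by (rule spectral_Eis_disjoint[OF G S[OF x(1)] N k that disj])
      show "primitive_mod N l" if "l \<in> residues_of N (scaled_rows G (S x))" for l
        by (rule residues_of_primitive[OF scaled_rows_coprime[OF G(1) S(1)[OF x(1)]] that])
      show "1 / eps_level N \<in> cyclotomic_field N" by (intro mem_intros eps)
    qed (use 2 in auto)
  next
    case 3
    let ?n = "\<lambda>x. card (cusps_inside G N x)"
    let ?L = "\<lambda>x. residues_of N (signed_rows G (S x))"
    obtain x where x: "x \<in> C" "f = (\<lambda>\<tau>. spectral_Eis 2 G (S x) x \<tau> -
        of_nat (?n x) / of_nat (?n x0) * spectral_Eis 2 G (S x0) x0 \<tau>)"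
      using f 3 by (auto simp: spectral_basis_def)
    define \<rho> :: complex where "\<rho> = of_nat (?n x) / of_nat (?n x0)"
    define c where "c = 1 / (2 * eps_level N)"
    \<comment> \<open>Both series are written over the union of their residue classes.\<close>
    define a where "a l = c * (if l \<in> ?L x then 1 else 0) - \<rho> * (c * (if l \<in> ?L x0 then 1 else 0))" for l
    have fin: "finite (?L x \<union> ?L x0)" by (simp add: finite_residues_of)
    have split: "(\<Sum>l\<in>?L x \<union> ?L x0. a l * E l) = (\<Sum>l\<in>?L x. c * E l) - \<rho> * (\<Sum>l\<in>?L x0. c * E l)" for E :: "int \<times> int \<Rightarrow> complex"
    proof -
      have "(\<Sum>l\<in>?L x \<union> ?L x0. a l * E l) = (\<Sum>l\<in>?L x \<union> ?L x0. if l \<in> ?L x then c * E l else 0)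
          - \<rho> * (\<Sum>l\<in>?L x \<union> ?L x0. if l \<in> ?L x0 then c * E l else 0)"
        unfolding sum_distrib_left sum_subtractf[symmetric]
        by (rule sum.cong) (simp_all add: a_def algebra_simps)
      also have "(\<Sum>l\<in>?L x \<union> ?L x0. if l \<in> ?L x then c * E l else 0) = (\<Sum>l\<in>?L x. c * E l)"
        by (subst sum.inter_restrict[OF fin, symmetric]) (simp add: Int_absorb1)
      also have "(\<Sum>l\<in>?L x \<union> ?L x0. if l \<in> ?L x0 then c * E l else 0) = (\<Sum>l\<in>?L x0. c * E l)"
        by (subst sum.inter_restrict[OF fin, symmetric]) (simp add: Int_absorb1)
      finally show ?thesis .
    qed
    show ?thesis
    proof (rule Eis_combination_expansion[OF k N z fin])
      show "primitive_mod N l" if "l \<in> ?L x \<union> ?L x0" for l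
        using that residues_of_primitive[OF signed_rows_coprime[OF G(1) S(1)[OF x(1)]]]
          residues_of_primitive[OF signed_rows_coprime[OF G(1) S(1)[OF x0]]] by blast
      show "a l \<in> cyclotomic_field N" for l
        unfolding a_def \<rho>_def c_def by (intro mem_intros eps) (auto intro: mem_intros)
      show "f \<tau> = (\<Sum>l\<in>?L x \<union> ?L x0. a l * Eis k N l \<tau>)" if \<tau>: "Im \<tau> > 0" for \<tau>
        unfolding split x(2) c_def \<rho>_def
        using spectral_Eis_even[OF G S[OF x(1)] N order_refl _ \<tau>] spectral_Eis_even[OF G S[OF x0] N order_refl _ \<tau>] 3
        by simp
      have card: "card (?L y) = (if N \<le> 2 then 1 else 2) * ?n y" if "y \<in> C" for y
        by (rule card_residues_eq_cusps[OF G S[OF that] N])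
      have "?n x0 \<noteq> 0"
      proof -
        have "mat 1 \<in> G" by (rule SL2Z_subgroupD(4)[OF G(1)])
        then have "signed_rows G (S x0) \<noteq> {}" unfolding signed_rows_def scaled_rows_def by blast
        then have "?L x0 \<noteq> {}" using residues_of_eq[OF N] by simp
        then have "card (?L x0) \<noteq> 0" using finite_residues_of by simp
        then show ?thesis using card[OF x0] by simp
      qed
      then have "of_nat (card (?L x)) = \<rho> * of_nat (card (?L x0))"
        unfolding card[OF x(1)] card[OF x0] \<rho>_def by simp
      moreover have "(\<Sum>l\<in>?L x \<union> ?L x0. a l) = c * of_nat (card (?L x)) - \<rho> * (c * of_nat (card (?L x0)))"
        using split[of "\<lambda>_. 1"] by simp
      ultimately have "(\<Sum>l\<in>?L x \<union> ?L x0. a l) = 0" by simp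
      then show "f holomorphic_on {\<tau>. Im \<tau> > 0} \<or> (\<Sum>l\<in>?L x \<union> ?L x0. a l) = 0" ..
    qed
  qed
qed

theorem theorem5p5:
  fixes k N :: nat and G :: "(int^2^2) set" and K :: "complex set"
  assumes "k \<ge> 2" and "N \<ge> 1"
    and "congruence_subgroup G" and "principal_congruence N \<subseteq> G"
    and "subfield K complex_ring" and "cyclotomic_field N \<subseteq> K"
  shows "(\<forall>f\<in>Eis_space k N G K. has_Fourier_expansion_over K N f) \<and>
         (\<forall>C S x0. spectral_choice G C S x0 \<longrightarrow>
            (\<forall>f\<in>spectral_basis k N G C S x0.
               has_Fourier_expansion_over (cyclotomic_field N) N f))"
proof -
  have G: "subgroup G SL2Z" using assms(3) by (simp add: congruence_subgroup_def)
  show ?thesis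
    using Eis_space_expansion[OF assms(1,2,5,6)] spectral_basis_expansion[OF assms(1,2) G assms(4)] by blast
qed

end
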